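(* Let $k\ge 2$, $\epsilon>0$ and $1\le u\le 2$. For every $\epsilon$-locally differentially private mechanism $\mathbf{Q}$ with input alphabet $\{1,\dots,k\}$, $$\lim_{n\to\infty}\frac{r_{k,n}^{\ell_u^u}(\mathbf{Q})}{r_{k,n}^{\ell_u^u}(\mathbf{Q}_{k,\epsilon,d^\ast},\hat{\mathbf{p}})}\ge 1,$$ where $\hat{\mathbf p}$ is the empirical estimator associated with $\mathbf{Q}_{k,\epsilon,d^\ast}$.
   Context: Let $\mathcal{X}=\{1,\dots,k\}$ and $\Delta_k=\{\mathbf p\in\mathbb R^k: p_i\ge 0,\ \sum_i p_i=1\}$. A privatization mechanism $\mathbf Q:\mathcal X\to\mathcal Y$ is a conditional distribution (Markov kernel) from $\mathcal X$ to a measurable output space $\mathcal Y$; it is $\epsilon$-locally differentially private if $\mathbf Q(Y\in S\mid X=x)\le e^{\epsilon}\mathbf Q(Y\in S\mid X=x')$ for all $x,x'\in\mathcal X$ and all measurable $S$. Given $\mathbf p\in\Delta_k$, the privatized samples $Y^{(1)},\dots,Y^{(n)}$ are i.i.d. with distribution $\mathbf m(S)=\sum_{i=1}^k \mathbf Q(S\mid i)p_i$. An estimator is a measurable map $\hat{\mathbf p}:\mathcal Y^n\to\mathbb R^k$. For $x\in\mathbb R^k$, $\ell_u^u(x)=\sum_{i=1}^k|x_i|^u$, and $\ell_u^u(\hat{\mathbf p},\mathbf p)=\ell_u^u(\hat{\mathbf p}-\mathbf p)$. Define $r_{k,n}^{\ell_u^u}(\mathbf Q,\hat{\mathbf p})=\sup_{\mathbf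 p\in\Delta_k}\mathbb E_{Y^n\sim\mathbf m^n}\ell_u^u(\hat{\mathbf p}(Y^n),\mathbf p)$ and $r_{k,n}^{\ell_u^u}(\mathbf Q)=\inf_{\hat{\mathbf p}} r_{k,n}^{\ell_u^u}(\mathbf Q,\hat{\mathbf p})$. For $1\le d\le k-1$, let $\mathcal Y_{k,d}=\{y\in\{0,1\}^k:\sum_i y_i=d\}$ and define $\mathbf Q_{k,\epsilon,d}(y\mid i)=\frac{e^{\epsilon}y_i+(1-y_i)}{\binom{k-1}{d-1}e^{\epsilon}+\binom{k-1}{d}}$ for $y\in\mathcal Y_{k,d}$, $i\in\mathcal X$. The empirical estimator for $\mathbf Q_{k,\epsilon,d}$ is, for $y^n=(y^{(1)},\dots,y^{(n)})\in\mathcal Y_{k,d}^n$, $\hat p_i(y^n)=\frac{(k-1)e^{\epsilon}+\frac{(k-1)(k-d)}{d}}{(k-d)(e^{\epsilon}-1)}\cdot\frac{t_i(y^n)}{n}-\frac{(d-1)e^{\epsilon}+k-d}{(k-d)(e^{\epsilon}-1)}$, where $t_i(y^n)=\sum_{j=1}^n y^{(j)}_i$. Let $d^\ast\in\arg\min_{1\le d\le k-1}\frac{(de^{\epsilon}+k-d)^2}{d(k-d)}$ (ties broken arbitrarily). *)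

theory Defs
  imports "HOL-Probability.Probability"
begin

definition prob_simplex :: "nat \<Rightarrow> (nat \<Rightarrow> real) set" where
  "prob_simplex k = {p. (\<forall>i\<in>{1..k}. 0 \<le> p i) \<and> (\<Sum>i=1..k. p i) = 1 \<and> (\<forall>i. i \<notin> {1..k} \<longrightarrow> p i = 0)}"

definition mechanism :: "nat \<Rightarrow> 'b measure \<Rightarrow> (nat \<Rightarrow> 'b measure) \<Rightarrow> bool" where
  "mechanism k M Q \<longleftrightarrow> (\<forall>i\<in>{1..k}. prob_space (Q i) \<and> sets (Q i) = sets M)"

definition ldp :: "nat \<Rightarrow> real \<Rightarrow> 'b measure \<Rightarrow> (nat \<Rightarrow> 'b measure) \<Rightarrow> bool" where
  "ldp k \<epsilon> M Q \<longleftrightarrow>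
     (\<forall>x\<in>{1..k}. \<forall>x'\<in>{1..k}. \<forall>S\<in>sets M. measure (Q x) S \<le> exp \<epsilon> * measure (Q x') S)"

definition mix :: "nat \<Rightarrow> 'b measure \<Rightarrow> (nat \<Rightarrow> 'b measure) \<Rightarrow> (nat \<Rightarrow> real) \<Rightarrow> 'b measure" where
  "mix k M Q p = measure_of (space M) (sets M) (\<lambda>S. \<Sum>i=1..k. ennreal (p i) * emeasure (Q i) S)"

definition lu :: "real \<Rightarrow> nat \<Rightarrow> (nat \<Rightarrow> real) \<Rightarrow> real" where
  "lu u k x = (\<Sum>i=1..k. \<bar>x i\<bar> powr u)"

definition estimators :: "nat \<Rightarrow> nat \<Rightarrow> 'b measure \<Rightarrow> ((nat \<Rightarrow> 'b) \<Rightarrow> nat \<Rightarrow> real) set" where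
  "estimators k n M = {e. \<forall>i\<in>{1..k}. (\<lambda>y. e y i) \<in> borel_measurable (PiM {..<n} (\<lambda>_. M))}"

definition risk :: "nat \<Rightarrow> nat \<Rightarrow> real \<Rightarrow> 'b measure \<Rightarrow> (nat \<Rightarrow> 'b measure)
                    \<Rightarrow> ((nat \<Rightarrow> 'b) \<Rightarrow> nat \<Rightarrow> real) \<Rightarrow> ennreal" where
  "risk k n u M Q e = (SUP p\<in>prob_simplex k.
      \<integral>\<^sup>+ y. ennreal (lu u k (\<lambda>i. e y i - p i)) \<partial>(PiM {..<n} (\<lambda>_. mix k M Q p)))"

definition minimax_risk :: "nat \<Rightarrow> nat \<Rightarrow> real \<Rightarrow> 'b measure \<Rightarrow> (nat \<Rightarrow> 'b measure) \<Rightarrow> ennreal" where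
  "minimax_risk k n u M Q = (INF e\<in>estimators k n M. risk k n u M Q e)"

definition Ykd :: "nat \<Rightarrow> nat \<Rightarrow> (nat \<Rightarrow> nat) set" where
  "Ykd k d = {y. (\<forall>i\<in>{1..k}. y i \<in> {0,1}) \<and> (\<forall>i. i \<notin> {1..k} \<longrightarrow> y i = 0) \<and> (\<Sum>i=1..k. y i) = d}"

definition Ykd_space :: "nat \<Rightarrow> nat \<Rightarrow> (nat \<Rightarrow> nat) measure" where
  "Ykd_space k d = count_space (Ykd k d)"

definition Qkd :: "nat \<Rightarrow> real \<Rightarrow> nat \<Rightarrow> nat \<Rightarrow> (nat \<Rightarrow> nat) measure" where
  "Qkd k \<epsilon> d i = point_measure (Ykd k d)
     (\<lambda>y. ennreal ((exp \<epsilon> * real (y i) + (1 - real (y i))) /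
                   (real ((k - 1) choose (d - 1)) * exp \<epsilon> + real ((k - 1) choose d))))"

definition emp_est :: "nat \<Rightarrow> real \<Rightarrow> nat \<Rightarrow> nat \<Rightarrow> (nat \<Rightarrow> nat \<Rightarrow> nat) \<Rightarrow> nat \<Rightarrow> real" where
  "emp_est k \<epsilon> d n y i =
     ((real (k - 1) * exp \<epsilon> + real (k - 1) * real (k - d) / real d) / (real (k - d) * (exp \<epsilon> - 1)))
       * (real (\<Sum>j<n. y j i) / real n)
     - (real (d - 1) * exp \<epsilon> + real (k - d)) / (real (k - d) * (exp \<epsilon> - 1))"

definition dstar_obj :: "nat \<Rightarrow> real \<Rightarrow> nat \<Rightarrow> real" where
  "dstar_obj k \<epsilon> d = (real d * exp \<epsilon> + real k - real d)^2 / (real d * (real k - real d))"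

end

theory Submission
  imports Defs "HOL-Combinatorics.Permutations"
begin

text \<open>
  Both risks are of order \<open>n powr (- u / 2)\<close>, and the leading constants are compared. Locally around the uniform
  distribution, at scale \<open>1 / sqrt n\<close>, every mechanism yields an asymptotically Gaussian experiment. Under a product
  prior that is uniform on a large cube, the loss in coordinate \<open>i\<close> is bounded below by a one-dimensional problem with
  Fisher information \<open>I i\<close>, which costs \<open>(I i) powr (- u / 2)\<close> times the \<open>u\<close>-th absolute Gaussian moment. Because the
  scores are bounded, the likelihood ratio can be replaced by its Gaussian approximation in \<open>L\<^sup>2\<close>. The privacy constraint
  bounds \<open>\<Sum>i. I i\<close>: it is the mean of a convex function of the vector of densities, which is maximal when these take
  only two values with ratio \<open>exp \<epsilon>\<close>; this gives the minimum over \<open>d\<close> that defines \<open>ds\<close>. By convexity of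
  \<open>x powr (- u / 2)\<close> the sum of the one-dimensional costs is smallest when all \<open>I i\<close> agree.

  For the empirical estimator the central limit theorem together with exponential moments gives the risk of every
  coordinate uniformly in \<open>p\<close>, and concavity of \<open>x powr (u / 2)\<close> shows that the uniform distribution is the worst case,
  with the same constant.
\<close>

text \<open>The obstacle is uniformity. Hence the one-dimensional bound has to hold from some
  \<open>n\<close> on for all probability measures and all bounded scores at once, and every limit
  theorem is proved for triangular arrays whose variances need not converge. Origin of the
  constants: moving coordinate \<open>i\<close> of the prior by \<open>t\<close> shifts
  \<open>p i\<close> by \<open>(k - 1) / k * s i * t / sqrt n\<close>, where \<open>s i\<close> is
  nearly the inverse root of the information; this gives
  \<open>((k - 1) / k) powr u * c powr (- u / 2)\<close> per coordinate, with \<open>c\<close> equal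
  to \<open>(exp \<epsilon> - 1)^2\<close> divided by the minimum of \<open>dstar_obj\<close>. For
  the estimator, at uniform \<open>p\<close> a coordinate has variance
  \<open>d / k * (1 - d / k)\<close> divided by \<open>(pa - pb)^2\<close>. Both agree because
  \<open>(pa - pb)^2 * ((k - 1) / k)^2 = d / k * (1 - d / k) * c\<close>.\<close>

abbreviation gauss :: "real measure" where
  "gauss \<equiv> std_normal_distribution"

abbreviation iid :: "nat \<Rightarrow> 'b measure \<Rightarrow> (nat \<Rightarrow> 'b) measure" where
  "iid n m \<equiv> PiM {..<n} (\<lambda>_. m)"

text \<open>The derivative of a one-parameter family at \<open>m\<close>. The bound holds at every
  point and with a constant named in advance, which makes all Taylor remainders below uniform over
  experiments.\<close>

definition score :: "real \<Rightarrow> 'b measure \<Rightarrow> ('b \<Rightarrow> real) \<Rightarrow> bool" where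
  "score B m f \<longleftrightarrow> prob_space m \<and> f \<in> borel_measurable m \<and> (\<forall>y. \<bar>f y\<bar> \<le> B) \<and> (\<integral>y. f y \<partial>m) = 0"

definition nsum :: "nat \<Rightarrow> ('b \<Rightarrow> real) \<Rightarrow> (nat \<Rightarrow> 'b) \<Rightarrow> real" where
  "nsum n f y = (\<Sum>j<n. f (y j) / sqrt (real n))"

section \<open>A central limit theorem for triangular arrays of bounded scores\<close>

text \<open>Division by \<open>R\<close> moves both numbers into the unit disc, where
  \<open>norm_power_diff\<close> applies; the factor \<open>1 / R\<close> left over is at most
  1.\<close>

lemma norm_power_diff_bounded:
  fixes z w :: complex
  assumes "norm z \<le> R" "norm w \<le> R" "R \<ge> 1"
  shows "norm (z ^ n - w ^ n) \<le> R ^ n * (real n * norm (z - w))"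
proof -
  have R: "R > 0" using assms by simp
  have "norm ((z / R) ^ n - (w / R) ^ n) \<le> real n * norm (z / R - w / R)"
    using assms R by (intro norm_power_diff) (auto simp: norm_divide)
  also have "norm (z / R - w / R) = norm (z - w) / R"
    using R by (simp add: norm_divide flip: diff_divide_distrib)
  also have "\<dots> \<le> norm (z - w)"
    using assms by (simp add: divide_le_eq mult_le_cancel_left1)
  finally have "norm ((z / R) ^ n - (w / R) ^ n) \<le> real n * norm (z - w)"
    by (simp add: mult_left_mono)
  moreover have "norm ((z / R) ^ n - (w / R) ^ n) = norm (z ^ n - w ^ n) / R ^ n"
    using R by (simp add: power_divide norm_divide norm_power flip: diff_divide_distrib)
  ultimately show ?thesis using R by (simp add: divide_le_eq mult.commute)
qed

lemma norm_exp_minus_linear: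
  fixes z :: complex
  assumes "norm z \<le> D"
  shows "norm (exp z - 1 - z) \<le> exp D * norm z ^ 2"
proof -
  have "norm (exp z - (\<Sum>k\<le>1. z ^ k / fact k)) \<le> exp \<bar>Re z\<bar> * (norm z ^ Suc 1) / fact 1"
    by (rule Taylor_exp)
  then have "norm (exp z - 1 - z) \<le> exp \<bar>Re z\<bar> * norm z ^ 2"
    by (simp add: diff_diff_eq power2_eq_square)
  also have "\<dots> \<le> exp D * norm z ^ 2"
    using assms abs_Re_le_cmod[of z] by (intro mult_right_mono) auto
  finally show ?thesis .
qed

text \<open>The exponents \<open>c n\<close> are only bounded, since the variances of a triangular
  array need not converge. With \<open>d n = n * (\<alpha> n - 1)\<close>, the numbers
  \<open>1 + d n / n\<close> and \<open>exp (d n / n)\<close> differ by O(1 / n^2), hence their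
  \<open>n\<close>-th powers by O(1 / n); afterwards \<open>exp (d n)\<close> is compared with
  \<open>exp (c n)\<close>.\<close>

lemma power_minus_exp_tendsto_0:
  fixes \<alpha> c :: "nat \<Rightarrow> complex"
  assumes lim: "(\<lambda>n. of_nat n * (\<alpha> n - 1) - c n) \<longlonglongrightarrow> 0" and c: "\<And>n. norm (c n) \<le> C"
  shows "(\<lambda>n. \<alpha> n ^ n - exp (c n)) \<longlonglongrightarrow> 0"
proof -
  define d where "d n = of_nat n * (\<alpha> n - 1)" for n
  define D where "D = C + 1"
  have C0: "C \<ge> 0" using c[of 0] norm_ge_zero order_trans by blast
  have "\<forall>\<^sub>F n in sequentially. norm (d n - c n) < 1"
    using lim[unfolded tendsto_iff, rule_format, of 1] by (simp add: d_def)
  then have dD: "\<forall>\<^sub>F n in sequentially. norm (d n) \<le> D"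
  proof eventually_elim
    case (elim n)
    then show ?case using norm_triangle_sub[of "d n" "c n"] c[of n] by (simp add: D_def norm_minus_commute)
  qed
  have b: "\<forall>\<^sub>F n in sequentially. norm (\<alpha> n ^ n - exp (d n)) \<le> exp D * exp D * D\<^sup>2 / real n"
    using dD eventually_gt_at_top[of 0]
  proof eventually_elim
    case (elim n)
    define z where "z = d n / of_nat n"
    have n: "real n \<ge> 1" using elim by simp
    have D1: "D \<ge> 0" using C0 by (simp add: D_def)
    have \<alpha>: "\<alpha> n = 1 + z" using elim by (simp add: z_def d_def)
    have nz: "norm z \<le> D / real n" using elim by (simp add: z_def norm_divide divide_right_mono)
    have zD: "norm z \<le> D" using nz n D1 by (smt (verit) divide_le_eq mult_le_cancel_left1)
    \<comment> \<open>\<open>R\<close> dominates both \<open>1 + z\<close> and \<open>exp z\<close>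
      in norm, and its \<open>n\<close>-th power is the constant \<open>exp D\<close>.\<close>
    define R where "R = exp (D / real n)"
    have R1: "R \<ge> 1" using D1 by (simp add: R_def)
    have "norm (\<alpha> n) \<le> 1 + norm z" unfolding \<alpha> by (metis norm_one norm_triangle_ineq)
    also have "\<dots> \<le> R" using nz exp_ge_add_one_self[of "D / real n"] unfolding R_def by linarith
    finally have a: "norm (\<alpha> n) \<le> R" .
    have e: "norm (exp z) \<le> R" unfolding R_def using nz norm_exp[of z] by (meson exp_le_cancel_iff order_trans)
    have Rn: "R ^ n = exp D" using elim by (simp add: R_def exp_of_nat_mult[symmetric])
    have dz: "exp (d n) = exp z ^ n" using elim by (simp add: z_def exp_of_nat_mult[symmetric])
    have "norm (\<alpha> n ^ n - exp (d n)) \<le> R ^ n * (real n * norm (\<alpha> n - exp z))"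
      unfolding dz by (rule norm_power_diff_bounded[OF a e R1])
    also have "norm (\<alpha> n - exp z) = norm (exp z - 1 - z)"
      unfolding \<alpha> by (metis diff_diff_eq norm_minus_commute)
    also have "\<dots> \<le> exp D * norm z ^ 2" by (rule norm_exp_minus_linear[OF zD])
    also have "norm z ^ 2 \<le> (D / real n)^2" using nz by (intro power_mono) auto
    finally have "norm (\<alpha> n ^ n - exp (d n)) \<le> R ^ n * (real n * (exp D * (D / real n)^2))"
      by (simp add: mult_left_mono Rn)
    also have "\<dots> = exp D * exp D * D\<^sup>2 / real n" unfolding Rn using elim by (simp add: power2_eq_square field_simps)
    finally show ?case .
  qed
  have 1: "(\<lambda>n. \<alpha> n ^ n - exp (d n)) \<longlonglongrightarrow> 0"
    by (rule Lim_null_comparison[OF b]) (rule lim_const_over_n)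
  have dc: "(\<lambda>n. exp (d n - c n) - 1) \<longlonglongrightarrow> 0"
    using tendsto_diff[OF tendsto_exp[OF lim] tendsto_const[of 1]] by (simp add: d_def)
  have "(\<lambda>n. exp (c n) * (exp (d n - c n) - 1)) \<longlonglongrightarrow> 0"
  proof (rule Lim_null_comparison)
    show "\<forall>\<^sub>F n in sequentially. norm (exp (c n) * (exp (d n - c n) - 1)) \<le> exp C * norm (exp (d n - c n) - 1)"
    proof (rule always_eventually, rule allI)
      fix n
      have "norm (exp (c n)) \<le> exp C" using norm_exp[of "c n"] c[of n] by (meson exp_le_cancel_iff order_trans)
      then show "norm (exp (c n) * (exp (d n - c n) - 1)) \<le> exp C * norm (exp (d n - c n) - 1)"
        unfolding norm_mult by (intro mult_right_mono) auto
    qed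
    show "(\<lambda>n. exp C * norm (exp (d n - c n) - 1)) \<longlonglongrightarrow> 0"
      using tendsto_mult_right_zero[OF tendsto_norm_zero[OF dc]] .
  qed
  then have 2: "(\<lambda>n. exp (d n) - exp (c n)) \<longlonglongrightarrow> 0"
    by (simp add: right_diff_distrib flip: exp_add)
  show ?thesis using tendsto_add[OF 1 2] by simp
qed

lemma scoreD:
  assumes "score B m f"
  shows "prob_space m" "f \<in> borel_measurable m" "\<And>y. \<bar>f y\<bar> \<le> B" "(\<integral>y. f y \<partial>m) = 0" "B \<ge> 0"
    "integrable m f" "integrable m (\<lambda>y. (f y)\<^sup>2)" "(\<integral>y. (f y)\<^sup>2 \<partial>m) \<le> B\<^sup>2"  "(\<integral>y. (f y)\<^sup>2 \<partial>m) \<ge> 0"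
proof -
  show p: "prob_space m" and [measurable]: "f \<in> borel_measurable m" and b: "\<And>y. \<bar>f y\<bar> \<le> B" and "(\<integral>y. f y \<partial>m) = 0"
    using assms by (auto simp: score_def)
  interpret prob_space m by fact
  show "B \<ge> 0" using b[of undefined] by simp
  show "integrable m f" by (rule integrable_const_bound[where B=B]) (auto simp: b)
  have b2: "(f y)\<^sup>2 \<le> B\<^sup>2" for y using power_mono[OF b, of y 2] by simp
  show i: "integrable m (\<lambda>y. (f y)\<^sup>2)" by (rule integrable_const_bound[where B="B\<^sup>2"]) (auto simp: b2)
  have "(\<integral>y. (f y)\<^sup>2 \<partial>m) \<le> (\<integral>y. B\<^sup>2 \<partial>m)" by (intro integral_mono i) (auto simp: b2)
  then show "(\<integral>y. (f y)\<^sup>2 \<partial>m) \<le> B\<^sup>2" by (simp add: prob_space)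
  show "(\<integral>y. (f y)\<^sup>2 \<partial>m) \<ge> 0" by simp
qed

text \<open>The linear term vanishes because a score is centred, the quadratic one gives the
  variance over \<open>n\<close>, and the cubic remainder is of order
  \<open>n powr (- 3 / 2)\<close>, so it disappears even after multiplication by \<open>n\<close>.
  \<open>H\<close> is left open to serve characteristic functions, likelihood factors and
  exponentials alike.\<close>

lemma expansion_integrable:
  fixes H :: "real \<Rightarrow> complex" and a b :: complex
  assumes s: "score B m f" and [measurable]: "H \<in> borel_measurable borel"
    and exp: "\<And>x. \<bar>x\<bar> \<le> B \<Longrightarrow> norm (H x - (1 + a * x + b * x\<^sup>2)) \<le> C * \<bar>x\<bar> ^ 3"
    and C: "C \<ge> 0" and n: "n > 0"
  shows "integrable m (\<lambda>y. H (f y / sqrt (real n)))"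
    and "norm (of_nat n * ((\<integral>y. H (f y / sqrt (real n)) \<partial>m) - 1) - b * (\<integral>y. (f y)\<^sup>2 \<partial>m)) \<le> C * B ^ 3 / sqrt (real n)"
proof -
  interpret prob_space m using scoreD[OF s] by simp
  note [measurable] = scoreD(2)[OF s]
  note fb = scoreD(3)[OF s]
  have sn: "sqrt (real n) \<ge> 1" using n by simp
  have B: "B \<ge> 0" by (rule scoreD[OF s])
  have fn: "\<bar>f y / sqrt (real n)\<bar> \<le> B / sqrt (real n)" for y using fb[of y] sn by (simp add: abs_divide divide_right_mono)
  have "B / sqrt (real n) \<le> B" using sn B by (simp add: divide_le_eq mult_le_cancel_left1)
  then have fB: "\<bar>f y / sqrt (real n)\<bar> \<le> B" for y using fn[of y] by linarith
  define g where "g y = H (f y / sqrt (real n)) - (1 + a * complex_of_real (f y / sqrt (real n)) + b * complex_of_real ((f y)\<^sup>2 / real n))" for y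
  have sq: "complex_of_real ((f y)\<^sup>2 / real n) = (complex_of_real (f y / sqrt (real n)))\<^sup>2" for y
    by (simp add: power_divide flip: of_real_power)
  have CB: "C * \<bar>f y / sqrt (real n)\<bar> ^ 3 \<le> C * B ^ 3 / (real n * sqrt (real n))" for y
  proof -
    have "\<bar>f y / sqrt (real n)\<bar> ^ 3 \<le> (B / sqrt (real n)) ^ 3" by (intro power_mono fn) simp
    also have "\<dots> = B ^ 3 / (real n * sqrt (real n))" by (simp add: power_divide power3_eq_cube)
    finally show ?thesis using C by (metis mult_left_mono times_divide_eq_right)
  qed
  have gb: "norm (g y) \<le> C * B ^ 3 / (real n * sqrt (real n))" for y
    using exp[OF fB[of y]] CB[of y] unfolding g_def sq of_real_power by linarith
  have [measurable]: "g \<in> borel_measurable m" unfolding g_def by measurable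
  have gi: "integrable m g" by (rule integrable_const_bound[where B="C * B ^ 3 / (real n * sqrt (real n))"]) (auto simp: gb)
  have i1: "integrable m (\<lambda>y. complex_of_real (f y / sqrt (real n)))" using scoreD(6)[OF s] by simp
  have i2: "integrable m (\<lambda>y. complex_of_real ((f y)\<^sup>2 / real n))" using scoreD(7)[OF s] by (simp del: of_real_power)
  have H: "H (f y / sqrt (real n)) = g y + (1 + a * complex_of_real (f y / sqrt (real n)) + b * complex_of_real ((f y)\<^sup>2 / real n))" for y
    by (simp add: g_def)
  have e1: "(\<integral>y. complex_of_real (f y / sqrt (real n)) \<partial>m) = 0"
    using scoreD(4)[OF s] by (simp only: integral_complex_of_real) simp
  have e2: "(\<integral>y. complex_of_real ((f y)\<^sup>2 / real n) \<partial>m) = (\<integral>y. (f y)\<^sup>2 \<partial>m) / n"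
    by (simp only: integral_complex_of_real) simp
  have hb: "has_bochner_integral m (\<lambda>_. 1::complex) 1"
    using has_bochner_integral_integrable[of m "\<lambda>_. 1::complex"] by (simp add: prob_space)
  have hg: "has_bochner_integral m g (\<integral>y. g y \<partial>m)" using gi by (rule has_bochner_integral_integrable)
  have h1: "has_bochner_integral m (\<lambda>y. complex_of_real (f y / sqrt (real n))) 0"
    using has_bochner_integral_integrable[OF i1] unfolding e1 .
  have h2: "has_bochner_integral m (\<lambda>y. complex_of_real ((f y)\<^sup>2 / real n)) ((\<integral>y. (f y)\<^sup>2 \<partial>m) / n)"
    using has_bochner_integral_integrable[OF i2] unfolding e2 .
  have hH: "has_bochner_integral m (\<lambda>y. H (f y / sqrt (real n))) ((\<integral>y. g y \<partial>m) + (1 + a * 0 + b * complex_of_real ((\<integral>y. (f y)\<^sup>2 \<partial>m) / n)))"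
    unfolding H by (rule has_bochner_integral_add[OF hg has_bochner_integral_add[OF has_bochner_integral_add[OF hb has_bochner_integral_mult_right[OF h1]] has_bochner_integral_mult_right[OF h2]]])
  then show "integrable m (\<lambda>y. H (f y / sqrt (real n)))" unfolding has_bochner_integral_iff by simp
  have "(\<integral>y. H (f y / sqrt (real n)) \<partial>m) = (\<integral>y. g y \<partial>m) + (1 + a * 0 + b * complex_of_real ((\<integral>y. (f y)\<^sup>2 \<partial>m) / n))"
    using hH by (rule has_bochner_integral_integral_eq)
  then have eq: "of_nat n * ((\<integral>y. H (f y / sqrt (real n)) \<partial>m) - 1) - b * (\<integral>y. (f y)\<^sup>2 \<partial>m) = of_nat n * (\<integral>y. g y \<partial>m)"
    using n by (simp add: field_simps)
  have "norm (\<integral>y. g y \<partial>m) \<le> (\<integral>y. norm (g y) \<partial>m)" by simp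
  also have "\<dots> \<le> (\<integral>y. C * B ^ 3 / (real n * sqrt (real n)) \<partial>m)" using gb gi by (intro integral_mono) auto
  also have "\<dots> = C * B ^ 3 / (real n * sqrt (real n))" by (simp add: prob_space)
  finally have "real n * norm (\<integral>y. g y \<partial>m) \<le> real n * (C * B ^ 3 / (real n * sqrt (real n)))"
    by (intro mult_left_mono) auto
  also have "\<dots> = C * B ^ 3 / sqrt (real n)" using n by simp
  finally show "norm (of_nat n * ((\<integral>y. H (f y / sqrt (real n)) \<partial>m) - 1) - b * (\<integral>y. (f y)\<^sup>2 \<partial>m)) \<le> C * B ^ 3 / sqrt (real n)"
    unfolding eq norm_mult by simp
qed

lemma power_expectation_tendsto:
  fixes H :: "real \<Rightarrow> complex" and a b :: complex
  assumes s: "\<And>n. score B (m n) (f n)" and H: "H \<in> borel_measurable borel"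
    and exp: "\<And>x. \<bar>x\<bar> \<le> B \<Longrightarrow> norm (H x - (1 + a * x + b * x\<^sup>2)) \<le> C * \<bar>x\<bar> ^ 3" and C: "C \<ge> 0"
  shows "(\<lambda>n. (\<integral>y. H (f n y / sqrt (real n)) \<partial>m n) ^ n - exp (b * (\<integral>y. (f n y)\<^sup>2 \<partial>m n))) \<longlonglongrightarrow> 0"
proof (rule power_minus_exp_tendsto_0)
  have l: "(\<lambda>n. C * B ^ 3 / sqrt (real n)) \<longlonglongrightarrow> 0"
    by (intro real_tendsto_divide_at_top[OF tendsto_const]
         filterlim_compose[OF sqrt_at_top filterlim_real_sequentially])
  show "(\<lambda>n. of_nat n * ((\<integral>y. H (f n y / sqrt (real n)) \<partial>m n) - 1) - b * (\<integral>y. (f n y)\<^sup>2 \<partial>m n)) \<longlonglongrightarrow> 0"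
    by (rule Lim_null_comparison[OF _ l])
       (use eventually_gt_at_top[of 0] in eventually_elim, rule expansion_integrable(2)[OF s H exp C])
  show "norm (b * complex_of_real (\<integral>y. (f n y)\<^sup>2 \<partial>m n)) \<le> norm b * B\<^sup>2" for n
    using scoreD(8,9)[OF s] by (simp add: norm_mult mult_left_mono)
qed

lemma PiM_integral_prod:
  fixes g :: "'b \<Rightarrow> 'c::{real_normed_field,banach,second_countable_topology}"
  assumes "prob_space m" "integrable m g"
  shows "(\<integral>y. (\<Prod>j<n. g (y j)) \<partial>iid n m) = (\<integral>y. g y \<partial>m) ^ n"
    and "integrable (iid n m) (\<lambda>y. \<Prod>j<n. g (y j))"
proof -
  interpret product_prob_space "\<lambda>_::nat. m" using assms(1) by (simp add: product_prob_spaceI)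
  show "(\<integral>y. (\<Prod>j<n. g (y j)) \<partial>iid n m) = (\<integral>y. g y \<partial>m) ^ n"
    by (subst product_integral_prod) (auto simp: assms)
  show "integrable (iid n m) (\<lambda>y. \<Prod>j<n. g (y j))"
    by (rule product_integrable_prod) (auto simp: assms)
qed

text \<open>Uniformity over all experiments is deduced from statements about sequences by choosing a violating
  experiment for every \<open>n\<close>.\<close>

lemma eventually_uniformly_in_parameter:
  assumes seq: "\<And>X. (\<And>n. P n (X n)) \<Longrightarrow> eventually (\<lambda>n. R n (X n)) sequentially"
    and ex: "\<And>n. \<exists>x. P n x"
  shows "eventually (\<lambda>n. \<forall>x. P n x \<longrightarrow> R n x) sequentially"
proof -
  define X where "X n = (if \<exists>x. P n x \<and> \<not> R n x then SOME x. P n x \<and> \<not> R n x else SOME x. P n x)" for n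
  have X: "P n (X n) \<and> ((\<exists>x. P n x \<and> \<not> R n x) \<longrightarrow> \<not> R n (X n))" for n
    using someI_ex[of "\<lambda>x. P n x \<and> \<not> R n x"] someI_ex[OF ex[of n]] by (simp add: X_def)
  have "eventually (\<lambda>n. R n (X n)) sequentially" using X by (intro seq) auto
  then show ?thesis by eventually_elim (use X in auto)
qed

text \<open>Supplies the nonemptiness required by
  \<open>eventually_uniformly_in_parameter\<close>.\<close>

lemma ex_score: "B \<ge> 0 \<Longrightarrow> \<exists>(m::'b measure) f. score B m f"
  by (rule exI[of _ "return (count_space UNIV) undefined"], rule exI[of _ "\<lambda>_. 0"])
     (simp add: score_def prob_space_return)

lemma score_scale: "score B m f \<Longrightarrow> \<bar>t\<bar> \<le> T \<Longrightarrow> score (T * B) m (\<lambda>y. t * f y)"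
  by (auto simp: score_def abs_mult intro!: mult_mono order_trans[OF abs_ge_zero])

lemma prob_space_PiM_iid: "prob_space m \<Longrightarrow> prob_space (iid n m)"
  by (rule prob_space_PiM) simp_all

lemma power_expectation_tendsto_real:
  fixes H :: "real \<Rightarrow> real"
  assumes s: "\<And>n. score B (m n) (f n)" and H: "H \<in> borel_measurable borel"
    and exp: "\<And>x. \<bar>x\<bar> \<le> B \<Longrightarrow> \<bar>H x - (1 + a * x + b * x\<^sup>2)\<bar> \<le> C * \<bar>x\<bar> ^ 3" and C: "C \<ge> 0"
  shows "(\<lambda>n. (\<integral>y. H (f n y / sqrt (real n)) \<partial>m n) ^ n - exp (b * (\<integral>y. (f n y)\<^sup>2 \<partial>m n))) \<longlonglongrightarrow> 0"
    and "n > 0 \<Longrightarrow> integrable (m n) (\<lambda>y. H (f n y / sqrt (real n)))"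
proof -
  have e: "norm (complex_of_real (H x) - (1 + of_real a * of_real x + of_real b * of_real (x\<^sup>2))) \<le> C * \<bar>x\<bar> ^ 3" if "\<bar>x\<bar> \<le> B" for x
  proof -
    have "complex_of_real (H x) - (1 + of_real a * of_real x + of_real b * of_real (x\<^sup>2)) = of_real (H x - (1 + a * x + b * x\<^sup>2))"
      by simp
    then show ?thesis using exp[OF that] by (simp only: norm_of_real)
  qed
  have HM: "(\<lambda>x. complex_of_real (H x)) \<in> borel_measurable borel" using H by measurable
  have "(\<lambda>n. (\<integral>y. complex_of_real (H (f n y / sqrt (real n))) \<partial>m n) ^ n - exp (complex_of_real b * complex_of_real (\<integral>y. (f n y)\<^sup>2 \<partial>m n))) \<longlonglongrightarrow> 0"
    by (rule power_expectation_tendsto[OF s HM e C])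
  then have "(\<lambda>n. complex_of_real ((\<integral>y. H (f n y / sqrt (real n)) \<partial>m n) ^ n - exp (b * (\<integral>y. (f n y)\<^sup>2 \<partial>m n)))) \<longlonglongrightarrow> of_real 0"
    by (simp flip: exp_of_real)
  then show "(\<lambda>n. (\<integral>y. H (f n y / sqrt (real n)) \<partial>m n) ^ n - exp (b * (\<integral>y. (f n y)\<^sup>2 \<partial>m n))) \<longlonglongrightarrow> 0"
    by (simp only: tendsto_of_real_iff)
  assume "n > 0"
  then have "integrable (m n) (\<lambda>y. complex_of_real (H (f n y / sqrt (real n))))"
    by (intro expansion_integrable(1)[where a="of_real a" and b="of_real b", OF s HM _ C] e)
  then show "integrable (m n) (\<lambda>y. H (f n y / sqrt (real n)))" by (simp only: complex_of_real_integrable_eq)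
qed

lemma nsum_measurable [measurable (raw)]:
  assumes [measurable]: "f \<in> borel_measurable m" "g \<in> measurable N (iid n m)"
  shows "(\<lambda>x. nsum n f (g x)) \<in> borel_measurable N"
  unfolding nsum_def by measurable

lemma sets_std_normal_distribution [measurable_cong]: "sets gauss = sets borel"
  by simp

text \<open>The independent Gaussian variable fills up the missing information \<open>\<kappa> n\<close>, so that experiments with little or
  no information need no separate treatment.\<close>

theorem gaussian_smoothed_clt:
  fixes m :: "nat \<Rightarrow> 'b measure"
  assumes s: "\<And>n. score B (m n) (f n)"
    and \<kappa>: "\<And>n. \<kappa> n \<ge> 0" and var: "\<And>n. (\<integral>y. (f n y)\<^sup>2 \<partial>m n) + \<kappa> n = 1"
  shows "weak_conv_m (\<lambda>n. distr (iid n (m n) \<Otimes>\<^sub>M gauss) borel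
      (\<lambda>(y, x). nsum n (f n) y + sqrt (\<kappa> n) * x)) gauss"
proof (rule levy_continuity)
  let ?P = "\<lambda>n. iid n (m n)"
  interpret N: prob_space gauss using real_dist_normal_dist by (simp add: real_distribution_def)
  have P: "prob_space (?P n)" for n by (rule prob_space_PiM_iid) (rule scoreD[OF s])
  note [measurable] = scoreD(2)[OF s]
  have PN: "prob_space (?P n \<Otimes>\<^sub>M gauss)" for n
    by (intro prob_space_pair P N.prob_space_axioms)
  have meas[measurable]: "(\<lambda>(y, x). nsum n (f n) y + sqrt (\<kappa> n) * x) \<in> borel_measurable (?P n \<Otimes>\<^sub>M gauss)" for n
    by measurable
  show "real_distribution (distr (?P n \<Otimes>\<^sub>M gauss) borel (\<lambda>(y, x). nsum n (f n) y + sqrt (\<kappa> n) * x))" for n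
    using PN by (rule prob_space.real_distribution_distr) simp
  show "real_distribution gauss" by (rule real_dist_normal_dist)
  fix t
  define H where "H x = iexp (t * x)" for x :: real
  have [measurable]: "H \<in> borel_measurable borel" unfolding H_def by measurable
  have H: "norm (H x - (1 + (\<i> * t) * of_real x + of_real (- (t\<^sup>2) / 2) * of_real (x\<^sup>2))) \<le> (\<bar>t\<bar> ^ 3 / 6) * \<bar>x\<bar> ^ 3" for x
  proof -
    have "norm (iexp (t * x) - (\<Sum>k\<le>2. (\<i> * (t * x)) ^ k / fact k)) \<le> \<bar>t * x\<bar> ^ Suc 2 / fact (Suc 2)"
      by (rule iexp_approx1)
    then show ?thesis
      by (simp add: H_def numeral_2_eq_2 abs_mult power_mult_distrib fact_numeral numeral_3_eq_3 algebra_simps)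
  qed
  have char: "char (distr (?P n \<Otimes>\<^sub>M gauss) borel (\<lambda>(y, x). nsum n (f n) y + sqrt (\<kappa> n) * x)) t
     = (\<integral>y. H (f n y / sqrt (real n)) \<partial>m n) ^ n * exp (- (t\<^sup>2) / 2 * \<kappa> n)" if "n > 0" for n
  proof -
    interpret Pn: prob_space "?P n" by (rule P)
    interpret pair_sigma_finite "?P n" gauss
      by (simp add: N.sigma_finite_measure_axioms Pn.sigma_finite_measure_axioms pair_sigma_finite_def)
    interpret PNn: prob_space "?P n \<Otimes>\<^sub>M gauss" by (rule PN)
    have int: "integrable (?P n \<Otimes>\<^sub>M gauss) (\<lambda>(y, x). iexp (t * (nsum n (f n) y + sqrt (\<kappa> n) * x)))"
      by (rule PNn.integrable_const_bound[where B=1]) (auto simp: split_beta)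
    have "char (distr (?P n \<Otimes>\<^sub>M gauss) borel (\<lambda>(y, x). nsum n (f n) y + sqrt (\<kappa> n) * x)) t
       = (\<integral>z. (case z of (y, x) \<Rightarrow> iexp (t * (nsum n (f n) y + sqrt (\<kappa> n) * x))) \<partial>(?P n \<Otimes>\<^sub>M gauss))"
      unfolding char_def by (subst integral_distr) (auto simp: split_beta intro!: Bochner_Integration.integral_cong)
    also have "\<dots> = (\<integral>y. (\<integral>x. iexp (t * (nsum n (f n) y + sqrt (\<kappa> n) * x)) \<partial>gauss) \<partial>?P n)"
      using integral_fst[OF int] by simp
    also have "\<dots> = (\<integral>y. iexp (t * nsum n (f n) y) * char gauss (t * sqrt (\<kappa> n)) \<partial>?P n)"
      unfolding char_def by (simp add: ring_distribs exp_add mult.assoc)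
    also have "\<dots> = (\<integral>y. iexp (t * nsum n (f n) y) \<partial>?P n) * exp (- (t\<^sup>2) / 2 * \<kappa> n)"
      using \<kappa>[of n] by (simp add: char_std_normal_distribution power_mult_distrib)
    also have "(\<integral>y. iexp (t * nsum n (f n) y) \<partial>?P n) = (\<integral>y. (\<Prod>j<n. H (f n (y j) / sqrt (real n))) \<partial>?P n)"
      unfolding H_def nsum_def by (simp add: sum_distrib_left exp_sum)
    also have "\<dots> = (\<integral>y. H (f n y / sqrt (real n)) \<partial>m n) ^ n"
      by (intro PiM_integral_prod expansion_integrable(1)[OF s _ H]) (use that scoreD(1)[OF s] in auto)
    finally show ?thesis .
  qed
  have "(\<lambda>n. (\<integral>y. H (f n y / sqrt (real n)) \<partial>m n) ^ n - exp (complex_of_real (- (t\<^sup>2) / 2) * complex_of_real (\<integral>y. (f n y)\<^sup>2 \<partial>m n))) \<longlonglongrightarrow> 0"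
    by (rule power_expectation_tendsto[OF s _ H]) simp_all
  then have c: "(\<lambda>n. (\<integral>y. H (f n y / sqrt (real n)) \<partial>m n) ^ n - exp (- (t\<^sup>2) / 2 * (\<integral>y. (f n y)\<^sup>2 \<partial>m n))) \<longlonglongrightarrow> 0"
    by (simp only: exp_of_real[symmetric] of_real_mult)
  have k: "norm (exp (- (t\<^sup>2) / 2 * \<kappa> n)) \<le> 1" for n using \<kappa>[of n] by simp
  \<comment> \<open>The second moments may oscillate, so neither factor has a limit of its own. A
    null sequence is multiplied by a factor of norm at most 1, and the two Gaussian exponents then
    combine by \<open>var\<close>.\<close>
  have "(\<lambda>n. ((\<integral>y. H (f n y / sqrt (real n)) \<partial>m n) ^ n - exp ((- (t\<^sup>2) / 2) * (\<integral>y. (f n y)\<^sup>2 \<partial>m n))) * exp (- (t\<^sup>2) / 2 * \<kappa> n)) \<longlonglongrightarrow> 0"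
    by (rule Lim_null_comparison[OF _ tendsto_norm_zero[OF c]])
       (rule always_eventually, rule allI, unfold norm_mult norm_of_real, rule mult_right_le_one_le, use k in simp_all)
  moreover have "exp (- (t\<^sup>2) / 2 * (\<integral>y. (f n y)\<^sup>2 \<partial>m n)) * exp (- (t\<^sup>2) / 2 * \<kappa> n) = exp (- (t\<^sup>2) / 2)" for n
    unfolding exp_add[symmetric] distrib_left[symmetric] var by simp
  then have "complex_of_real (exp ((- (t\<^sup>2) / 2) * (\<integral>y. (f n y)\<^sup>2 \<partial>m n))) * of_real (exp (- (t\<^sup>2) / 2 * \<kappa> n)) = of_real (exp (- (t\<^sup>2) / 2))" for n
    by (metis of_real_mult)
  ultimately have "(\<lambda>n. (\<integral>y. H (f n y / sqrt (real n)) \<partial>m n) ^ n * exp (- (t\<^sup>2) / 2 * \<kappa> n) - exp (- (t\<^sup>2) / 2)) \<longlonglongrightarrow> 0"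
    by (simp add: left_diff_distrib exp_of_real)
  then have "(\<lambda>n. (\<integral>y. H (f n y / sqrt (real n)) \<partial>m n) ^ n * exp (- (t\<^sup>2) / 2 * \<kappa> n)) \<longlonglongrightarrow> exp (- (t\<^sup>2) / 2)"
    by (rule Lim_null[THEN iffD2])
  then show "(\<lambda>n. char (distr (?P n \<Otimes>\<^sub>M gauss) borel (\<lambda>(y, x). nsum n (f n) y + sqrt (\<kappa> n) * x)) t)
     \<longlonglongrightarrow> char gauss t"
    unfolding char_std_normal_distribution
    by (rule Lim_transform_eventually) (rule eventually_mono[OF eventually_gt_at_top[of 0]], rule char[symmetric])
qed

section \<open>Gaussian approximation of the likelihood ratio\<close>

text \<open>Density, relative to \<open>n\<close> independent draws from \<open>m\<close>, of
  \<open>n\<close> draws from the perturbed law with density \<open>1 + f / sqrt n\<close>. For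
  small \<open>n\<close> the factors may be negative.\<close>

definition lik :: "nat \<Rightarrow> ('b \<Rightarrow> real) \<Rightarrow> (nat \<Rightarrow> 'b) \<Rightarrow> real" where
  "lik n f y = (\<Prod>j<n. 1 + f (y j) / sqrt (real n))"

lemma lik_measurable [measurable (raw)]:
  assumes [measurable]: "f \<in> borel_measurable m" "g \<in> measurable N (iid n m)"
  shows "(\<lambda>x. lik n f (g x)) \<in> borel_measurable N"
  unfolding lik_def by measurable

text \<open>Negative values of the product are read as zero by \<open>ennreal\<close>, so the
  expression makes sense for every \<open>t\<close> and \<open>n\<close>.\<close>

abbreviation tilted_risk :: "real \<Rightarrow> nat \<Rightarrow> 'b measure \<Rightarrow> ('b \<Rightarrow> real) \<Rightarrow> ((nat \<Rightarrow> 'b) \<Rightarrow> real) \<Rightarrow> real \<Rightarrow> ennreal" where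
  "tilted_risk u n m f \<delta> t \<equiv> \<integral>\<^sup>+y. ennreal (lik n (\<lambda>y. t * f y) y * \<bar>\<delta> y - t\<bar> powr u) \<partial>iid n m"

lemma exp_taylor_cubic:
  fixes x :: real
  assumes "\<bar>x\<bar> \<le> B"
  shows "\<bar>exp x - (1 + x + x\<^sup>2 / 2)\<bar> \<le> exp B * \<bar>x\<bar> ^ 3"
proof -
  obtain t where t: "\<bar>t\<bar> \<le> \<bar>x\<bar>" "exp x = (\<Sum>m<3. (x ^ m) / fact m) + (exp t / fact 3) * x ^ 3"
    using Maclaurin_exp_le[of x 3] by blast
  have "exp x - (1 + x + x\<^sup>2 / 2) = exp t / 6 * x ^ 3"
    unfolding t(2) by (simp add: lessThan_Suc eval_nat_numeral)
  then have "\<bar>exp x - (1 + x + x\<^sup>2 / 2)\<bar> = exp t / 6 * \<bar>x\<bar> ^ 3"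
    by (simp only: abs_mult power_abs) simp
  also have "\<dots> \<le> exp B * \<bar>x\<bar> ^ 3"
    using t(1) assms exp_gt_zero[of B] by (intro mult_right_mono) (auto intro!: order_trans[of "exp t" "exp B" "exp B * 6"])
  finally show ?thesis .
qed

lemma mgf_tendsto:
  assumes s: "\<And>n. score B (m n) (f n)"
  shows "(\<lambda>n. (\<integral>y. exp (nsum n (f n) y) \<partial>iid n (m n)) - exp ((\<integral>y. (f n y)\<^sup>2 \<partial>m n) / 2)) \<longlonglongrightarrow> 0" (is "?A")
    and "n > 0 \<Longrightarrow> integrable (iid n (m n)) (\<lambda>y. exp (nsum n (f n) y))" (is "_ \<Longrightarrow> ?B")
proof -
  have e: "\<bar>exp x - (1 + 1 * x + 1 / 2 * x\<^sup>2)\<bar> \<le> exp B * \<bar>x\<bar> ^ 3" if "\<bar>x\<bar> \<le> B" for x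
    using exp_taylor_cubic[OF that] by simp
  note * = power_expectation_tendsto_real[where m=m and f=f, OF s _ e, simplified]
  have p: "exp (nsum n (f n) y) = (\<Prod>j<n. exp (f n (y j) / sqrt (real n)))" for n y
    by (simp add: nsum_def exp_sum)
  show ?B if "n > 0" unfolding p by (rule PiM_integral_prod(2)) (use scoreD(1)[OF s] *(2) that in auto)
  have "(\<integral>y. exp (nsum n (f n) y) \<partial>iid n (m n)) = (\<integral>y. exp (f n y / sqrt (real n)) \<partial>m n) ^ n" if "n > 0" for n
    unfolding p by (rule PiM_integral_prod(1)) (use scoreD(1)[OF s] *(2) that in auto)
  then show ?A
    by (intro Lim_transform_eventually[OF *(1)] eventually_mono[OF eventually_gt_at_top[of 0]]) simp
qed

text \<open>Expanding the square leaves three products over the sample, whose integrals behave like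
  \<open>exp J\<close>, \<open>exp (3 * J / 2)\<close> and \<open>exp (2 * J)\<close>. With the
  weights \<open>1\<close>, \<open>- 2 * exp (- J / 2)\<close> and \<open>exp (- J)\<close> they
  become \<open>exp J\<close> times 1, -2 and 1, and cancel.\<close>

lemma lik_approx_L2:
  assumes s: "\<And>n. score B (m n) (f n)"
  defines "J \<equiv> \<lambda>n. \<integral>y. (f n y)\<^sup>2 \<partial>m n"
  shows "(\<lambda>n. \<integral>y. (lik n (f n) y - exp (nsum n (f n) y - J n / 2))\<^sup>2 \<partial>iid n (m n)) \<longlonglongrightarrow> 0" (is ?A)
    and "n > 0 \<Longrightarrow> integrable (iid n (m n)) (\<lambda>y. (lik n (f n) y - exp (nsum n (f n) y - J n / 2))\<^sup>2)" (is "_ \<Longrightarrow> ?B")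
proof -
  let ?P = "\<lambda>n. iid n (m n)"
  have B0: "B \<ge> 0" by (rule scoreD[OF s])
  have e1: "\<bar>(1 + x)\<^sup>2 - (1 + 2 * x + 1 * x\<^sup>2)\<bar> \<le> 0 * \<bar>x\<bar> ^ 3" for x :: real
    by (simp add: power2_eq_square algebra_simps)
  have e2: "\<bar>(1 + x) * exp x - (1 + 2 * x + 3 / 2 * x\<^sup>2)\<bar> \<le> (1 + (1 + B) * exp B) * \<bar>x\<bar> ^ 3" if "\<bar>x\<bar> \<le> B" for x
  proof -
    have "(1 + x) * exp x - (1 + 2 * x + 3 / 2 * x\<^sup>2) = x ^ 3 / 2 + (1 + x) * (exp x - (1 + x + x\<^sup>2 / 2))"
      by (simp add: field_simps power2_eq_square power3_eq_cube)
    also have "\<bar>\<dots>\<bar> \<le> \<bar>x\<bar> ^ 3 + (1 + B) * (exp B * \<bar>x\<bar> ^ 3)"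
      using exp_taylor_cubic[OF that] that
      by (intro order_trans[OF abs_triangle_ineq] add_mono) (auto simp: abs_mult power_abs intro!: mult_mono)
    finally show ?thesis by (simp add: algebra_simps)
  qed
  have e3: "\<bar>exp (2 * x) - (1 + 2 * x + 2 * x\<^sup>2)\<bar> \<le> (8 * exp (2 * B)) * \<bar>x\<bar> ^ 3" if "\<bar>x\<bar> \<le> B" for x
    using exp_taylor_cubic[of "2 * x" "2 * B"] that by (simp add: power_mult_distrib abs_mult)
  have c2: "1 + (1 + B) * exp B \<ge> 0" using B0 by (simp add: add_nonneg_nonneg)
  note l1 = power_expectation_tendsto_real[where H="\<lambda>x. (1 + x)\<^sup>2" and m=m and f=f, OF s _ e1, simplified]
  note l2 = power_expectation_tendsto_real[where H="\<lambda>x. (1 + x) * exp x" and m=m and f=f, OF s _ e2 c2, simplified]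
  note l3 = power_expectation_tendsto_real[where H="\<lambda>x. exp (2 * x)" and m=m and f=f, OF s _ e3, simplified]
  define A1 A2 A3 where "A1 n = (\<integral>y. (1 + f n y / sqrt (real n))\<^sup>2 \<partial>m n) ^ n"
    and "A2 n = (\<integral>y. (1 + f n y / sqrt (real n)) * exp (f n y / sqrt (real n)) \<partial>m n) ^ n"
    and "A3 n = (\<integral>y. exp (2 * f n y / sqrt (real n)) \<partial>m n) ^ n" for n
  have hb: "has_bochner_integral (?P n) (\<lambda>y. (lik n (f n) y - exp (nsum n (f n) y - J n / 2))\<^sup>2)
      (A1 n + ((-2 * exp (- J n / 2)) * A2 n + exp (- J n) * A3 n))" if n: "n > 0" for n
  proof -
    have p: "prob_space (m n)" by (rule scoreD[OF s])
    have sq: "(lik n (f n) y - exp (nsum n (f n) y - J n / 2))\<^sup>2 =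
       (\<Prod>j<n. (1 + f n (y j) / sqrt (real n))\<^sup>2)
       + ((-2 * exp (- J n / 2)) * (\<Prod>j<n. (1 + f n (y j) / sqrt (real n)) * exp (f n (y j) / sqrt (real n)))
       + exp (- J n) * (\<Prod>j<n. exp (2 * f n (y j) / sqrt (real n))))" for y
    proof -
      have a: "exp (nsum n (f n) y - J n / 2) = exp (- J n / 2) * (\<Prod>j<n. exp (f n (y j) / sqrt (real n)))"
        unfolding nsum_def exp_sum[OF finite_lessThan, symmetric] exp_add[symmetric] by simp
      have b: "(\<Prod>j<n. exp (2 * f n (y j) / sqrt (real n))) = (\<Prod>j<n. exp (f n (y j) / sqrt (real n)))\<^sup>2"
        unfolding prod_power_distrib by (intro prod.cong) (auto simp: power2_eq_square simp flip: exp_add)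
      have c: "exp (- J n) = (exp (- J n / 2))\<^sup>2" by (simp add: power2_eq_square flip: exp_add)
      have d: "(\<Prod>j<n. (1 + f n (y j) / sqrt (real n))\<^sup>2) = (\<Prod>j<n. 1 + f n (y j) / sqrt (real n))\<^sup>2"
        by (rule prod_power_distrib[symmetric])
      have id: "(p - e * q)\<^sup>2 = p\<^sup>2 + ((- 2 * e) * (p * q) + e\<^sup>2 * q\<^sup>2)" for p e q :: real
        by (simp add: power2_eq_square algebra_simps)
      show ?thesis unfolding a b c d lik_def prod.distrib by (rule id)
    qed
    have h1: "has_bochner_integral (?P n) (\<lambda>y. \<Prod>j<n. (1 + f n (y j) / sqrt (real n))\<^sup>2) (A1 n)"
      unfolding A1_def has_bochner_integral_iff using n l1(2) by (intro conjI PiM_integral_prod p) auto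
    have h2: "has_bochner_integral (?P n) (\<lambda>y. \<Prod>j<n. (1 + f n (y j) / sqrt (real n)) * exp (f n (y j) / sqrt (real n))) (A2 n)"
      unfolding A2_def has_bochner_integral_iff using n l2(2) by (intro conjI PiM_integral_prod p) auto
    have h3: "has_bochner_integral (?P n) (\<lambda>y. \<Prod>j<n. exp (2 * f n (y j) / sqrt (real n))) (A3 n)"
      unfolding A3_def has_bochner_integral_iff using n l3(2) by (intro conjI PiM_integral_prod p) auto
    show ?thesis unfolding sq
      by (rule has_bochner_integral_add[OF h1 has_bochner_integral_add[OF has_bochner_integral_mult_right[OF h2] has_bochner_integral_mult_right[OF h3]]])
  qed
  show ?B if "n > 0" using hb[OF that] by (simp add: has_bochner_integral_iff)
  have J0: "J n \<ge> 0" for n using scoreD(9)[OF s] by (simp add: J_def)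
  have "(\<lambda>n. (A1 n - exp (J n)) + (-2 * (exp (- J n / 2) * (A2 n - exp (3 / 2 * J n))) + exp (- J n) * (A3 n - exp (2 * J n)))) \<longlonglongrightarrow> 0 + (-2 * 0 + 0)"
  proof (intro tendsto_add tendsto_mult_left)
    show "(\<lambda>n. A1 n - exp (J n)) \<longlonglongrightarrow> 0" using l1(1) by (simp add: A1_def J_def)
    have t2: "(\<lambda>n. A2 n - exp (3 / 2 * J n)) \<longlonglongrightarrow> 0" using l2(1) by (simp add: A2_def J_def)
    have t3: "(\<lambda>n. A3 n - exp (2 * J n)) \<longlonglongrightarrow> 0" using l3(1) by (simp add: A3_def J_def)
    show "(\<lambda>n. exp (- J n / 2) * (A2 n - exp (3 / 2 * J n))) \<longlonglongrightarrow> 0"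
      by (rule Lim_null_comparison[OF _ tendsto_norm_zero[OF t2]]) (auto intro!: always_eventually simp: abs_mult mult_left_le_one_le J0)
    show "(\<lambda>n. exp (- J n) * (A3 n - exp (2 * J n))) \<longlonglongrightarrow> 0"
      by (rule Lim_null_comparison[OF _ tendsto_norm_zero[OF t3]]) (auto intro!: always_eventually simp: abs_mult mult_left_le_one_le J0)
  qed
  moreover have "(A1 n - exp (J n)) + (-2 * (exp (- J n / 2) * (A2 n - exp (3 / 2 * J n))) + exp (- J n) * (A3 n - exp (2 * J n)))
     = A1 n + ((-2 * exp (- J n / 2)) * A2 n + exp (- J n) * A3 n)" for n
  proof -
    have "exp (- J n / 2) * exp (3 / 2 * J n) = exp (J n)" "exp (- J n) * exp (2 * J n) = exp (J n)"
      unfolding exp_add[symmetric] by (simp_all add: field_simps)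
    then show ?thesis unfolding right_diff_distrib by simp
  qed
  ultimately have "(\<lambda>n. A1 n + ((-2 * exp (- J n / 2)) * A2 n + exp (- J n) * A3 n)) \<longlonglongrightarrow> 0"
    by (simp only: add_0 mult_zero_right)
  then show ?A
    by (rule Lim_transform_eventually)
       (rule eventually_mono[OF eventually_gt_at_top[of 0]], rule has_bochner_integral_integral_eq[OF hb, symmetric])
qed

text \<open>In this form the approximation can be integrated against any bounded loss: a loss of at
  most \<open>K\<close> changes by at most \<open>K * \<eta>\<close>.\<close>

lemma lik_approx_L1:
  assumes B: "B \<ge> 0" and \<eta>: "\<eta> > 0"
  shows "\<forall>\<^sub>F n in sequentially. \<forall>(m::'b measure) f. score B m f \<longrightarrow>
    (\<integral>\<^sup>+y. ennreal \<bar>lik n f y - exp (nsum n f y - (\<integral>y. (f y)\<^sup>2 \<partial>m) / 2)\<bar> \<partial>iid n m) \<le> ennreal \<eta>"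
proof -
  have "\<forall>\<^sub>F n in sequentially. \<forall>(z :: 'b measure \<times> ('b \<Rightarrow> real)). score B (fst z) (snd z) \<longrightarrow>
    (\<integral>\<^sup>+y. ennreal \<bar>lik n (snd z) y - exp (nsum n (snd z) y - (\<integral>y. (snd z y)\<^sup>2 \<partial>fst z) / 2)\<bar> \<partial>iid n (fst z)) \<le> ennreal \<eta>"
  proof (rule eventually_uniformly_in_parameter)
    show "\<exists>z :: 'b measure \<times> ('b \<Rightarrow> real). score B (fst z) (snd z)" using ex_score[OF B] by auto
    fix X :: "nat \<Rightarrow> 'b measure \<times> ('b \<Rightarrow> real)"
    assume s: "\<And>n. score B (fst (X n)) (snd (X n))"
    define P where "P n = iid n (fst (X n))" for n
    define D where "D n y = lik n (snd (X n)) y - exp (nsum n (snd (X n)) y - (\<integral>y. (snd (X n) y)\<^sup>2 \<partial>fst (X n)) / 2)" for n y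
    have l: "(\<lambda>n. \<integral>y. (D n y)\<^sup>2 \<partial>P n) \<longlonglongrightarrow> 0" unfolding P_def D_def
      by (rule lik_approx_L2(1)[OF s])
    have "\<forall>\<^sub>F n in sequentially. (\<integral>y. (D n y)\<^sup>2 \<partial>P n) < \<eta>\<^sup>2"
      by (rule order_tendstoD(2)[OF l]) (use \<eta> in simp)
    then show "\<forall>\<^sub>F n in sequentially. (\<integral>\<^sup>+y. ennreal \<bar>lik n (snd (X n)) y - exp (nsum n (snd (X n)) y - (\<integral>y. (snd (X n) y)\<^sup>2 \<partial>fst (X n)) / 2)\<bar> \<partial>iid n (fst (X n))) \<le> ennreal \<eta>"
      using eventually_gt_at_top[of 0]
    proof eventually_elim
      case (elim n)
      interpret prob_space "P n" unfolding P_def by (rule prob_space_PiM_iid) (rule scoreD[OF s])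
      note [measurable] = scoreD(2)[OF s]
      have [measurable]: "D n \<in> borel_measurable (P n)" unfolding P_def D_def by measurable
      have i2: "integrable (P n) (\<lambda>y. (D n y)\<^sup>2)" unfolding P_def D_def
        by (rule lik_approx_L2(2)[OF s]) (use elim in simp)
      then have i2': "integrable (P n) (\<lambda>y. \<bar>D n y\<bar>\<^sup>2)" by simp
      have i1: "integrable (P n) (\<lambda>y. \<bar>D n y\<bar>)"
        by (rule square_integrable_imp_integrable[OF _ i2']) simp
      \<comment> \<open>Nonnegativity of the variance of \<open>\<bar>D n y\<bar>\<close> takes the
        place of the Cauchy-Schwarz inequality.\<close>
      have "(expectation (\<lambda>y. \<bar>D n y\<bar>))\<^sup>2 \<le> expectation (\<lambda>y. \<bar>D n y\<bar>\<^sup>2)"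
        using variance_eq[OF i1 i2'] variance_positive[of "\<lambda>y. \<bar>D n y\<bar>"] by simp
      also have "\<dots> \<le> \<eta>\<^sup>2" using elim by simp
      finally have "expectation (\<lambda>y. \<bar>D n y\<bar>) \<le> \<eta>"
        by (rule power2_le_imp_le) (use \<eta> in simp)
      then have "(\<integral>\<^sup>+y. ennreal \<bar>D n y\<bar> \<partial>P n) \<le> ennreal \<eta>"
        using i1 by (subst nn_integral_eq_integral) (auto intro: ennreal_leI)
      then show ?case by (simp add: D_def P_def)
    qed
  qed
  then show ?thesis by (rule eventually_mono) auto
qed

section \<open>Bayes risk in the Gaussian shift experiment\<close>

text \<open>The tangent line at 1 of a convex power, obtained from
  \<open>ln (1 / x) \<le> 1 / x - 1\<close> and \<open>exp v \<ge> 1 + v\<close> instead of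
  derivatives.\<close>

lemma powr_Bernoulli:
  fixes x u :: real
  assumes "x \<ge> 0" "u \<ge> 1"
  shows "x powr u \<ge> 1 + u * (x - 1)"
proof (cases "x = 0")
  case False
  then have x: "x > 0" using assms by simp
  have "ln (1 / x) \<le> 1 / x - 1" by (rule ln_le_minus_one) (use x in simp)
  then have "x * ln x \<ge> x - 1" using x by (simp add: ln_div field_simps)
  then have "(u - 1) * (x * ln x) \<ge> (u - 1) * (x - 1)" using assms by (intro mult_left_mono) auto
  then have "1 + u * (x - 1) \<le> x * (1 + (u - 1) * ln x)" by (simp add: algebra_simps)
  also have "\<dots> \<le> x * exp ((u - 1) * ln x)" using x exp_ge_add_one_self by (intro mult_left_mono) auto
  also have "\<dots> = x powr u" using x by (simp add: powr_def exp_diff left_diff_distrib)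
  finally show ?thesis .
qed (use assms in simp)

text \<open>The convex case with exponent \<open>1 / s\<close>, applied to
  \<open>z powr s\<close>.\<close>

lemma powr_Bernoulli_concave:
  fixes z s :: real
  assumes z: "z \<ge> 0" and s: "0 < s" "s \<le> 1"
  shows "z powr s \<le> 1 + s * (z - 1)"
proof -
  have "1 + 1 / s * (z powr s - 1) \<le> (z powr s) powr (1 / s)"
    by (rule powr_Bernoulli) (use s in \<open>auto simp: field_simps\<close>)
  also have "\<dots> = z" using z s by (simp add: powr_powr)
  finally show ?thesis using s by (simp add: field_simps)
qed

text \<open>Both terms on the right lie above the tangent at \<open>\<bar>s\<bar>\<close>, whose
  slope is nonnegative, and their arguments add up to at least \<open>2 * \<bar>s\<bar>\<close>. In
  the Bayes problem \<open>c\<close> is the offset of an estimate from the posterior centre.\<close>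

lemma abs_powr_midpoint:
  fixes c s u :: real
  assumes u: "u \<ge> 1"
  shows "2 * \<bar>s\<bar> powr u \<le> \<bar>c - s\<bar> powr u + \<bar>c + s\<bar> powr u"
proof (cases "s = 0")
  case False
  then have s: "\<bar>s\<bar> > 0" by simp
  have B: "\<bar>s\<bar> powr u * (1 + u * (\<bar>x\<bar> / \<bar>s\<bar> - 1)) \<le> \<bar>x\<bar> powr u" for x
  proof -
    have "\<bar>s\<bar> powr u * (1 + u * (\<bar>x\<bar> / \<bar>s\<bar> - 1)) \<le> \<bar>s\<bar> powr u * (\<bar>x\<bar> / \<bar>s\<bar>) powr u"
      by (intro mult_left_mono powr_Bernoulli) (use u in auto)
    then show ?thesis using s by (simp add: powr_divide)
  qed
  have "\<bar>c - s\<bar> + \<bar>c + s\<bar> \<ge> 2 * \<bar>s\<bar>" by linarith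
  then have "\<bar>c - s\<bar> / \<bar>s\<bar> + \<bar>c + s\<bar> / \<bar>s\<bar> \<ge> 2" using s by (simp add: field_simps)
  then have "u * (\<bar>c - s\<bar> / \<bar>s\<bar> + \<bar>c + s\<bar> / \<bar>s\<bar> - 2) \<ge> 0" using u by simp
  then have "2 \<le> (1 + u * (\<bar>c - s\<bar> / \<bar>s\<bar> - 1)) + (1 + u * (\<bar>c + s\<bar> / \<bar>s\<bar> - 1))"
    by (simp add: algebra_simps)
  then have "\<bar>s\<bar> powr u * 2 \<le> \<bar>s\<bar> powr u * ((1 + u * (\<bar>c - s\<bar> / \<bar>s\<bar> - 1)) + (1 + u * (\<bar>c + s\<bar> / \<bar>s\<bar> - 1)))"
    by (intro mult_left_mono) auto
  then show ?thesis using B[of "c - s"] B[of "c + s"] by (simp add: distrib_left)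
qed simp

section \<open>Absolute moments of the standard normal law\<close>

definition gauss_moment :: "real \<Rightarrow> real" where
  "gauss_moment u = (\<integral>x. \<bar>x\<bar> powr u \<partial>gauss)"

definition gauss_trunc_moment :: "real \<Rightarrow> real \<Rightarrow> real" where
  "gauss_trunc_moment u b = (\<integral>x. indicator {-b..b} x * \<bar>x\<bar> powr u \<partial>gauss)"

lemma prob_space_std_normal: "prob_space gauss"
  using real_dist_normal_dist by (simp add: real_distribution_def)

lemma abs_powr_le_square:
  fixes x u :: real
  assumes "0 < u" "u \<le> 2"
  shows "\<bar>x\<bar> powr u \<le> 1 + x\<^sup>2"
proof (cases "\<bar>x\<bar> \<le> 1")
  case True
  then have "\<bar>x\<bar> powr u \<le> 1" using assms by (simp add: powr_le1)
  then show ?thesis by (smt (verit) zero_le_power2)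
next
  case False
  then have "\<bar>x\<bar> powr u \<le> \<bar>x\<bar> powr 2" using assms by (intro powr_mono) auto
  also have "\<bar>x\<bar> powr 2 = x\<^sup>2" using False by (simp add: powr_numeral)
  finally show ?thesis by simp
qed

lemma integrable_gauss_moment:
  assumes "0 < u" "u \<le> 2"
  shows "integrable gauss (\<lambda>x. \<bar>x\<bar> powr u)"
proof -
  interpret N: prob_space gauss by (rule prob_space_std_normal)
  show ?thesis
  proof (rule Bochner_Integration.integrable_bound)
    show "integrable gauss (\<lambda>x. 1 + x\<^sup>2)"
      by (intro Bochner_Integration.integrable_add integrable_std_normal_distribution_moment) simp
    show "AE x in gauss. norm (\<bar>x\<bar> powr u) \<le> norm (1 + x\<^sup>2)"
      using abs_powr_le_square[OF assms] by auto
  qed simp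
qed

lemma integrable_gauss_trunc:
  assumes "0 < u" "u \<le> 2"
  shows "integrable gauss (\<lambda>x. indicator {-b..b} x * \<bar>x\<bar> powr u)"
  by (rule Bochner_Integration.integrable_bound[OF integrable_gauss_moment[OF assms]])
     (auto simp: indicator_def)

lemma gauss_trunc_moment_tendsto:
  assumes u: "0 < u" "u \<le> 2"
  shows "(\<lambda>n. gauss_trunc_moment u (real n)) \<longlonglongrightarrow> gauss_moment u"
  unfolding gauss_trunc_moment_def gauss_moment_def
proof (rule integral_dominated_convergence[where w="\<lambda>x. \<bar>x\<bar> powr u"])
  show "AE x in gauss. (\<lambda>n. indicator {- real n..real n} x * \<bar>x\<bar> powr u) \<longlonglongrightarrow> \<bar>x\<bar> powr u"
  proof (rule AE_I2)
    fix x :: real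
    have "\<forall>\<^sub>F n in sequentially. real n \<ge> \<bar>x\<bar>"
      using filterlim_real_sequentially by (simp add: filterlim_at_top)
    then have "\<forall>\<^sub>F n in sequentially. \<bar>x\<bar> powr u = indicator {- real n..real n} x * \<bar>x\<bar> powr u"
      by eventually_elim (auto simp: indicator_def)
    then show "(\<lambda>n. indicator {- real n..real n} x * \<bar>x\<bar> powr u) \<longlonglongrightarrow> \<bar>x\<bar> powr u"
      by (rule Lim_transform_eventually[OF tendsto_const])
  qed
  show "integrable gauss (\<lambda>x. \<bar>x\<bar> powr u)" by (rule integrable_gauss_moment[OF u])
qed (auto simp: indicator_def)

lemma gauss_trunc_moment_nonneg: "gauss_trunc_moment u b \<ge> 0"
  unfolding gauss_trunc_moment_def by (intro integral_nonneg_AE) auto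

lemma gauss_moment_pos:
  assumes u: "0 < u" "u \<le> 2"
  shows "gauss_moment u > 0"
proof -
  have "gauss_moment u \<ge> 0" unfolding gauss_moment_def by (intro integral_nonneg_AE) auto
  moreover have "gauss_moment u \<noteq> 0"
  proof
    assume "gauss_moment u = 0"
    then have "AE x in gauss. \<bar>x\<bar> powr u = 0"
      unfolding gauss_moment_def by (subst (asm) integral_nonneg_eq_0_iff_AE[OF integrable_gauss_moment[OF u]]) auto
    then have "AE x in lborel. x = (0::real)"
      using normal_density_pos[of 1 0] by (subst (asm) AE_density) (auto simp: less_le)
    moreover have "AE x in lborel. x \<noteq> (0::real)" by (rule AE_lborel_singleton)
    ultimately have "AE x::real in lborel. False" by eventually_elim simp
    then have "ae_filter (lborel :: real measure) = bot" by (simp only: eventually_False)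
    then show False unfolding ae_filter_eq_bot_iff by simp
  qed
  ultimately show ?thesis by simp
qed

lemma nn_integral_std_normal:
  assumes [measurable]: "f \<in> borel_measurable borel"
  shows "(\<integral>\<^sup>+x. f x \<partial>gauss) = (\<integral>\<^sup>+x. ennreal (std_normal_density x) * f x \<partial>lborel)"
  by (subst nn_integral_density) auto

lemma gauss_trunc_moment_lborel:
  assumes u: "0 < u" "u \<le> 2"
  shows "(\<integral>\<^sup>+s. ennreal (indicator {-b..b} s * exp (- s\<^sup>2 / 2) * \<bar>s\<bar> powr u) \<partial>lborel) = ennreal (sqrt (2 * pi) * gauss_trunc_moment u b)"
proof -
  have "ennreal (gauss_trunc_moment u b) = (\<integral>\<^sup>+x. ennreal (indicator {-b..b} x * \<bar>x\<bar> powr u) \<partial>gauss)"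
    unfolding gauss_trunc_moment_def by (rule nn_integral_eq_integral[OF integrable_gauss_trunc[OF u], symmetric]) auto
  also have "\<dots> = (\<integral>\<^sup>+x. ennreal (1 / sqrt (2 * pi)) * ennreal (indicator {-b..b} x * exp (- x\<^sup>2 / 2) * \<bar>x\<bar> powr u) \<partial>lborel)"
    by (subst nn_integral_std_normal, simp)
       (intro nn_integral_cong, simp add: ennreal_mult'[symmetric] std_normal_density_def mult_ac)
  also have "\<dots> = ennreal (1 / sqrt (2 * pi)) * (\<integral>\<^sup>+s. ennreal (indicator {-b..b} s * exp (- s\<^sup>2 / 2) * \<bar>s\<bar> powr u) \<partial>lborel)"
    by (rule nn_integral_cmult) simp
  finally have "ennreal (sqrt (2 * pi)) * ennreal (gauss_trunc_moment u b) = ennreal (sqrt (2 * pi)) * (ennreal (1 / sqrt (2 * pi)) * (\<integral>\<^sup>+s. ennreal (indicator {-b..b} s * exp (- s\<^sup>2 / 2) * \<bar>s\<bar> powr u) \<partial>lborel))"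
    by simp
  also have "\<dots> = (\<integral>\<^sup>+s. ennreal (indicator {-b..b} s * exp (- s\<^sup>2 / 2) * \<bar>s\<bar> powr u) \<partial>lborel)"
    unfolding mult.assoc[symmetric] by (subst ennreal_mult'[symmetric]) simp_all
  finally show ?thesis by (simp add: ennreal_mult'[symmetric] gauss_trunc_moment_nonneg)
qed

text \<open>The posterior is symmetric about \<open>z\<close> on the window of radius \<open>b\<close>, so by convexity of the loss the best
  estimate is its centre.\<close>

lemma gaussian_posterior_window:
  assumes u: "1 \<le> u" "u \<le> 2" and b: "b > 0" and z: "\<bar>z\<bar> \<le> T - b"
  shows "ennreal (exp (z\<^sup>2 / 2) * (sqrt (2 * pi) * gauss_trunc_moment u b))
    \<le> (\<integral>\<^sup>+t. ennreal (indicator {-T..T} t * exp (t * z - t\<^sup>2 / 2) * \<bar>a - t\<bar> powr u) \<partial>lborel)"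
proof -
  define c where "c = a - z"
  define h where "h s = ennreal (indicator {-b..b} s * exp (- s\<^sup>2 / 2) * \<bar>c - s\<bar> powr u)" for s :: real
  define g where "g s = ennreal (indicator {-b..b} s * exp (- s\<^sup>2 / 2) * \<bar>s\<bar> powr u)" for s :: real
  have [measurable]: "h \<in> borel_measurable borel" "g \<in> borel_measurable borel" unfolding h_def g_def by measurable
  have "2 * (\<integral>\<^sup>+s. g s \<partial>lborel) = (\<integral>\<^sup>+s. 2 * g s \<partial>lborel)" by (simp add: nn_integral_cmult)
  \<comment> \<open>Window and Gaussian weight are even, so the points \<open>s\<close> and
    \<open>- s\<close> can be paired and \<open>abs_powr_midpoint\<close> applies to each
    pair.\<close>
  also have "\<dots> \<le> (\<integral>\<^sup>+s. h s + h (- s) \<partial>lborel)"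
  proof (rule nn_integral_mono)
    fix s :: real
    have "2 * (exp (- s\<^sup>2 / 2) * \<bar>s\<bar> powr u) \<le> exp (- s\<^sup>2 / 2) * \<bar>c - s\<bar> powr u + exp (- s\<^sup>2 / 2) * \<bar>c + s\<bar> powr u"
      using mult_left_mono[OF abs_powr_midpoint[OF u(1), of s c], of "exp (- s\<^sup>2 / 2)"] by (simp add: algebra_simps)
    then have "2 * (indicator {-b..b} s * exp (- s\<^sup>2 / 2) * \<bar>s\<bar> powr u) \<le>
        indicator {-b..b} s * exp (- s\<^sup>2 / 2) * \<bar>c - s\<bar> powr u + indicator {-b..b} (- s) * exp (- (- s)\<^sup>2 / 2) * \<bar>c - (- s)\<bar> powr u"
      by (auto simp: indicator_def)
    moreover have "h s + h (- s) = ennreal (indicator {-b..b} s * exp (- s\<^sup>2 / 2) * \<bar>c - s\<bar> powr u + indicator {-b..b} (- s) * exp (- (- s)\<^sup>2 / 2) * \<bar>c - (- s)\<bar> powr u)"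
      unfolding h_def by (rule ennreal_plus[symmetric]) auto
    moreover have "2 * g s = ennreal (2 * (indicator {-b..b} s * exp (- s\<^sup>2 / 2) * \<bar>s\<bar> powr u))"
      unfolding g_def by (simp only: ennreal_mult'[of 2] ennreal_numeral zero_le_numeral)
    ultimately show "2 * g s \<le> h s + h (- s)"
      by (metis ennreal_leI)
  qed
  also have "\<dots> = (\<integral>\<^sup>+s. h s \<partial>lborel) + (\<integral>\<^sup>+s. h (- s) \<partial>lborel)" by (rule nn_integral_add) auto
  also have "(\<integral>\<^sup>+s. h (- s) \<partial>lborel) = (\<integral>\<^sup>+s. h s \<partial>lborel)"
    using nn_integral_real_affine[of h "-1" 0] by simp
  finally have "2 * (\<integral>\<^sup>+s. g s \<partial>lborel) \<le> 2 * (\<integral>\<^sup>+s. h s \<partial>lborel)" by (simp add: mult_2)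
  then have gh: "(\<integral>\<^sup>+s. g s \<partial>lborel) \<le> (\<integral>\<^sup>+s. h s \<partial>lborel)"
    by (subst (asm) ennreal_mult_le_mult_iff) auto
  have "ennreal (exp (z\<^sup>2 / 2) * (sqrt (2 * pi) * gauss_trunc_moment u b)) = ennreal (exp (z\<^sup>2 / 2)) * (\<integral>\<^sup>+s. g s \<partial>lborel)"
    unfolding g_def using u by (subst gauss_trunc_moment_lborel) (auto simp: ennreal_mult')
  also have "\<dots> \<le> ennreal (exp (z\<^sup>2 / 2)) * (\<integral>\<^sup>+s. h s \<partial>lborel)" by (rule mult_left_mono[OF gh]) simp
  also have "\<dots> = (\<integral>\<^sup>+s. ennreal (exp (z\<^sup>2 / 2)) * h s \<partial>lborel)" by (simp add: nn_integral_cmult)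
  also have "\<dots> \<le> (\<integral>\<^sup>+s. ennreal (indicator {-T..T} (z + 1 * s) * exp ((z + 1 * s) * z - (z + 1 * s)\<^sup>2 / 2) * \<bar>a - (z + 1 * s)\<bar> powr u) \<partial>lborel)"
  proof (rule nn_integral_mono)
    fix s :: real
    \<comment> \<open>Completing the square with \<open>t = z + s\<close>: around \<open>z\<close>
      the weight is Gaussian, up to the factor \<open>exp (z^2 / 2)\<close>.\<close>
    have e: "exp (z\<^sup>2 / 2) * exp (- s\<^sup>2 / 2) = exp ((z + s) * z - (z + s)\<^sup>2 / 2)"
      by (simp add: power2_eq_square field_simps flip: exp_add)
    have "exp (z\<^sup>2 / 2) * (indicator {-b..b} s * exp (- s\<^sup>2 / 2) * \<bar>c - s\<bar> powr u) = indicator {-b..b} s * exp ((z + s) * z - (z + s)\<^sup>2 / 2) * \<bar>a - (z + s)\<bar> powr u"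
      unfolding e[symmetric] c_def by (simp add: mult_ac diff_diff_eq)
    also have "\<dots> \<le> indicator {-T..T} (z + 1 * s) * exp ((z + 1 * s) * z - (z + 1 * s)\<^sup>2 / 2) * \<bar>a - (z + 1 * s)\<bar> powr u"
      using z by (auto simp: indicator_def)
    finally show "ennreal (exp (z\<^sup>2 / 2)) * h s \<le> ennreal (indicator {-T..T} (z + 1 * s) * exp ((z + 1 * s) * z - (z + 1 * s)\<^sup>2 / 2) * \<bar>a - (z + 1 * s)\<bar> powr u)"
      unfolding h_def by (subst ennreal_mult'[symmetric]) (auto intro: ennreal_leI)
  qed
  also have "\<dots> = (\<integral>\<^sup>+t. ennreal (indicator {-T..T} t * exp (t * z - t\<^sup>2 / 2) * \<bar>a - t\<bar> powr u) \<partial>lborel)"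
    by (subst (2) nn_integral_real_affine[where c=1 and t=z]) simp_all
  finally show ?thesis .
qed

lemma nn_integral_exp_std_normal:
  "(\<integral>\<^sup>+x. ennreal (exp (c * x)) \<partial>gauss) = ennreal (exp (c\<^sup>2 / 2))"
proof -
  interpret N: prob_space "density lborel (normal_density c 1)" by (rule prob_space_normal_density) simp
  have "(\<integral>\<^sup>+x. ennreal (exp (c * x)) \<partial>gauss) = (\<integral>\<^sup>+x. ennreal (exp (c\<^sup>2 / 2)) * ennreal (normal_density c 1 x) \<partial>lborel)"
  proof (subst nn_integral_std_normal, simp, intro nn_integral_cong)
    fix x :: real
    have "exp (- x\<^sup>2 / 2) * exp (c * x) = exp (c\<^sup>2 / 2) * exp (- (x - c)\<^sup>2 / 2)"
      by (simp add: power2_eq_square field_simps flip: exp_add)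
    then have "std_normal_density x * exp (c * x) = exp (c\<^sup>2 / 2) * normal_density c 1 x"
      by (simp add: normal_density_def field_simps)
    then show "ennreal (std_normal_density x) * ennreal (exp (c * x)) = ennreal (exp (c\<^sup>2 / 2)) * ennreal (normal_density c 1 x)"
      by (simp add: ennreal_mult'[symmetric])
  qed
  also have "\<dots> = ennreal (exp (c\<^sup>2 / 2)) * (\<integral>\<^sup>+x. ennreal (normal_density c 1 x) \<partial>lborel)"
    by (rule nn_integral_cmult) simp
  also have "(\<integral>\<^sup>+x. ennreal (normal_density c 1 x) \<partial>lborel) = 1"
    using N.emeasure_space_1 by (simp add: emeasure_density)
  finally show ?thesis by simp
qed

text \<open>Lower bound for the unnormalised posterior risk at the statistic \<open>z\<close>. It is
  set to zero when the window of radius \<open>b\<close> about \<open>z\<close> sticks out of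
  \<open>[-T, T]\<close>.\<close>

definition window_bound :: "real \<Rightarrow> real \<Rightarrow> real \<Rightarrow> real \<Rightarrow> real" where
  "window_bound u b T z = indicator {-(T - b)..T - b} z * exp (z\<^sup>2 / 2) * (sqrt (2 * pi) * gauss_trunc_moment u b)"

lemma window_bound_measurable [measurable]: "window_bound u b T \<in> borel_measurable borel"
  unfolding window_bound_def by measurable

text \<open>The statistic \<open>\<Delta>\<close> carries information \<open>1 - \<kappa>\<close>
  about \<open>t\<close>, and \<open>x\<close> stands for an additional observation that completes
  it to 1. The same \<open>a\<close> is used for every \<open>x\<close>, so the bound for
  information 1 may be averaged over \<open>x\<close>; the average of
  \<open>exp (t * sqrt \<kappa> * x)\<close> is \<open>exp (t^2 * \<kappa> / 2)\<close>, which turns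
  the exponent into the one for \<open>1 - \<kappa>\<close>.\<close>

lemma gaussian_bayes_bound:
  assumes u: "1 \<le> u" "u \<le> 2" and b: "b > 0" and \<kappa>: "\<kappa> \<ge> 0"
  shows "(\<integral>\<^sup>+x. ennreal (window_bound u b T (\<Delta> + sqrt \<kappa> * x)) \<partial>gauss)
    \<le> (\<integral>\<^sup>+t. ennreal (indicator {-T..T} t * exp (t * \<Delta> - t\<^sup>2 * (1 - \<kappa>) / 2) * \<bar>a - t\<bar> powr u) \<partial>lborel)"
proof -
  let ?F = "\<lambda>x t. ennreal (indicator {-T..T} t * exp (t * (\<Delta> + sqrt \<kappa> * x) - t\<^sup>2 / 2) * \<bar>a - t\<bar> powr u)"
  let ?G = "\<lambda>t. ennreal (indicator {-T..T} t * exp (t * \<Delta> - t\<^sup>2 * (1 - \<kappa>) / 2) * \<bar>a - t\<bar> powr u)"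
  interpret N: prob_space gauss by (rule prob_space_std_normal)
  interpret pair_sigma_finite lborel gauss
    by (simp add: pair_sigma_finite_def N.sigma_finite_measure_axioms lborel.sigma_finite_measure_axioms)
  have "(\<integral>\<^sup>+x. ennreal (window_bound u b T (\<Delta> + sqrt \<kappa> * x)) \<partial>gauss) \<le>
     (\<integral>\<^sup>+x. (\<integral>\<^sup>+t. ?F x t \<partial>lborel) \<partial>gauss)"
  proof (rule nn_integral_mono)
    fix x :: real
    show "ennreal (window_bound u b T (\<Delta> + sqrt \<kappa> * x)) \<le> (\<integral>\<^sup>+t. ?F x t \<partial>lborel)"
    proof (cases "\<bar>\<Delta> + sqrt \<kappa> * x\<bar> \<le> T - b")
      case True
      then show ?thesis using gaussian_posterior_window[OF u b True, of a] by (auto simp: window_bound_def indicator_def abs_le_iff)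
    next
      case False
      then have "window_bound u b T (\<Delta> + sqrt \<kappa> * x) = 0" by (auto simp: window_bound_def indicator_def)
      then show ?thesis by simp
    qed
  qed
  also have "\<dots> = (\<integral>\<^sup>+t. (\<integral>\<^sup>+x. ?F x t \<partial>gauss) \<partial>lborel)"
    by (rule Fubini') measurable
  also have "\<dots> = (\<integral>\<^sup>+t. ?G t \<partial>lborel)"
  proof (rule nn_integral_cong)
    fix t :: real
    have "(\<integral>\<^sup>+x. ?F x t \<partial>gauss)
      = (\<integral>\<^sup>+x. ennreal (indicator {-T..T} t * exp (t * \<Delta> - t\<^sup>2 / 2) * \<bar>a - t\<bar> powr u) * ennreal (exp ((t * sqrt \<kappa>) * x)) \<partial>gauss)"
    proof (rule nn_integral_cong)
      fix x :: real
      have e: "exp (t * (\<Delta> + sqrt \<kappa> * x) - t\<^sup>2 / 2) = exp (t * \<Delta> - t\<^sup>2 / 2) * exp ((t * sqrt \<kappa>) * x)"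
        by (simp add: algebra_simps flip: exp_add)
      show "?F x t = ennreal (indicator {-T..T} t * exp (t * \<Delta> - t\<^sup>2 / 2) * \<bar>a - t\<bar> powr u) * ennreal (exp ((t * sqrt \<kappa>) * x))"
        unfolding e by (subst ennreal_mult'[symmetric]) (simp_all add: mult_ac)
    qed
    also have "\<dots> = ennreal (indicator {-T..T} t * exp (t * \<Delta> - t\<^sup>2 / 2) * \<bar>a - t\<bar> powr u) * ennreal (exp ((t * sqrt \<kappa>)\<^sup>2 / 2))"
      by (subst nn_integral_cmult) (simp_all add: nn_integral_exp_std_normal)
    also have "\<dots> = ?G t"
    proof -
      have e: "exp (t * \<Delta> - t\<^sup>2 * (1 - \<kappa>) / 2) = exp (t * \<Delta> - t\<^sup>2 / 2) * exp ((t * sqrt \<kappa>)\<^sup>2 / 2)"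
        using \<kappa> by (simp add: power_mult_distrib field_simps flip: exp_add)
      show ?thesis unfolding e by (subst ennreal_mult'[symmetric]) (simp_all add: mult_ac)
    qed
    finally show "(\<integral>\<^sup>+x. ?F x t \<partial>gauss)
      = ?G t" .
  qed
  finally show ?thesis .
qed

lemma window_bound_nonneg: "window_bound u b T z \<ge> 0"
  by (simp add: window_bound_def gauss_trunc_moment_nonneg)

lemma window_bound_le: "\<bar>window_bound u b T z\<bar> \<le> exp ((T - b)\<^sup>2 / 2) * (sqrt (2 * pi) * gauss_trunc_moment u b)"
proof -
  have "z\<^sup>2 \<le> (T - b)\<^sup>2" if "- (T - b) \<le> z" "z \<le> T - b" using that by (intro abs_le_square_iff[THEN iffD1]) auto
  then have "indicator {-(T - b)..T - b} z * exp (z\<^sup>2 / 2) \<le> exp ((T - b)\<^sup>2 / 2)" by (auto simp: indicator_def)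
  then show ?thesis unfolding abs_of_nonneg[OF window_bound_nonneg]
    unfolding window_bound_def by (intro mult_right_mono) (auto simp: gauss_trunc_moment_nonneg)
qed

text \<open>The factor \<open>exp (z^2 / 2)\<close> cancels the normal density, so only the length
  of the admissible interval remains.\<close>

lemma integral_window_bound:
  assumes "b \<le> T"
  shows "(\<integral>z. window_bound u b T z \<partial>gauss) = 2 * (T - b) * gauss_trunc_moment u b"
proof -
  have "(\<integral>z. window_bound u b T z \<partial>gauss) = (\<integral>z. std_normal_density z * window_bound u b T z \<partial>lborel)"
    by (subst integral_density) auto
  also have "\<dots> = (\<integral>z. indicator {-(T - b)..T - b} z * gauss_trunc_moment u b \<partial>lborel)"
  proof (rule Bochner_Integration.integral_cong)
    fix z :: real
    have "exp (- z\<^sup>2 / 2) * exp (z\<^sup>2 / 2) = 1" by (simp flip: exp_add)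
    then show "std_normal_density z * window_bound u b T z = indicator {-(T - b)..T - b} z * gauss_trunc_moment u b"
      by (simp add: std_normal_density_def window_bound_def)
  qed simp
  also have "\<dots> = 2 * (T - b) * gauss_trunc_moment u b" using assms by (simp add: measure_def)
  finally show ?thesis .
qed

text \<open>The jumps sit at the two ends of the interval. This is what lets weak convergence be
  applied to a discontinuous integrand.\<close>

lemma window_bound_discontinuity_null: "gauss {z. \<not> isCont (window_bound u b T) z} = 0"
proof -
  have sub: "{z. \<not> isCont (window_bound u b T) z} \<subseteq> {-(T - b), T - b}"
  proof (rule subsetI, rule ccontr)
    fix z assume "z \<in> {z. \<not> isCont (window_bound u b T) z}" "z \<notin> {-(T - b), T - b}"
    then have z: "\<not> isCont (window_bound u b T) z" "z \<noteq> T - b" "z \<noteq> -(T - b)" by auto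
    show False
    proof -
      have "z \<notin> frontier {-(T - b)..T - b}" using z by (auto simp: frontier_def interior_atLeastAtMost_real)
      then have "isCont (indicator {-(T - b)..T - b} :: real \<Rightarrow> real) z" by (simp add: isCont_indicator)
      then have "isCont (\<lambda>z. indicator {-(T - b)..T - b} z * exp (z\<^sup>2 / 2) * (sqrt (2 * pi) * gauss_trunc_moment u b)) z"
        by (intro continuous_intros) auto
      then show False using z unfolding window_bound_def[abs_def] by simp
    qed
  qed
  have "AE x in lborel. x \<noteq> - (T - b)" "AE x in lborel. x \<noteq> T - b" by (rule AE_lborel_singleton)+
  then have "AE x in lborel. x \<notin> {-(T - b), T - b}" by eventually_elim simp
  then have "AE x in gauss. x \<notin> {-(T - b), T - b}" by (subst AE_density) auto
  then have "{-(T - b), T - b} \<in> null_sets gauss" by (subst AE_iff_null_sets) auto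
  then have "gauss {-(T - b), T - b} = 0" by (rule null_setsD1)
  then show ?thesis using emeasure_mono[OF sub, of gauss] by simp
qed

section \<open>Bayes risk of one-parameter local experiments\<close>

text \<open>The real \<open>r\<close> records that the integral is finite, so that lower bounds
  (\<open>clt_window_bound\<close>) and upper bounds (\<open>absolute_moment_clt\<close>) can both
  be read off without subtracting in \<open>ennreal\<close>.\<close>

lemma expectation_clt:
  fixes h :: "real \<Rightarrow> real"
  assumes B: "B \<ge> 0" and \<eta>: "\<eta> > 0" and h[measurable]: "h \<in> borel_measurable borel"
    and hK: "\<And>x. 0 \<le> h x" "\<And>x. h x \<le> K" and disc: "gauss {x. \<not> isCont h x} = 0"
  shows "\<forall>\<^sub>F n in sequentially. \<forall>(m::'b measure) f. score B m f \<and> (\<integral>y. (f y)\<^sup>2 \<partial>m) \<le> 1 \<longrightarrow>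
    (\<exists>r. \<bar>r - (\<integral>x. h x \<partial>gauss)\<bar> < \<eta> \<and>
      (\<integral>\<^sup>+y. (\<integral>\<^sup>+x. ennreal (h (nsum n f y + sqrt (1 - (\<integral>y. (f y)\<^sup>2 \<partial>m)) * x)) \<partial>gauss) \<partial>iid n m) = ennreal r)"
    (is "\<forall>\<^sub>F n in sequentially. \<forall>m f. ?P m f \<longrightarrow> ?R n m f")
proof -
  have "\<forall>\<^sub>F n in sequentially. \<forall>z :: 'b measure \<times> ('b \<Rightarrow> real). ?P (fst z) (snd z) \<longrightarrow> ?R n (fst z) (snd z)"
  proof (rule eventually_uniformly_in_parameter)
    show "\<exists>z :: 'b measure \<times> ('b \<Rightarrow> real). ?P (fst z) (snd z)"
      by (rule exI[of _ "(return (count_space UNIV) undefined, \<lambda>_. 0)"]) (use B in \<open>simp add: score_def prob_space_return\<close>)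
    fix X :: "nat \<Rightarrow> 'b measure \<times> ('b \<Rightarrow> real)"
    assume X: "\<And>n. ?P (fst (X n)) (snd (X n))"
    define m f where "m n = fst (X n)" and "f n = snd (X n)" for n
    define \<kappa> where "\<kappa> n = 1 - (\<integral>y. (f n y)\<^sup>2 \<partial>m n)" for n
    define P where "P n = iid n (m n)" for n
    define g where "g n = (\<lambda>(y, x). nsum n (f n) y + sqrt (\<kappa> n) * x)" for n
    have s: "\<And>n. score B (m n) (f n)" and \<kappa>: "\<And>n. \<kappa> n \<ge> 0" and var: "\<And>n. (\<integral>y. (f n y)\<^sup>2 \<partial>m n) + \<kappa> n = 1"
      using X by (auto simp: m_def f_def \<kappa>_def)
    interpret N: prob_space gauss by (rule prob_space_std_normal)
    have P: "prob_space (P n)" for n unfolding P_def by (rule prob_space_PiM_iid) (rule scoreD[OF s])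
    have PN: "prob_space (P n \<Otimes>\<^sub>M gauss)" for n
      by (intro prob_space_pair P N.prob_space_axioms)
    note [measurable] = scoreD(2)[OF s]
    have g[measurable]: "g n \<in> borel_measurable (P n \<Otimes>\<^sub>M gauss)" for n
      unfolding g_def P_def by measurable
    define \<mu> where "\<mu> n = distr (P n \<Otimes>\<^sub>M gauss) borel (g n)" for n
    have wc: "weak_conv_m \<mu> gauss"
      unfolding \<mu>_def g_def P_def by (rule gaussian_smoothed_clt[OF s \<kappa> var])
    have rd: "real_distribution (\<mu> n)" for n
      unfolding \<mu>_def using PN g by (rule prob_space.real_distribution_distr)
    have "(\<lambda>n. \<integral>x. h x \<partial>\<mu> n) \<longlonglongrightarrow> (\<integral>x. h x \<partial>gauss)"
      by (rule weak_conv_imp_bdd_ae_continuous_conv[OF rd real_dist_normal_dist wc disc, where B=K])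
         (use hK in auto)
    then have "\<forall>\<^sub>F n in sequentially. \<bar>(\<integral>x. h x \<partial>\<mu> n) - (\<integral>x. h x \<partial>gauss)\<bar> < \<eta>"
      using \<eta> unfolding tendsto_iff dist_real_def by blast
    then show "\<forall>\<^sub>F n in sequentially. ?R n (fst (X n)) (snd (X n))"
    proof eventually_elim
      case (elim n)
      interpret \<mu>: real_distribution "\<mu> n" by (rule rd)
      have "integrable (\<mu> n) h"
        by (rule \<mu>.integrable_const_bound[where B=K]) (use hK in auto)
      then have "ennreal (\<integral>x. h x \<partial>\<mu> n) = (\<integral>\<^sup>+x. ennreal (h x) \<partial>\<mu> n)"
        by (subst nn_integral_eq_integral) (auto simp: hK)
      also have "\<dots> = (\<integral>\<^sup>+z. ennreal (h (g n z)) \<partial>(P n \<Otimes>\<^sub>M gauss))"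
        unfolding \<mu>_def by (subst nn_integral_distr) auto
      also have "\<dots> = (\<integral>\<^sup>+y. (\<integral>\<^sup>+x. ennreal (h (g n (y, x))) \<partial>gauss) \<partial>P n)"
        by (subst N.nn_integral_fst[symmetric]) auto
      finally show ?case using elim
        by (intro exI[of _ "\<integral>x. h x \<partial>\<mu> n"]) (simp add: g_def P_def m_def f_def \<kappa>_def)
    qed
  qed
  then show ?thesis by (rule eventually_mono) auto
qed

lemma clt_window_bound:
  assumes b: "b \<le> T" and B: "B \<ge> 0" and \<eta>: "\<eta> > 0"
  shows "\<forall>\<^sub>F n in sequentially. \<forall>(m::'b measure) f. score B m f \<and> (\<integral>y. (f y)\<^sup>2 \<partial>m) \<le> 1 \<longrightarrow>
    ennreal (2 * (T - b) * gauss_trunc_moment u b - \<eta>) \<le>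
    (\<integral>\<^sup>+y. (\<integral>\<^sup>+x. ennreal (window_bound u b T (nsum n f y + sqrt (1 - (\<integral>y. (f y)\<^sup>2 \<partial>m)) * x)) \<partial>gauss) \<partial>iid n m)"
  using expectation_clt[OF B \<eta> window_bound_measurable window_bound_nonneg
      order_trans[OF abs_ge_self window_bound_le] window_bound_discontinuity_null, of u b T, where 'b='b]
proof eventually_elim
  case (elim n)
  show ?case
  proof (intro allI impI)
    fix m :: "'b measure" and f assume "score B m f \<and> (\<integral>y. (f y)\<^sup>2 \<partial>m) \<le> 1"
    from elim[rule_format, OF this]
    obtain r where r: "\<bar>r - (\<integral>z. window_bound u b T z \<partial>gauss)\<bar> < \<eta>"
      and eq: "(\<integral>\<^sup>+y. (\<integral>\<^sup>+x. ennreal (window_bound u b T (nsum n f y + sqrt (1 - (\<integral>y. (f y)\<^sup>2 \<partial>m)) * x)) \<partial>gauss) \<partial>iid n m) = ennreal r"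
      by blast
    show "ennreal (2 * (T - b) * gauss_trunc_moment u b - \<eta>) \<le>
      (\<integral>\<^sup>+y. (\<integral>\<^sup>+x. ennreal (window_bound u b T (nsum n f y + sqrt (1 - (\<integral>y. (f y)\<^sup>2 \<partial>m)) * x)) \<partial>gauss) \<partial>iid n m)"
      unfolding eq by (rule ennreal_leI) (use r in \<open>simp add: integral_window_bound[OF b]\<close>)
  qed
qed

lemma ennreal_le_plus: "x \<le> a + b \<Longrightarrow> 0 \<le> a \<Longrightarrow> 0 \<le> b \<Longrightarrow> ennreal x \<le> ennreal a + ennreal b"
  by (metis ennreal_leI ennreal_plus)

lemma nsum_scale: "nsum n (\<lambda>y. t * f y) y = t * nsum n f y"
  by (simp add: nsum_def sum_distrib_left)

text \<open>Clipping an estimate to the range of the parameter does no harm and makes the loss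
  bounded, as the \<open>L1\<close> approximation of the likelihood requires.\<close>

lemma abs_diff_clamp_le:
  fixes d t T :: real
  assumes "\<bar>t\<bar> \<le> T"
  shows "\<bar>max (- T) (min T d) - t\<bar> \<le> \<bar>d - t\<bar>" "\<bar>max (- T) (min T d) - t\<bar> \<le> 2 * T"
  using assms by (auto simp: max_def min_def)

text \<open>The prior is left unnormalised; statistics outside \<open>[-(T - b), T - b]\<close> are
  given up, which turns the length \<open>2 * T\<close> into \<open>2 * (T - b)\<close>. The
  Gaussian density is exchanged for \<open>lik\<close> with the clipped loss, and only then is
  clipping undone.\<close>

theorem bayes_risk_window:
  assumes u: "1 \<le> u" "u \<le> 2" and b: "0 < b" "b \<le> T" and B: "B \<ge> 0" and \<eta>: "\<eta> > 0"
  shows "\<forall>\<^sub>F n in sequentially. \<forall>(m::'b measure) f \<delta>. score B m f \<and> (\<integral>y. (f y)\<^sup>2 \<partial>m) \<le> 1 \<and> \<delta> \<in> borel_measurable (iid n m) \<longrightarrow>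
    ennreal (2 * (T - b) * gauss_trunc_moment u b - \<eta>) \<le>
    (\<integral>\<^sup>+t. (\<integral>\<^sup>+y. ennreal (indicator {-T..T} t * lik n (\<lambda>y. t * f y) y * \<bar>\<delta> y - t\<bar> powr u) \<partial>iid n m) \<partial>lborel)"
proof -
  have T: "T > 0" using b by simp
  define K where "K = (2 * T) powr u"
  have K: "K > 0" using T by (simp add: K_def)
  \<comment> \<open>A loss of at most \<open>K\<close> and a prior of length \<open>2 * T\<close>
    turn \<open>\<eta>'\<close> into \<open>\<eta> / 2\<close>; the other half pays for the central
    limit theorem.\<close>
  define \<eta>' where "\<eta>' = \<eta> / 2 / (K * (2 * T))"
  have \<eta>': "\<eta>' > 0" using \<eta> K T by (simp add: \<eta>'_def)
  have TB: "T * B \<ge> 0" using T B by simp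
  have \<eta>2: "\<eta> / 2 > 0" using \<eta> by simp
  show ?thesis using lik_approx_L1[where 'b='b, OF TB \<eta>'] clt_window_bound[where 'b='b, OF b(2) B \<eta>2, of u]
  proof eventually_elim
    case (elim n)
    note L1 = elim(1)[rule_format] and W = elim(2)[rule_format]
    show ?case
    proof (intro allI impI, elim conjE)
      fix m :: "'b measure" and f and \<delta> :: "(nat \<Rightarrow> 'b) \<Rightarrow> real"
      assume s: "score B m f" and J1: "(\<integral>y. (f y)\<^sup>2 \<partial>m) \<le> 1" and \<delta>[measurable]: "\<delta> \<in> borel_measurable (iid n m)"
      define P where "P = iid n m"
      define J where "J = (\<integral>y. (f y)\<^sup>2 \<partial>m)"
      interpret P: prob_space P unfolding P_def by (rule prob_space_PiM_iid) (rule scoreD[OF s])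
      interpret pair_sigma_finite lborel P
        by (simp add: pair_sigma_finite_def P.sigma_finite_measure_axioms lborel.sigma_finite_measure_axioms)
      note [measurable] = scoreD(2)[OF s]
      have [measurable]: "\<delta> \<in> borel_measurable P" unfolding P_def by measurable
      define d where "d y = max (- T) (min T (\<delta> y))" for y
      have [measurable]: "d \<in> borel_measurable P" unfolding d_def by measurable
      define G where "G t y = exp (t * nsum n f y - t\<^sup>2 * J / 2)" for t y
      define L where "L t y = lik n (\<lambda>y. t * f y) y" for t y
      have [measurable]: "(\<lambda>(t, y). G t y) \<in> borel_measurable (lborel \<Otimes>\<^sub>M P)" unfolding G_def P_def by measurable
      have Lm[measurable]: "(\<lambda>(t, y). L t y) \<in> borel_measurable (lborel \<Otimes>\<^sub>M P)" unfolding L_def lik_def P_def by measurable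
      have LG: "(\<integral>\<^sup>+y. ennreal \<bar>L t y - G t y\<bar> \<partial>P) \<le> ennreal \<eta>'" if t: "\<bar>t\<bar> \<le> T" for t
      proof -
        have e: "(\<integral>y. (t * f y)\<^sup>2 \<partial>m) = t\<^sup>2 * J" by (simp add: power_mult_distrib J_def)
        show ?thesis using L1[OF score_scale[OF s t]] unfolding e nsum_scale by (simp add: L_def G_def P_def)
      qed
      define R where "R = (\<integral>\<^sup>+t. (\<integral>\<^sup>+y. ennreal (indicator {-T..T} t * L t y * \<bar>\<delta> y - t\<bar> powr u) \<partial>P) \<partial>lborel)"
      have "ennreal (2 * (T - b) * gauss_trunc_moment u b - \<eta> / 2) \<le>
        (\<integral>\<^sup>+y. (\<integral>\<^sup>+x. ennreal (window_bound u b T (nsum n f y + sqrt (1 - J) * x)) \<partial>gauss) \<partial>P)"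
        using W[of m f] s J1 by (simp add: P_def J_def)
      also have "\<dots> \<le> (\<integral>\<^sup>+y. (\<integral>\<^sup>+t. ennreal (indicator {-T..T} t * G t y * \<bar>d y - t\<bar> powr u) \<partial>lborel) \<partial>P)"
      proof (rule nn_integral_mono)
        fix y
        show "(\<integral>\<^sup>+x. ennreal (window_bound u b T (nsum n f y + sqrt (1 - J) * x)) \<partial>gauss) \<le> (\<integral>\<^sup>+t. ennreal (indicator {-T..T} t * G t y * \<bar>d y - t\<bar> powr u) \<partial>lborel)"
          using gaussian_bayes_bound[OF u b(1), of "1 - J" T "nsum n f y" "d y"] J1 by (simp add: G_def J_def)
      qed
      also have "\<dots> = (\<integral>\<^sup>+t. (\<integral>\<^sup>+y. ennreal (indicator {-T..T} t * G t y * \<bar>d y - t\<bar> powr u) \<partial>P) \<partial>lborel)"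
        by (rule Fubini') measurable
      also have "\<dots> \<le> (\<integral>\<^sup>+t. (\<integral>\<^sup>+y. ennreal (indicator {-T..T} t * L t y * \<bar>\<delta> y - t\<bar> powr u) \<partial>P) + ennreal (K * \<eta>') * indicator {-T..T} t \<partial>lborel)"
      proof (rule nn_integral_mono)
        fix t :: real
        show "(\<integral>\<^sup>+y. ennreal (indicator {-T..T} t * G t y * \<bar>d y - t\<bar> powr u) \<partial>P) \<le>
          (\<integral>\<^sup>+y. ennreal (indicator {-T..T} t * L t y * \<bar>\<delta> y - t\<bar> powr u) \<partial>P) + ennreal (K * \<eta>') * indicator {-T..T} t"
        proof (cases "t \<in> {-T..T}")
          case True
          then have t: "\<bar>t\<bar> \<le> T" by auto
          have [measurable]: "(\<lambda>y. L t y) \<in> borel_measurable P" "(\<lambda>y. G t y) \<in> borel_measurable P" unfolding L_def lik_def G_def P_def by measurable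
          have "(\<integral>\<^sup>+y. ennreal (indicator {-T..T} t * G t y * \<bar>d y - t\<bar> powr u) \<partial>P) \<le>
            (\<integral>\<^sup>+y. ennreal (indicator {-T..T} t * L t y * \<bar>\<delta> y - t\<bar> powr u) + ennreal K * ennreal \<bar>L t y - G t y\<bar> \<partial>P)"
          proof (rule nn_integral_mono)
            fix y
            define l where "l = \<bar>d y - t\<bar> powr u"
            have l: "0 \<le> l" "l \<le> \<bar>\<delta> y - t\<bar> powr u" "l \<le> K"
              unfolding l_def K_def d_def using abs_diff_clamp_le[OF t, of "\<delta> y"] u by (auto intro!: powr_mono2)
            \<comment> \<open>\<open>L\<close> can be negative and then counts as zero under
              \<open>ennreal\<close>, hence \<open>max 0\<close>. The difference
              \<open>L - G\<close> meets only the clipped loss \<open>l \<le> K\<close>.\<close>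
            have "G t y * l \<le> max 0 (L t y) * l + \<bar>L t y - G t y\<bar> * l"
              unfolding distrib_right[symmetric] using l by (intro mult_right_mono) (auto simp: max_def)
            also have "\<dots> \<le> max 0 (L t y) * \<bar>\<delta> y - t\<bar> powr u + \<bar>L t y - G t y\<bar> * K"
              using l by (intro add_mono mult_left_mono) auto
            finally have "ennreal (G t y * l) \<le> ennreal (max 0 (L t y) * \<bar>\<delta> y - t\<bar> powr u) + ennreal (\<bar>L t y - G t y\<bar> * K)"
              using K by (intro ennreal_le_plus) auto
            also have "ennreal (max 0 (L t y) * \<bar>\<delta> y - t\<bar> powr u) = ennreal (L t y * \<bar>\<delta> y - t\<bar> powr u)"
              by (auto simp: max_def ennreal_neg mult_nonpos_nonneg)
            finally show "ennreal (indicator {-T..T} t * G t y * \<bar>d y - t\<bar> powr u) \<le> ennreal (indicator {-T..T} t * L t y * \<bar>\<delta> y - t\<bar> powr u) + ennreal K * ennreal \<bar>L t y - G t y\<bar>"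
              using True K by (simp add: l_def ennreal_mult'[symmetric] mult.commute)
          qed
          also have "\<dots> = (\<integral>\<^sup>+y. ennreal (indicator {-T..T} t * L t y * \<bar>\<delta> y - t\<bar> powr u) \<partial>P) + ennreal K * (\<integral>\<^sup>+y. ennreal \<bar>L t y - G t y\<bar> \<partial>P)"
            by (subst nn_integral_add) (auto simp: nn_integral_cmult)
          also have "ennreal K * (\<integral>\<^sup>+y. ennreal \<bar>L t y - G t y\<bar> \<partial>P) \<le> ennreal (K * \<eta>') * indicator {-T..T} t"
            using LG[OF t] True K by (simp add: ennreal_mult' mult_left_mono)
          finally show ?thesis by (simp add: add_left_mono)
        qed simp
      qed
      also have "\<dots> = R + ennreal (K * \<eta>') * ennreal (2 * T)"
        unfolding R_def using T by (subst nn_integral_add) (auto simp: nn_integral_cmult_indicator)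
      also have "ennreal (K * \<eta>') * ennreal (2 * T) = ennreal (\<eta> / 2)"
        using K T \<eta>' \<eta> by (subst ennreal_mult'[symmetric]) (auto simp: \<eta>'_def)
      finally have R: "ennreal (2 * (T - b) * gauss_trunc_moment u b - \<eta> / 2) \<le> R + ennreal (\<eta> / 2)" .
      have "ennreal (2 * (T - b) * gauss_trunc_moment u b - \<eta>) \<le> R"
      proof (cases R)
        case (real r)
        then have "ennreal (2 * (T - b) * gauss_trunc_moment u b - \<eta> / 2) \<le> ennreal (r + \<eta> / 2)" using R \<eta> by simp
        then have "2 * (T - b) * gauss_trunc_moment u b - \<eta> / 2 \<le> r + \<eta> / 2" using real \<eta> by (subst (asm) ennreal_le_iff) auto
        then show ?thesis using real by (simp add: ennreal_leI)
      qed simp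
      then show "ennreal (2 * (T - b) * gauss_trunc_moment u b - \<eta>) \<le>
        (\<integral>\<^sup>+t. (\<integral>\<^sup>+y. ennreal (indicator {-T..T} t * lik n (\<lambda>y. t * f y) y * \<bar>\<delta> y - t\<bar> powr u) \<partial>iid n m) \<partial>lborel)"
        by (simp add: R_def P_def L_def)
    qed
  qed
qed

text \<open>First \<open>b\<close> is taken so large that truncating the moment is harmless, then
  \<open>T\<close> so large that the boundary strip is. \<open>T\<close> is fixed before
  \<open>B\<close>, so that one cube serves all coordinates of the prior although their scores have
  different bounds.\<close>

theorem bayes_risk_uniform_prior:
  assumes u: "1 \<le> u" "u \<le> 2" and \<eta>: "\<eta> > 0"
  obtains T where "T > 0" "\<And>B. B \<ge> 0 \<Longrightarrow> \<forall>\<^sub>F n in sequentially. \<forall>(m::'b measure) f \<delta>. score B m f \<and> (\<integral>y. (f y)\<^sup>2 \<partial>m) \<le> 1 \<and> \<delta> \<in> borel_measurable (iid n m) \<longrightarrow>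
    ennreal (gauss_moment u - \<eta>) \<le>
    (\<integral>\<^sup>+t. tilted_risk u n m f \<delta> t \<partial>uniform_measure lborel {-T..T})"
proof -
  have "\<forall>\<^sub>F n in sequentially. gauss_trunc_moment u (real n) > gauss_moment u - \<eta> / 3"
    using gauss_trunc_moment_tendsto[of u] u \<eta> by (intro order_tendstoD(1)) auto
  then have "\<forall>\<^sub>F n in sequentially. gauss_trunc_moment u (real n) > gauss_moment u - \<eta> / 3 \<and> n > 0"
    using eventually_gt_at_top[of 0] by eventually_elim simp
  then obtain n where n: "gauss_trunc_moment u (real n) > gauss_moment u - \<eta> / 3" "n > 0"
    by (auto dest!: eventually_happens)
  define b where "b = real n"
  define Cb where "Cb = gauss_trunc_moment u b"
  have b: "b > 0" and C: "Cb > gauss_moment u - \<eta> / 3" "Cb \<ge> 0" using n by (auto simp: b_def Cb_def gauss_trunc_moment_nonneg)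
  \<comment> \<open>Makes \<open>b * Cb / T\<close> at most \<open>\<eta> / 3\<close>. The losses
    are then \<open>\<eta> / 3\<close> from truncation, \<open>\<eta> / 3\<close> from the boundary
    and \<open>\<eta> / 4\<close> from the error \<open>\<eta> * T / 2\<close> after division by
    \<open>2 * T\<close>.\<close>
  define T where "T = b + 3 * b * Cb / \<eta>"
  have T: "T \<ge> b" "T > 0" using b C \<eta> by (auto simp: T_def add_pos_nonneg)
  have ineq: "gauss_moment u - \<eta> \<le> (2 * (T - b) * Cb - \<eta> * T / 2) / (2 * T)"
  proof -
    have "b * Cb \<le> \<eta> / 3 * T" using b C \<eta> by (simp add: T_def field_simps)
    then have "b * Cb / T \<le> \<eta> / 3" using T by (simp add: field_simps)
    moreover have "(2 * (T - b) * Cb - \<eta> * T / 2) / (2 * T) = Cb - b * Cb / T - \<eta> / 4"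
      using T by (simp add: field_simps)
    ultimately show ?thesis using C \<eta> by linarith
  qed
  show ?thesis
  proof (rule that[OF T(2)])
    fix B :: real assume B: "B \<ge> 0"
    have e: "\<eta> * T / 2 > 0" using \<eta> T by simp
    show "\<forall>\<^sub>F n in sequentially. \<forall>(m::'b measure) f \<delta>. score B m f \<and> (\<integral>y. (f y)\<^sup>2 \<partial>m) \<le> 1 \<and> \<delta> \<in> borel_measurable (iid n m) \<longrightarrow>
      ennreal (gauss_moment u - \<eta>) \<le>
      (\<integral>\<^sup>+t. tilted_risk u n m f \<delta> t \<partial>uniform_measure lborel {-T..T})"
      using bayes_risk_window[OF u b T(1) B e, where 'b='b]
    proof eventually_elim
      case (elim n)
      show ?case
      proof (intro allI impI)
        fix m :: "'b measure" and f and \<delta> :: "(nat \<Rightarrow> 'b) \<Rightarrow> real"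
        assume a: "score B m f \<and> (\<integral>y. (f y)\<^sup>2 \<partial>m) \<le> 1 \<and> \<delta> \<in> borel_measurable (iid n m)"
        define P where "P = iid n m"
        interpret P: prob_space P unfolding P_def by (rule prob_space_PiM_iid) (use a scoreD in blast)
        have [measurable]: "f \<in> borel_measurable m" "\<delta> \<in> borel_measurable P" using a by (auto simp: score_def P_def)
        have [measurable]: "(\<lambda>(t, y). lik n (\<lambda>y. t * f y) y) \<in> borel_measurable (lborel \<Otimes>\<^sub>M P)" unfolding lik_def P_def by measurable
        have "ennreal (gauss_moment u - \<eta>) \<le> ennreal ((2 * (T - b) * Cb - \<eta> * T / 2) / (2 * T))" by (rule ennreal_leI[OF ineq])
        also have "\<dots> = ennreal (2 * (T - b) * Cb - \<eta> * T / 2) / ennreal (2 * T)"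
          using T by (cases "2 * (T - b) * Cb - \<eta> * T / 2 \<ge> 0") (auto simp: divide_ennreal ennreal_neg divide_nonpos_pos)
        also have "\<dots> \<le> (\<integral>\<^sup>+t. (\<integral>\<^sup>+y. ennreal (indicator {-T..T} t * lik n (\<lambda>y. t * f y) y * \<bar>\<delta> y - t\<bar> powr u) \<partial>P) \<partial>lborel) / ennreal (2 * T)"
          by (rule divide_right_mono_ennreal) (use elim[rule_format, OF a] in \<open>simp add: P_def Cb_def\<close>)
        also have "(\<integral>\<^sup>+t. (\<integral>\<^sup>+y. ennreal (indicator {-T..T} t * lik n (\<lambda>y. t * f y) y * \<bar>\<delta> y - t\<bar> powr u) \<partial>P) \<partial>lborel)
          = (\<integral>\<^sup>+t. (\<integral>\<^sup>+y. ennreal (lik n (\<lambda>y. t * f y) y * \<bar>\<delta> y - t\<bar> powr u) \<partial>P) * indicator {-T..T} t \<partial>lborel)"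
          by (rule nn_integral_cong) (simp add: indicator_def)
        also have "\<dots> / ennreal (2 * T) = (\<integral>\<^sup>+t. (\<integral>\<^sup>+y. ennreal (lik n (\<lambda>y. t * f y) y * \<bar>\<delta> y - t\<bar> powr u) \<partial>P) \<partial>uniform_measure lborel {-T..T})"
          using T by (subst nn_integral_uniform_measure) auto
        finally show "ennreal (gauss_moment u - \<eta>) \<le> (\<integral>\<^sup>+t. tilted_risk u n m f \<delta> t \<partial>uniform_measure lborel {-T..T})"
          by (simp add: P_def)
      qed
    qed
  qed
qed

section \<open>Fisher information under the privacy constraint\<close>

text \<open>Coordinates are pushed to an endpoint one after another, each time without decreasing
  \<open>q\<close>.\<close>

lemma coordinatewise_convex_box_max:
  fixes q :: "(nat \<Rightarrow> real) \<Rightarrow> real"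
  assumes fin: "finite S"
    and cvx: "\<And>x i t. i \<in> S \<Longrightarrow> a \<le> t \<Longrightarrow> t \<le> b \<Longrightarrow> q (x(i := t)) \<le> max (q (x(i := a))) (q (x(i := b)))"
    and x: "\<And>i. i \<in> S \<Longrightarrow> a \<le> x i \<and> x i \<le> b"
  shows "\<exists>z. (\<forall>i\<in>S. z i \<in> {a, b}) \<and> (\<forall>i. i \<notin> S \<longrightarrow> z i = x i) \<and> q x \<le> q z"
  using fin cvx x
proof (induction S arbitrary: x rule: finite_induct)
  case (insert i S)
  have "\<exists>z. (\<forall>j\<in>S. z j \<in> {a, b}) \<and> (\<forall>j. j \<notin> S \<longrightarrow> z j = x j) \<and> q x \<le> q z"
    using insert.prems by (intro insert.IH) auto
  then obtain z where z: "\<forall>j\<in>S. z j \<in> {a, b}" "\<forall>j. j \<notin> S \<longrightarrow> z j = x j" "q x \<le> q z" by blast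
  have "z i = x i" using z(2) insert.hyps by simp
  then have "q z \<le> max (q (z(i := a))) (q (z(i := b)))"
    using insert.prems(1)[of i "z i" z] insert.prems(2)[of i] by (simp del: fun_upd_apply) (metis fun_upd_triv)
  then obtain c where c: "c \<in> {a, b}" "q z \<le> q (z(i := c))" by (auto simp: max_def split: if_splits)
  have "q x \<le> q (z(i := c))" using z(3) c(2) by linarith
  then show ?case
    by (intro exI[of _ "z(i := c)"] conjI) (use z c insert.hyps in \<open>auto simp del: fun_upd_apply simp: fun_upd_def[of z i c]\<close>)
qed auto

text \<open>The secant slopes over \<open>[a, t]\<close> and \<open>[t, b]\<close> are
  \<open>A * (t + a) + B\<close> and \<open>A * (t + b) + B\<close>. A violation would make the
  first positive and the second negative, against their order.\<close>

lemma quadratic_le_max_endpoints: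
  fixes A B C t a b :: real
  assumes "A \<ge> 0" "a \<le> t" "t \<le> b"
  shows "A * t\<^sup>2 + B * t + C \<le> max (A * a\<^sup>2 + B * a + C) (A * b\<^sup>2 + B * b + C)"
proof (rule ccontr)
  assume "\<not> ?thesis"
  then have 1: "A * t\<^sup>2 + B * t > A * a\<^sup>2 + B * a" and 2: "A * t\<^sup>2 + B * t > A * b\<^sup>2 + B * b" by auto
  have "(t - a) * (A * (t + a) + B) > 0" using 1 by (simp add: algebra_simps power2_eq_square)
  then have p: "A * (t + a) + B > 0" using assms by (simp add: zero_less_mult_iff)
  have "(b - t) * (A * (t + b) + B) < 0" using 2 by (simp add: algebra_simps power2_eq_square)
  then have n: "A * (t + b) + B < 0" using assms by (simp add: mult_less_0_iff)
  have "A * (b - a) \<ge> 0" using assms by simp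
  then show False using p n by (simp add: algebra_simps)
qed

text \<open>With \<open>c\<close> fixed, the function \<open>k * (sum of x i^2) - (1 + c) * (sum of x i)^2\<close> is convex in every single
  coordinate when \<open>c \<le> k - 1\<close>, so it is enough to look at the vertices of the box; for larger \<open>c\<close> it is
  trivially nonpositive.\<close>

lemma bounded_ratio_variance:
  fixes x :: "nat \<Rightarrow> real" and E c :: real
  assumes k: "k \<ge> 2" and E: "E > 1"
    and x0: "\<And>i. i \<in> {1..k} \<Longrightarrow> 0 \<le> x i"
    and ratio: "\<And>i j. i \<in> {1..k} \<Longrightarrow> j \<in> {1..k} \<Longrightarrow> x i \<le> E * x j"
    and c: "\<And>d. d \<in> {1..k-1} \<Longrightarrow> real d * (real k - real d) * (E - 1)\<^sup>2 \<le> c * (real d * E + real k - real d)\<^sup>2"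
  shows "real k * (\<Sum>i=1..k. (x i)\<^sup>2) \<le> (1 + c) * (\<Sum>i=1..k. x i)\<^sup>2"
proof (cases "c \<le> real k - 1")
  case False
  have "(\<Sum>i=1..k. (x i)\<^sup>2) \<le> (\<Sum>i=1..k. x i * (\<Sum>j=1..k. x j))"
  proof (rule sum_mono)
    fix i assume i: "i \<in> {1..k}"
    have "x i \<le> (\<Sum>j=1..k. x j)" by (rule member_le_sum[OF i]) (use x0 in auto)
    then show "(x i)\<^sup>2 \<le> x i * (\<Sum>j=1..k. x j)" using x0[OF i] by (simp add: power2_eq_square mult_left_mono)
  qed
  also have "\<dots> = (\<Sum>i=1..k. x i)\<^sup>2" by (simp add: power2_eq_square sum_distrib_right)
  finally have "real k * (\<Sum>i=1..k. (x i)\<^sup>2) \<le> real k * (\<Sum>i=1..k. x i)\<^sup>2" by (simp add: mult_left_mono)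
  also have "\<dots> \<le> (1 + c) * (\<Sum>i=1..k. x i)\<^sup>2" using False by (intro mult_right_mono) auto
  finally show ?thesis .
next
  case True
  \<comment> \<open>The case \<open>d = 1\<close> of the hypothesis already rules out a negative
    \<open>c\<close>.\<close>
  have c0: "c \<ge> 0"
  proof (rule ccontr)
    assume "\<not> c \<ge> 0"
    then have "c * (real 1 * E + real k - real 1)\<^sup>2 \<le> 0" by (intro mult_nonpos_nonneg) auto
    moreover have "real 1 * (real k - real 1) * (E - 1)\<^sup>2 > 0" using k E by simp
    moreover have "1 \<in> {1..k-1}" using k by simp
    ultimately show False using c[of 1] by linarith
  qed
  \<comment> \<open>The ratio condition puts all coordinates into \<open>[a, E * a]\<close> once
    \<open>a\<close> is the smallest of them.\<close>
  define a where "a = Min (x ` {1..k})"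
  have ne: "finite (x ` {1..k})" "x ` {1..k} \<noteq> {}" using k by auto
  have a_le: "a \<le> x i" if "i \<in> {1..k}" for i unfolding a_def using that by (intro Min_le) auto
  have "a \<in> x ` {1..k}" unfolding a_def by (rule Min_in[OF ne])
  then obtain i0 where i0: "i0 \<in> {1..k}" "a = x i0" by auto
  have a0: "a \<ge> 0" using i0 x0 by simp
  have box: "a \<le> x i \<and> x i \<le> E * a" if "i \<in> {1..k}" for i using a_le[OF that] ratio[OF that i0(1)] i0(2) by simp
  define q where "q y = real k * (\<Sum>i=1..k. (y i)\<^sup>2) - (1 + c) * (\<Sum>i=1..k. y i)\<^sup>2" for y :: "nat \<Rightarrow> real"
  have "\<exists>z. (\<forall>i\<in>{1..k}. z i \<in> {a, E * a}) \<and> (\<forall>i. i \<notin> {1..k} \<longrightarrow> z i = x i) \<and> q x \<le> q z"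
  proof (rule coordinatewise_convex_box_max)
    fix y :: "nat \<Rightarrow> real" and i t assume i: "i \<in> {1..k}" and t: "a \<le> t" "t \<le> E * a"
    define S1 where "S1 = (\<Sum>j\<in>{1..k}-{i}. y j)"
    define S2 where "S2 = (\<Sum>j\<in>{1..k}-{i}. (y j)\<^sup>2)"
    \<comment> \<open>As a quadratic in one coordinate \<open>q\<close> has leading coefficient
      \<open>k - 1 - c\<close>, which is nonnegative in the present case.\<close>
    have q: "q (y(i := s)) = (real k - 1 - c) * s\<^sup>2 + (- 2 * (1 + c) * S1) * s + (real k * S2 - (1 + c) * S1\<^sup>2)" for s
    proof -
      have "(\<Sum>j=1..k. (y(i := s)) j) = s + S1" unfolding S1_def using i by (subst sum.remove[OF _ i]) (auto intro!: sum.cong)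
      moreover have "(\<Sum>j=1..k. ((y(i := s)) j)\<^sup>2) = s\<^sup>2 + S2" unfolding S2_def using i by (subst sum.remove[OF _ i]) (auto intro!: sum.cong)
      ultimately show ?thesis unfolding q_def by (simp add: power2_eq_square algebra_simps)
    qed
    show "q (y(i := t)) \<le> max (q (y(i := a))) (q (y(i := E * a)))"
      unfolding q by (rule quadratic_le_max_endpoints) (use True t in auto)
  qed (use box in auto)
  then obtain z where z: "\<forall>i\<in>{1..k}. z i \<in> {a, E * a}" "q x \<le> q z" by blast
  \<comment> \<open>The second condition matters when \<open>a = 0\<close>: then both endpoints
    coincide and every coordinate is counted as \<open>a\<close>.\<close>
  define D where "D = {i\<in>{1..k}. z i = E * a \<and> z i \<noteq> a}"
  define d where "d = card D"
  have Dk: "D \<subseteq> {1..k}" by (auto simp: D_def)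
  have dk: "d \<le> k" unfolding d_def using card_mono[OF _ Dk] by simp
  have cD: "card ({1..k} - D) = k - d" using Dk by (simp add: card_Diff_subset d_def finite_subset[OF Dk])
  have sum_z: "(\<Sum>i=1..k. g (z i)) = real d * g (E * a) + (real k - real d) * g a" for g :: "real \<Rightarrow> real"
  proof -
    have "(\<Sum>i=1..k. g (z i)) = (\<Sum>i\<in>{1..k} - D. g (z i)) + (\<Sum>i\<in>D. g (z i))" by (rule sum.subset_diff[OF Dk]) simp
    also have "(\<Sum>i\<in>{1..k} - D. g (z i)) = (\<Sum>i\<in>{1..k} - D. g a)" by (rule sum.cong) (use z in \<open>auto simp: D_def\<close>)
    also have "(\<Sum>i\<in>D. g (z i)) = (\<Sum>i\<in>D. g (E * a))" by (rule sum.cong) (auto simp: D_def)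
    finally show ?thesis using dk by (simp add: cD[simplified] of_nat_diff flip: d_def)
  qed
  \<comment> \<open>At a vertex with \<open>d\<close> coordinates at the upper end, \<open>q\<close>
    is a multiple of the difference in the hypothesis for this \<open>d\<close>. The constant
    vectors, \<open>d = 0\<close> and \<open>d = k\<close>, are not covered there but have zero
    variance.\<close>
  have "q z = a\<^sup>2 * (real d * (real k - real d) * (E - 1)\<^sup>2 - c * (real d * E + real k - real d)\<^sup>2)"
    unfolding q_def sum_z[of "\<lambda>x. x"] sum_z[of "\<lambda>x. x\<^sup>2"] by (simp add: power2_eq_square algebra_simps)
  also have "\<dots> \<le> 0"
  proof (cases "d \<in> {1..k-1}")
    case True
    then show ?thesis using c[OF True] by (intro mult_nonneg_nonpos) auto
  next
    case False
    then have "d = 0 \<or> d = k" using dk by auto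
    then show ?thesis using c0 by (intro mult_nonneg_nonpos) auto
  qed
  finally show ?thesis using z(2) by (simp add: q_def)
qed

section \<open>Output mixtures and densities of private mechanisms\<close>

lemma emeasure_mix:
  assumes mech: "mechanism k M Q" and S: "S \<in> sets M"
  shows "emeasure (mix k M Q p) S = (\<Sum>i=1..k. ennreal (p i) * emeasure (Q i) S)"
  unfolding mix_def
proof (rule emeasure_measure_of_sigma)
  show "sigma_algebra (space M) (sets M)" by (rule sets.sigma_algebra_axioms)
  show "positive (sets M) (\<lambda>S. \<Sum>i=1..k. ennreal (p i) * emeasure (Q i) S)" by (simp add: positive_def)
  show "countably_additive (sets M) (\<lambda>S. \<Sum>i=1..k. ennreal (p i) * emeasure (Q i) S)"
  proof (rule countably_additiveI)
    fix A :: "nat \<Rightarrow> 'a set" assume A: "range A \<subseteq> sets M" "disjoint_family A" "(\<Union>i. A i) \<in> sets M"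
    have "(\<Sum>n. \<Sum>i=1..k. ennreal (p i) * emeasure (Q i) (A n)) = (\<Sum>i=1..k. \<Sum>n. ennreal (p i) * emeasure (Q i) (A n))"
      by (rule suminf_sum) auto
    also have "\<dots> = (\<Sum>i=1..k. ennreal (p i) * emeasure (Q i) (\<Union>i. A i))"
    proof (rule sum.cong)
      fix i assume "i \<in> {1..k}"
      then have "range A \<subseteq> sets (Q i)" using A(1) mech by (simp add: mechanism_def)
      then show "(\<Sum>n. ennreal (p i) * emeasure (Q i) (A n)) = ennreal (p i) * emeasure (Q i) (\<Union>i. A i)"
        using A(2) by (simp add: suminf_emeasure)
    qed simp
    finally show "(\<Sum>n. \<Sum>i=1..k. ennreal (p i) * emeasure (Q i) (A n)) = (\<Sum>i=1..k. ennreal (p i) * emeasure (Q i) (\<Union>i. A i))" .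
  qed
qed (rule S)

lemma sets_mix [simp, measurable_cong]: "sets (mix k M Q p) = sets M"
  by (simp add: mix_def)

lemma space_mix [simp]: "space (mix k M Q p) = space M"
  by (simp add: mix_def space_measure_of_conv)

lemma prob_space_mix:
  assumes mech: "mechanism k M Q" and p: "\<And>i. i \<in> {1..k} \<Longrightarrow> 0 \<le> p i" "(\<Sum>i=1..k. p i) = 1"
  shows "prob_space (mix k M Q p)"
proof
  have "emeasure (Q i) (space M) = 1" if "i \<in> {1..k}" for i
    using that mech prob_space.emeasure_space_1[of "Q i"] sets_eq_imp_space_eq[of "Q i" M] by (simp add: mechanism_def)
  then have "emeasure (mix k M Q p) (space M) = (\<Sum>i=1..k. ennreal (p i))"
    by (simp add: emeasure_mix[OF mech])
  also have "\<dots> = 1" using p by (subst sum_ennreal) auto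
  finally show "emeasure (mix k M Q p) (space (mix k M Q p)) = 1" by simp
qed

text \<open>The test set is the one where \<open>g < f\<close>; finiteness of the integral of
  \<open>g\<close> permits subtraction on it.\<close>

lemma AE_le_of_set_integrals_le:
  assumes [measurable]: "f \<in> borel_measurable m" "g \<in> borel_measurable m"
    and fin: "(\<integral>\<^sup>+y. g y \<partial>m) \<noteq> \<infinity>"
    and le: "\<And>S. S \<in> sets m \<Longrightarrow> (\<integral>\<^sup>+y. f y * indicator S y \<partial>m) \<le> (\<integral>\<^sup>+y. g y * indicator S y \<partial>m)"
  shows "AE y in m. f y \<le> g y"
proof -
  define S where "S = {y \<in> space m. g y < f y}"
  have [measurable]: "S \<in> sets m" unfolding S_def by measurable
  have "(\<integral>\<^sup>+y. g y * indicator S y \<partial>m) \<le> (\<integral>\<^sup>+y. g y \<partial>m)"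
    by (intro nn_integral_mono) (auto simp: indicator_def)
  then have f: "(\<integral>\<^sup>+y. g y * indicator S y \<partial>m) \<noteq> \<infinity>" using fin by (auto simp: top_unique)
  have "(\<integral>\<^sup>+y. f y * indicator S y - g y * indicator S y \<partial>m) = (\<integral>\<^sup>+y. f y * indicator S y \<partial>m) - (\<integral>\<^sup>+y. g y * indicator S y \<partial>m)"
    by (rule nn_integral_diff) (use f in \<open>auto simp: S_def indicator_def\<close>)
  also have "\<dots> = 0" using le[of S] f by (intro diff_eq_0_ennreal) (auto simp: less_top top_unique)
  finally have "AE y in m. f y * indicator S y - g y * indicator S y = 0"
    by (subst (asm) nn_integral_0_iff_AE) auto
  then show ?thesis
  proof (rule AE_mp, intro AE_I2 impI)
    fix y assume y: "y \<in> space m" and 0: "f y * indicator S y - g y * indicator S y = 0"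
    show "f y \<le> g y"
    proof (rule ccontr)
      assume "\<not> f y \<le> g y"
      then have "y \<in> S" "g y < f y" using y by (auto simp: S_def)
      then show False using 0 by (auto simp: diff_eq_0_iff_ennreal)
    qed
  qed
qed

text \<open>The likelihood ratio bound holds almost everywhere; off the exceptional set the densities are reset to 1.\<close>

lemma ldp_densities:
  fixes M :: "'b measure"
  assumes k: "k \<ge> 1" and mech: "mechanism k M Q" and ldp: "ldp k \<epsilon> M Q" and \<epsilon>: "\<epsilon> \<ge> 0"
  defines "m \<equiv> mix k M Q (\<lambda>i. if i \<in> {1..k} then 1 / real k else 0)"
  obtains f :: "nat \<Rightarrow> 'b \<Rightarrow> real" where
    "prob_space m" "sets m = sets M"
    "\<And>i. f i \<in> borel_measurable M"
    "\<And>i y. i \<in> {1..k} \<Longrightarrow> 0 \<le> f i y"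
    "\<And>y. (\<Sum>i=1..k. f i y) = real k"
    "\<And>i j y. i \<in> {1..k} \<Longrightarrow> j \<in> {1..k} \<Longrightarrow> f i y \<le> exp \<epsilon> * f j y"
    "\<And>i. i \<in> {1..k} \<Longrightarrow> Q i = density m (\<lambda>y. ennreal (f i y))"
proof -
  let ?p = "\<lambda>i. if i \<in> {1..k} then 1 / real k else 0"
  have mechD: "prob_space (Q i)" "sets (Q i) = sets M" if "i \<in> {1..k}" for i
    using mech that by (auto simp: mechanism_def)
  have pm: "prob_space m" unfolding m_def by (rule prob_space_mix[OF mech]) (use k in auto)
  interpret m: prob_space m by (rule pm)
  have sm[measurable_cong]: "sets m = sets M" by (simp add: m_def)
  have em: "emeasure m S = (\<Sum>i=1..k. ennreal (1 / real k) * emeasure (Q i) S)" if "S \<in> sets M" for S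
    unfolding m_def using that by (subst emeasure_mix[OF mech]) auto
  have "\<exists>g \<in> borel_measurable m. density m g = Q i" if i: "i \<in> {1..k}" for i
  proof (rule m.Radon_Nikodym)
    \<comment> \<open>\<open>m\<close> averages the \<open>Q i\<close> with positive weights, so its
      null sets are null for each of them.\<close>
    show "absolutely_continuous m (Q i)" unfolding absolutely_continuous_def
    proof
      fix S assume "S \<in> null_sets m"
      then have S: "S \<in> sets M" "emeasure m S = 0" by (auto simp: sm)
      then have "emeasure (Q i) S = 0" using i k by (subst (asm) em) (auto simp: sum_nonneg_eq_0_iff)
      then show "S \<in> null_sets (Q i)" using S mechD[OF i] by auto
    qed
    show "sets (Q i) = sets m" using mechD[OF i] sm by simp
  qed
  then obtain g where g: "\<And>i. i \<in> {1..k} \<Longrightarrow> g i \<in> borel_measurable m" "\<And>i. i \<in> {1..k} \<Longrightarrow> density m (g i) = Q i"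
    by metis
  have Qi: "emeasure (Q i) S = (\<integral>\<^sup>+y. g i y * indicator S y \<partial>m)" if "i \<in> {1..k}" "S \<in> sets m" for i S
    using g[OF that(1)] that(2) by (simp flip: g(2)[OF that(1)] add: emeasure_density)
  let ?avg = "\<lambda>y. \<Sum>i=1..k. ennreal (1 / real k) * g i y"
  have AE1: "AE y in m. g i y \<le> ennreal (exp \<epsilon>) * g j y" if i: "i \<in> {1..k}" and j: "j \<in> {1..k}" for i j
  proof (rule AE_le_of_set_integrals_le)
    show "g i \<in> borel_measurable m" "(\<lambda>y. ennreal (exp \<epsilon>) * g j y) \<in> borel_measurable m" using g i j by auto
    interpret Qi: prob_space "Q i" by (rule mechD[OF i])
    interpret Qj: prob_space "Q j" by (rule mechD[OF j])
    have "(\<integral>\<^sup>+y. g j y \<partial>m) = emeasure (Q j) (space m)" by (subst Qi[OF j]) (auto intro!: nn_integral_cong)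
    then show "(\<integral>\<^sup>+y. ennreal (exp \<epsilon>) * g j y \<partial>m) \<noteq> \<infinity>"
      using g(1)[OF j] by (simp add: nn_integral_cmult ennreal_mult_eq_top_iff Qj.emeasure_eq_measure)
    fix S assume S: "S \<in> sets m"
    have "measure (Q i) S \<le> exp \<epsilon> * measure (Q j) S" using ldp i j S by (simp add: ldp_def sm)
    then have "emeasure (Q i) S \<le> ennreal (exp \<epsilon>) * emeasure (Q j) S"
      by (simp add: Qi.emeasure_eq_measure Qj.emeasure_eq_measure ennreal_mult'[symmetric] ennreal_leI)
    also have "\<dots> = (\<integral>\<^sup>+y. ennreal (exp \<epsilon>) * g j y * indicator S y \<partial>m)"
      using g(1)[OF j] S unfolding Qi[OF j S] by (subst nn_integral_cmult[symmetric]) (auto simp: mult.assoc)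
    finally show "(\<integral>\<^sup>+y. g i y * indicator S y \<partial>m) \<le> (\<integral>\<^sup>+y. ennreal (exp \<epsilon>) * g j y * indicator S y \<partial>m)"
      by (simp add: Qi[OF i S])
  qed
  \<comment> \<open>The averaged density represents \<open>m\<close> itself, and densities with
    respect to \<open>m\<close> are unique almost everywhere.\<close>
  have AE2: "AE y in m. ?avg y = 1"
  proof -
    have "density m ?avg = m"
    proof (rule measure_eqI)
      fix S assume "S \<in> sets (density m ?avg)"
      then have S: "S \<in> sets m" by simp
      have "emeasure (density m ?avg) S = (\<integral>\<^sup>+y. (\<Sum>i=1..k. ennreal (1 / real k) * (g i y * indicator S y)) \<partial>m)"
        using S g(1) by (subst emeasure_density) (auto simp: sum_distrib_right mult.assoc)
      also have "\<dots> = (\<Sum>i=1..k. ennreal (1 / real k) * (\<integral>\<^sup>+y. g i y * indicator S y \<partial>m))"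
        using S g(1) by (subst nn_integral_sum) (auto simp: nn_integral_cmult)
      also have "\<dots> = emeasure m S" using S by (subst em) (auto simp: sm Qi intro!: sum.cong)
      finally show "emeasure (density m ?avg) S = emeasure m S" .
    qed simp
    then have "density m ?avg = density m (\<lambda>_. 1)" by (simp add: density_1)
    then show ?thesis using g(1) by (subst (asm) m.density_unique_iff) auto
  qed
  define G where "G = {y \<in> space m. ?avg y = 1 \<and> (\<forall>i\<in>{1..k}. \<forall>j\<in>{1..k}. g i y \<le> ennreal (exp \<epsilon>) * g j y)}"
  have G[measurable]: "G \<in> sets m" unfolding G_def using g(1) by measurable
  have AEG: "AE y in m. y \<in> G"
  proof -
    have "AE y in m. \<forall>i\<in>{1..k}. \<forall>j\<in>{1..k}. g i y \<le> ennreal (exp \<epsilon>) * g j y"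
      by (intro AE_finite_allI) (auto intro: AE1)
    then show ?thesis using AE2 AE_space by eventually_elim (simp add: G_def)
  qed
  have fin: "g i y < \<top>" if "y \<in> G" "i \<in> {1..k}" for i y
  proof -
    have "ennreal (1 / real k) * g i y \<le> ?avg y"
      using that(2) by (intro member_le_sum) auto
    also have "\<dots> = 1" using that by (simp add: G_def)
    finally show ?thesis using k by (auto simp: less_top[symmetric] ennreal_mult_top top_unique)
  qed
  \<comment> \<open>The value 1 satisfies the pointwise requirements: the densities add up to
    \<open>k\<close>, and the ratio bound holds since \<open>\<epsilon> \<ge> 0\<close>. On
    \<open>G\<close> the densities are finite, so \<open>enn2real\<close> loses nothing.\<close>
  define f where "f i y = (if i \<in> {1..k} \<and> y \<in> G then enn2real (g i y) else 1)" for i y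
  show thesis
  proof (rule that)
    show "f i \<in> borel_measurable M" for i
    proof (cases "i \<in> {1..k}")
      case True
      then have [measurable]: "g i \<in> borel_measurable M" using g(1) sm by (simp cong: measurable_cong_sets)
      have [measurable]: "G \<in> sets M" using G sm by simp
      have "(\<lambda>y. if y \<in> G then enn2real (g i y) else 1) \<in> borel_measurable M" by measurable
      then show ?thesis using True by (simp add: f_def[abs_def])
    next
      case False
      then have "f i = (\<lambda>_. 1)" by (auto simp: f_def)
      then show ?thesis by simp
    qed
    show "0 \<le> f i y" for i y by (simp add: f_def)
    show "(\<Sum>i=1..k. f i y) = real k" for y
    proof (cases "y \<in> G")
      case True
      have "ennreal ((1 / real k) * (\<Sum>i=1..k. enn2real (g i y))) = ennreal (1 / real k) * (\<Sum>i=1..k. ennreal (enn2real (g i y)))"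
        by (subst ennreal_mult') auto
      also have "(\<Sum>i=1..k. ennreal (enn2real (g i y))) = (\<Sum>i=1..k. g i y)"
        using fin[OF True] by (intro sum.cong) auto
      also have "ennreal (1 / real k) * (\<Sum>i=1..k. g i y) = 1" using True by (simp add: G_def sum_distrib_left)
      finally have "(1 / real k) * (\<Sum>i=1..k. enn2real (g i y)) = 1" by simp
      then show ?thesis using True k by (simp add: f_def field_simps)
    qed (use k in \<open>simp add: f_def\<close>)
    show "f i y \<le> exp \<epsilon> * f j y" if "i \<in> {1..k}" "j \<in> {1..k}" for i j y
    proof (cases "y \<in> G")
      case True
      have "g i y \<le> ennreal (exp \<epsilon>) * g j y" using True that by (simp add: G_def)
      then have "enn2real (g i y) \<le> enn2real (ennreal (exp \<epsilon>) * g j y)"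
        using fin[OF True that(2)] by (intro enn2real_mono) (auto simp: ennreal_mult_less_top)
      then show ?thesis using True that by (simp add: f_def enn2real_mult)
    qed (use \<epsilon> that in \<open>simp add: f_def\<close>)
    show "Q i = density m (\<lambda>y. ennreal (f i y))" if i: "i \<in> {1..k}" for i
      unfolding g(2)[OF i, symmetric]
    proof (rule density_cong)
      show "AE y in m. g i y = ennreal (f i y)"
        using AEG by eventually_elim (use fin i in \<open>simp add: f_def\<close>)
      show "(\<lambda>y. ennreal (f i y)) \<in> borel_measurable m"
      proof -
        have [measurable]: "g i \<in> borel_measurable m" using g(1) i by simp
        have "(\<lambda>y. ennreal (if y \<in> G then enn2real (g i y) else 1)) \<in> borel_measurable m" by measurable
        then show ?thesis using i by (simp add: f_def[abs_def])
      qed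
    qed (use g i in auto)
  qed (use pm sm in auto)
qed

section \<open>The local minimax lower bound\<close>

lemma PiM_density_iid:
  fixes h :: "'b \<Rightarrow> ennreal"
  assumes m: "prob_space m" and [measurable]: "h \<in> borel_measurable m" and mh: "prob_space (density m h)"
  shows "iid n (density m h) = density (iid n m) (\<lambda>y. \<Prod>j<n. h (y j))"
proof -
  interpret m: product_prob_space "\<lambda>_::nat. m" using m by (simp add: product_prob_spaceI)
  interpret h: product_prob_space "\<lambda>_::nat. density m h" using mh by (simp add: product_prob_spaceI)
  show ?thesis
  proof (rule h.PiM_eqI[symmetric])
    show "sets (density (iid n m) (\<lambda>y. \<Prod>j<n. h (y j))) = sets (iid n (density m h))"
      by (simp cong: sets_PiM_cong)
    fix A :: "nat \<Rightarrow> 'b set" assume "\<And>j. j \<in> {..<n} \<Longrightarrow> A j \<in> sets (density m h)"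
    then have A: "\<And>j. j \<in> {..<n} \<Longrightarrow> A j \<in> sets m" by simp
    have "emeasure (density (iid n m) (\<lambda>y. \<Prod>j<n. h (y j))) (Pi\<^sub>E {..<n} A)
      = (\<integral>\<^sup>+y. (\<Prod>j<n. h (y j)) * indicator (Pi\<^sub>E {..<n} A) y \<partial>iid n m)"
      using A by (subst emeasure_density) (auto intro!: sets_PiM_I_finite)
    also have "\<dots> = (\<integral>\<^sup>+y. (\<Prod>j<n. h (y j) * indicator (A j) (y j)) \<partial>iid n m)"
    proof (rule nn_integral_cong)
      fix y assume y: "y \<in> space (iid n m)"
      have "indicator (Pi\<^sub>E {..<n} A) y = (\<Prod>j<n. indicator (A j) (y j) :: ennreal)"
      proof (cases "y \<in> Pi\<^sub>E {..<n} A")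
        case True
        then show ?thesis by (auto simp: PiE_iff)
      next
        case False
        then obtain j where "j < n" "y j \<notin> A j" using y by (auto simp: PiE_iff space_PiM)
        then have "(\<Prod>j<n. indicator (A j) (y j) :: ennreal) = 0" by (intro prod_zero bexI[of _ j]) auto
        then show ?thesis using False by simp
      qed
      then show "(\<Prod>j<n. h (y j)) * indicator (Pi\<^sub>E {..<n} A) y = (\<Prod>j<n. h (y j) * indicator (A j) (y j))"
        by (simp add: prod.distrib)
    qed
    also have "\<dots> = (\<Prod>j<n. \<integral>\<^sup>+y. h y * indicator (A j) y \<partial>m)"
      using A by (intro m.product_nn_integral_prod) auto
    also have "\<dots> = (\<Prod>j\<in>{..<n}. emeasure (density m h) (A j))"
      using A by (intro prod.cong) (auto simp: emeasure_density)
    finally show "emeasure (density (iid n m) (\<lambda>y. \<Prod>j<n. h (y j))) (Pi\<^sub>E {..<n} A) = (\<Prod>j\<in>{..<n}. emeasure (density m h) (A j))" .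
  qed simp
qed

text \<open>\<open>m\<close> is the output law under uniform inputs. The identities are required at
  every point, which keeps exceptional sets out of the local analysis; privacy enters through the
  hypothesis of \<open>sum_info_le\<close>.\<close>

locale mechanism_densities =
  fixes k :: nat and M :: "'b measure" and Q :: "nat \<Rightarrow> 'b measure" and m :: "'b measure" and f :: "nat \<Rightarrow> 'b \<Rightarrow> real"
  assumes k2: "k \<ge> 2" and mech: "mechanism k M Q" and pm: "prob_space m" and sm: "sets m = sets M"
    and f_meas: "\<And>i. f i \<in> borel_measurable m"
    and f_nonneg: "\<And>i y. i \<in> {1..k} \<Longrightarrow> 0 \<le> f i y"
    and f_sum: "\<And>y. (\<Sum>i=1..k. f i y) = real k"
    and Q_dens: "\<And>i. i \<in> {1..k} \<Longrightarrow> Q i = density m (\<lambda>y. ennreal (f i y))"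
begin

sublocale m: prob_space m by (rule pm)

lemmas f_meas' [measurable] = f_meas

text \<open>Score at the uniform distribution in the direction that raises \<open>p i\<close> and
  lowers all coordinates equally to restore the total: the derivative of the mixture density is
  \<open>f i\<close> minus the average of the densities, which is 1.\<close>

definition dev :: "nat \<Rightarrow> 'b \<Rightarrow> real" where "dev i y = f i y - 1"

lemma dev_measurable [measurable]: "dev i \<in> borel_measurable m"
  unfolding dev_def by measurable

lemma f_le: "i \<in> {1..k} \<Longrightarrow> f i y \<le> real k"
  using member_le_sum[of i "{1..k}" "\<lambda>i. f i y"] f_nonneg f_sum[of y] by auto

lemma dev_bound: "i \<in> {1..k} \<Longrightarrow> \<bar>dev i y\<bar> \<le> real k"
  using f_le[of i y] f_nonneg[of i y] k2 by (auto simp: dev_def abs_le_iff)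

lemma sum_dev: "(\<Sum>i=1..k. dev i y) = 0"
  using f_sum[of y] by (simp add: dev_def sum_subtractf)

lemma integral_dev:
  assumes i: "i \<in> {1..k}"
  shows "integrable m (dev i)" "(\<integral>y. dev i y \<partial>m) = 0"
proof -
  interpret Qi: prob_space "Q i" using mech i by (simp add: mechanism_def)
  have fi: "integrable m (f i)"
    by (rule m.integrable_const_bound[where B="real k"]) (use f_le[OF i] f_nonneg[OF i] in auto)
  have "ennreal (\<integral>y. f i y \<partial>m) = (\<integral>\<^sup>+y. ennreal (f i y) \<partial>m)"
    by (rule nn_integral_eq_integral[symmetric, OF fi]) (use f_nonneg[OF i] in auto)
  also have "\<dots> = emeasure (Q i) (space m)" unfolding Q_dens[OF i] by (subst emeasure_density) (auto intro!: nn_integral_cong)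
  also have "\<dots> = 1" using Qi.emeasure_space_1 Q_dens[OF i] by simp
  finally have "(\<integral>y. f i y \<partial>m) = 1" by simp
  then show "integrable m (dev i)" "(\<integral>y. dev i y \<partial>m) = 0"
    unfolding dev_def using fi by (auto simp: m.prob_space)
qed

text \<open>Fisher information at the uniform distribution in the direction of
  \<open>dev i\<close>.\<close>

definition info :: "nat \<Rightarrow> real" where "info i = (\<integral>y. (dev i y)\<^sup>2 \<partial>m)"

lemma dev_sq_bound: "i \<in> {1..k} \<Longrightarrow> (dev i y)\<^sup>2 \<le> (real k)\<^sup>2"
  using dev_bound[of i y] by (simp add: abs_le_square_iff[symmetric])

lemma integrable_dev_sq: "i \<in> {1..k} \<Longrightarrow> integrable m (\<lambda>y. (dev i y)\<^sup>2)"
  by (rule m.integrable_const_bound[where B="(real k)\<^sup>2"]) (use dev_sq_bound in auto)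

lemma info_bounds: "i \<in> {1..k} \<Longrightarrow> 0 \<le> info i \<and> info i \<le> (real k)\<^sup>2"
  using integral_mono[OF integrable_dev_sq[of i], of "\<lambda>_. (real k)\<^sup>2"] dev_sq_bound
  by (auto simp: info_def m.prob_space)

text \<open>As the densities add up to \<open>k\<close> at every point, the sum of the squared
  deviations is the sum of the squared densities minus \<open>k\<close>. The bound therefore holds
  pointwise and is then averaged.\<close>

lemma sum_info_le:
  assumes "\<And>y. real k * (\<Sum>i=1..k. (f i y)\<^sup>2) \<le> (1 + c) * (\<Sum>i=1..k. f i y)\<^sup>2"
  shows "(\<Sum>i=1..k. info i) \<le> c * real k"
proof -
  have pt: "(\<Sum>i=1..k. (dev i y)\<^sup>2) \<le> c * real k" for y
  proof -
    have "real k * (\<Sum>i=1..k. (f i y)\<^sup>2) \<le> real k * ((1 + c) * real k)"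
      using assms[of y] unfolding f_sum by (simp add: power2_eq_square mult_ac)
    then have "(\<Sum>i=1..k. (f i y)\<^sup>2) \<le> (1 + c) * real k" using k2 by (simp add: mult_le_cancel_left)
    moreover have "(\<Sum>i=1..k. (dev i y)\<^sup>2) = (\<Sum>i=1..k. (f i y)\<^sup>2) - 2 * (\<Sum>i=1..k. f i y) + real k"
      by (simp add: dev_def power2_diff sum.distrib sum_subtractf sum_distrib_left)
    ultimately show ?thesis unfolding f_sum by (simp add: algebra_simps)
  qed
  have "(\<Sum>i=1..k. info i) = (\<integral>y. (\<Sum>i=1..k. (dev i y)\<^sup>2) \<partial>m)"
    unfolding info_def by (rule Bochner_Integration.integral_sum[symmetric]) (rule integrable_dev_sq)
  also have "\<dots> \<le> (\<integral>y. c * real k \<partial>m)"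
    by (rule integral_mono) (use pt in \<open>auto intro!: Bochner_Integration.integrable_sum integrable_dev_sq\<close>)
  finally show ?thesis by (simp add: m.prob_space)
qed

lemma mix_density:
  assumes p: "\<And>i. i \<in> {1..k} \<Longrightarrow> 0 \<le> p i"
  shows "mix k M Q p = density m (\<lambda>y. ennreal (\<Sum>i=1..k. p i * f i y))"
proof (rule measure_eqI)
  show "sets (mix k M Q p) = sets (density m (\<lambda>y. ennreal (\<Sum>i=1..k. p i * f i y)))" by (simp add: sm)
  fix S assume "S \<in> sets (mix k M Q p)"
  then have S: "S \<in> sets M" and [measurable]: "S \<in> sets m" by (auto simp: sm)
  have "emeasure (mix k M Q p) S = (\<Sum>i=1..k. ennreal (p i) * (\<integral>\<^sup>+y. ennreal (f i y) * indicator S y \<partial>m))"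
    unfolding emeasure_mix[OF mech S] by (intro sum.cong) (auto simp: Q_dens emeasure_density)
  also have "\<dots> = (\<integral>\<^sup>+y. (\<Sum>i=1..k. ennreal (p i) * (ennreal (f i y) * indicator S y)) \<partial>m)"
    by (subst nn_integral_sum) (auto simp: nn_integral_cmult)
  also have "\<dots> = (\<integral>\<^sup>+y. ennreal (\<Sum>i=1..k. p i * f i y) * indicator S y \<partial>m)"
  proof (rule nn_integral_cong)
    fix y
    have "ennreal (\<Sum>i=1..k. p i * f i y) = (\<Sum>i=1..k. ennreal (p i * f i y))"
      by (rule sum_ennreal[symmetric]) (use p f_nonneg in auto)
    also have "\<dots> = (\<Sum>i=1..k. ennreal (p i) * ennreal (f i y))"
      by (intro sum.cong refl ennreal_mult') (use p in auto)
    finally show "(\<Sum>i=1..k. ennreal (p i) * (ennreal (f i y) * indicator S y)) = ennreal (\<Sum>i=1..k. p i * f i y) * indicator S y"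
      by (simp add: sum_distrib_right mult.assoc)
  qed
  also have "\<dots> = emeasure (density m (\<lambda>y. ennreal (\<Sum>i=1..k. p i * f i y))) S"
    by (rule emeasure_density[symmetric]) auto
  finally show "emeasure (mix k M Q p) S = emeasure (density m (\<lambda>y. ennreal (\<Sum>i=1..k. p i * f i y))) S" .
qed

text \<open>The least favourable prior: \<open>local_param\<close> moves around the uniform distribution at scale \<open>1 / sqrt n\<close>, and
  \<open>local_dens\<close> is the density with respect to \<open>m\<close> of the resulting output distribution. Changing a single
  coordinate of \<open>\<tau>\<close> moves the parameter along the least favourable direction for that coordinate.\<close>

definition local_param :: "(nat \<Rightarrow> real) \<Rightarrow> nat \<Rightarrow> (nat \<Rightarrow> real) \<Rightarrow> nat \<Rightarrow> real" where
  "local_param s n \<tau> i = (if i \<in> {1..k} then 1 / real k + (s i * \<tau> i - (\<Sum>l=1..k. s l * \<tau> l) / real k) / sqrt (real n) else 0)"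

definition local_dens :: "(nat \<Rightarrow> real) \<Rightarrow> nat \<Rightarrow> (nat \<Rightarrow> real) \<Rightarrow> 'b \<Rightarrow> real" where
  "local_dens s n \<tau> y = 1 + (\<Sum>i=1..k. s i * \<tau> i * dev i y) / sqrt (real n)"

lemma sum_local_param: "(\<Sum>i=1..k. local_param s n \<tau> i) = 1"
proof -
  have "(\<Sum>i=1..k. local_param s n \<tau> i) = (\<Sum>i=1..k. 1 / real k + (s i * \<tau> i - (\<Sum>l=1..k. s l * \<tau> l) / real k) / sqrt (real n))"
    by (intro sum.cong) (auto simp: local_param_def)
  also have "\<dots> = 1 + ((\<Sum>i=1..k. s i * \<tau> i) - real k * ((\<Sum>l=1..k. s l * \<tau> l) / real k)) / sqrt (real n)"
    using k2 by (simp add: sum.distrib sum_subtractf flip: sum_divide_distrib)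
  also have "\<dots> = 1" using k2 by simp
  finally show ?thesis .
qed

text \<open>The centring term of \<open>local_param\<close> multiplies the sum of all
  \<open>dev i\<close>, which is zero; this is why \<open>local_dens\<close> contains no such
  term.\<close>

lemma sum_local_param_f: "(\<Sum>i=1..k. local_param s n \<tau> i * f i y) = local_dens s n \<tau> y"
proof -
  have "(\<Sum>i=1..k. local_param s n \<tau> i * f i y) = (\<Sum>i=1..k. local_param s n \<tau> i) + (\<Sum>i=1..k. local_param s n \<tau> i * dev i y)"
    unfolding sum.distrib[symmetric] by (intro sum.cong) (auto simp: dev_def algebra_simps)
  also have "(\<Sum>i=1..k. local_param s n \<tau> i * dev i y) = (\<Sum>i=1..k. (1 / real k - (\<Sum>l=1..k. s l * \<tau> l) / real k / sqrt (real n)) * dev i y + s i * \<tau> i * dev i y / sqrt (real n))"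
    by (intro sum.cong) (auto simp: local_param_def diff_divide_distrib algebra_simps)
  also have "\<dots> = (1 / real k - (\<Sum>l=1..k. s l * \<tau> l) / real k / sqrt (real n)) * (\<Sum>i=1..k. dev i y) + (\<Sum>i=1..k. s i * \<tau> i * dev i y) / sqrt (real n)"
    by (simp only: sum.distrib sum_distrib_left sum_divide_distrib)
  finally show ?thesis unfolding sum_local_param sum_dev local_dens_def by simp
qed

lemma local_dens_ge:
  assumes s: "\<And>i. i \<in> {1..k} \<Longrightarrow> s i \<ge> 0" and \<tau>: "\<And>i. i \<in> {1..k} \<Longrightarrow> \<bar>\<tau> i\<bar> \<le> T"
  shows "local_dens s n \<tau> y \<ge> 1 - (\<Sum>i=1..k. s i) * T * real k / sqrt (real n)"
proof -
  have "\<bar>\<Sum>i=1..k. s i * \<tau> i * dev i y\<bar> \<le> (\<Sum>i=1..k. s i * T * real k)"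
  proof (rule order_trans[OF sum_abs sum_mono])
    fix i assume i: "i \<in> {1..k}"
    show "\<bar>s i * \<tau> i * dev i y\<bar> \<le> s i * T * real k"
      unfolding abs_mult using s[OF i] \<tau>[OF i] dev_bound[OF i, of y] by (intro mult_mono) (auto intro: order_trans[OF abs_ge_zero])
  qed
  also have "\<dots> = (\<Sum>i=1..k. s i) * T * real k" by (simp add: sum_distrib_right)
  finally have "\<bar>\<Sum>i=1..k. s i * \<tau> i * dev i y\<bar> / sqrt (real n) \<le> (\<Sum>i=1..k. s i) * T * real k / sqrt (real n)"
    by (rule divide_right_mono) simp
  then show ?thesis unfolding local_dens_def
    by (smt (verit, ccfv_SIG) abs_ge_minus_self divide_minus_left divide_right_mono real_sqrt_ge_zero of_nat_0_le_iff)
qed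

lemma local_param_nonneg:
  assumes s: "\<And>i. i \<in> {1..k} \<Longrightarrow> s i \<ge> 0" and \<tau>: "\<And>i. i \<in> {1..k} \<Longrightarrow> \<bar>\<tau> i\<bar> \<le> T"
    and n: "(\<Sum>i=1..k. s i) * T * 2 * real k / sqrt (real n) \<le> 1" and i: "i \<in> {1..k}"
  shows "local_param s n \<tau> i \<ge> 0"
proof -
  define S where "S = (\<Sum>i=1..k. s i)"
  have T: "T \<ge> 0" using \<tau>[OF i] by linarith
  have "\<bar>s i * \<tau> i\<bar> \<le> s i * T" unfolding abs_mult using s[OF i] \<tau>[OF i] by (intro mult_mono) auto
  also have "s i * T \<le> S * T" unfolding S_def using T i s by (intro mult_right_mono member_le_sum) auto
  finally have 1: "\<bar>s i * \<tau> i\<bar> \<le> S * T" .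
  have "\<bar>\<Sum>l=1..k. s l * \<tau> l\<bar> \<le> (\<Sum>l=1..k. s l * T)"
    by (rule order_trans[OF sum_abs sum_mono]) (auto simp: abs_mult intro!: mult_mono \<tau> s)
  then have 2: "\<bar>\<Sum>l=1..k. s l * \<tau> l\<bar> \<le> S * T" by (simp add: S_def sum_distrib_right)
  have "\<bar>(\<Sum>l=1..k. s l * \<tau> l) / real k\<bar> \<le> S * T"
  proof -
    have "\<bar>(\<Sum>l=1..k. s l * \<tau> l) / real k\<bar> \<le> \<bar>\<Sum>l=1..k. s l * \<tau> l\<bar>"
      using k2 by (simp add: divide_le_eq mult_le_cancel_left1)
    then show ?thesis using 2 by simp
  qed
  \<comment> \<open>The own term and the subtracted mean are each at most \<open>S * T\<close>,
    whence the factor 2 in the hypothesis on \<open>n\<close>.\<close>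
  then have "\<bar>s i * \<tau> i - (\<Sum>l=1..k. s l * \<tau> l) / real k\<bar> \<le> 2 * (S * T)" using 1 by linarith
  then have "\<bar>s i * \<tau> i - (\<Sum>l=1..k. s l * \<tau> l) / real k\<bar> / sqrt (real n) \<le> 2 * (S * T) / sqrt (real n)"
    by (rule divide_right_mono) simp
  also have "\<dots> \<le> 1 / real k" using n k2 by (simp add: S_def field_simps)
  finally have "\<bar>(s i * \<tau> i - (\<Sum>l=1..k. s l * \<tau> l) / real k) / sqrt (real n)\<bar> \<le> 1 / real k"
    by (simp only: abs_divide) simp
  then show ?thesis using i unfolding local_param_def by (simp only: if_True)
qed

lemma local_dens_measurable [measurable]: "local_dens s n \<tau> \<in> borel_measurable m"
  unfolding local_dens_def by measurable

lemma mix_local_param: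
  assumes "\<And>i. i \<in> {1..k} \<Longrightarrow> local_param s n \<tau> i \<ge> 0"
  shows "mix k M Q (local_param s n \<tau>) = density m (\<lambda>y. ennreal (local_dens s n \<tau> y))"
    and "prob_space (mix k M Q (local_param s n \<tau>))"
proof -
  show "mix k M Q (local_param s n \<tau>) = density m (\<lambda>y. ennreal (local_dens s n \<tau> y))"
    using mix_density[of "local_param s n \<tau>", OF assms] by (simp only: sum_local_param_f)
  show "prob_space (mix k M Q (local_param s n \<tau>))"
    by (rule prob_space_mix[OF mech assms sum_local_param])
qed

text \<open>A change in coordinate \<open>i\<close> also moves the subtracted mean by one
  \<open>k\<close>-th of it. What is left is the factor \<open>(k - 1) / k\<close> of the final
  constant.\<close>

lemma local_param_update:
  assumes i: "i \<in> {1..k}"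
  shows "local_param s n (w(i := t)) i = local_param s n (w(i := 0)) i + (real k - 1) / real k * s i / sqrt (real n) * t"
proof -
  have sm: "(\<Sum>l=1..k. s l * (w(i := t)) l) = s i * t + (\<Sum>l\<in>{1..k}-{i}. s l * w l)" for t
    by (subst sum.remove[OF _ i]) (auto intro!: sum.cong)
  define R where "R = (\<Sum>l\<in>{1..k}-{i}. s l * w l)"
  have "s i * t - (s i * t + R) / real k = (s i * 0 - (s i * 0 + R) / real k) + (real k - 1) / real k * (s i * t)"
    using k2 by (simp add: field_simps)
  then have "(s i * t - (s i * t + R) / real k) / sqrt (real n) = (s i * 0 - (s i * 0 + R) / real k) / sqrt (real n) + (real k - 1) / real k * (s i * t) / sqrt (real n)"
    by (simp only: add_divide_distrib)
  then show ?thesis unfolding local_param_def sm R_def[symmetric] using i by simp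
qed

lemma local_dens_update:
  assumes i: "i \<in> {1..k}"
  shows "local_dens s n (w(i := t)) y = local_dens s n (w(i := 0)) y + t * s i * dev i y / sqrt (real n)"
proof -
  have sm: "(\<Sum>l=1..k. s l * (w(i := t)) l * dev l y) = s i * t * dev i y + (\<Sum>l\<in>{1..k}-{i}. s l * w l * dev l y)" for t
    by (subst sum.remove[OF _ i]) (auto intro!: sum.cong)
  show ?thesis unfolding local_dens_def sm by (simp add: add_divide_distrib mult_ac)
qed

section \<open>Reduction to one-parameter experiments\<close>

text \<open>Written against the fixed measure \<open>iid n m\<close>, so that it is visibly
  measurable in \<open>\<tau>\<close> and can be averaged over the prior.\<close>

definition coord_risk :: "real \<Rightarrow> (nat \<Rightarrow> real) \<Rightarrow> nat \<Rightarrow> ((nat \<Rightarrow> 'b) \<Rightarrow> nat \<Rightarrow> real) \<Rightarrow> nat \<Rightarrow> (nat \<Rightarrow> real) \<Rightarrow> ennreal" where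
  "coord_risk u s n e i \<tau> = (\<integral>\<^sup>+y. ennreal ((\<Prod>j<n. local_dens s n \<tau> (y j)) * \<bar>e y i - local_param s n \<tau> i\<bar> powr u) \<partial>iid n m)"

lemma nn_integral_mix_local_param:
  assumes p: "\<And>i. i \<in> {1..k} \<Longrightarrow> local_param s n \<tau> i \<ge> 0"
    and [measurable]: "h \<in> borel_measurable (iid n m)"
    and pos: "\<And>y. local_dens s n \<tau> y \<ge> 0"
  shows "(\<integral>\<^sup>+y. ennreal (h y) \<partial>iid n (mix k M Q (local_param s n \<tau>)))
    = (\<integral>\<^sup>+y. ennreal ((\<Prod>j<n. local_dens s n \<tau> (y j)) * h y) \<partial>iid n m)"
proof -
  have mixD: "mix k M Q (local_param s n \<tau>) = density m (\<lambda>y. ennreal (local_dens s n \<tau> y))"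
    by (rule mix_local_param(1)) (rule p)
  have pr: "prob_space (density m (\<lambda>y. ennreal (local_dens s n \<tau> y)))"
  proof -
    have "prob_space (mix k M Q (local_param s n \<tau>))" by (rule mix_local_param(2)) (rule p)
    then show ?thesis unfolding mixD .
  qed
  have "iid n (mix k M Q (local_param s n \<tau>)) = density (iid n m) (\<lambda>y. \<Prod>j<n. ennreal (local_dens s n \<tau> (y j)))"
    unfolding mixD by (rule PiM_density_iid[OF pm _ pr]) measurable
  then have "(\<integral>\<^sup>+y. ennreal (h y) \<partial>iid n (mix k M Q (local_param s n \<tau>))) = (\<integral>\<^sup>+y. (\<Prod>j<n. ennreal (local_dens s n \<tau> (y j))) * ennreal (h y) \<partial>iid n m)"
    by (simp add: nn_integral_density)
  also have "\<dots> = (\<integral>\<^sup>+y. ennreal ((\<Prod>j<n. local_dens s n \<tau> (y j)) * h y) \<partial>iid n m)"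
    by (intro nn_integral_cong) (simp add: prod_ennreal pos ennreal_mult' prod_nonneg)
  finally show ?thesis .
qed

text \<open>The density at \<open>w(i := t)\<close> is the density \<open>D\<close> at
  \<open>w(i := 0)\<close> times \<open>1 + t * \<phi> / sqrt n\<close> with
  \<open>\<phi> = s i * dev i / D\<close>. The first factor is absorbed into the base law, the
  second is the likelihood; recentring and rescaling the estimator by \<open>r\<close> then produces
  a \<open>tilted_risk\<close>.\<close>

lemma coord_risk_update:
  assumes i: "i \<in> {1..k}" and si: "s i > 0" and n: "n > 0"
    and p: "\<And>l. l \<in> {1..k} \<Longrightarrow> local_param s n (w(i := 0)) l \<ge> 0"
    and pos: "\<And>y. local_dens s n (w(i := 0)) y > 0"
    and em: "(\<lambda>y. e y i) \<in> borel_measurable (iid n m)"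
  defines "r \<equiv> (real k - 1) / real k * s i / sqrt (real n)"
  shows "coord_risk u s n e i (w(i := t)) = ennreal (r powr u) *
    (\<integral>\<^sup>+y. ennreal (lik n (\<lambda>y. t * (s i * dev i y / local_dens s n (w(i := 0)) y)) y * \<bar>(e y i - local_param s n (w(i := 0)) i) / r - t\<bar> powr u)
      \<partial>iid n (mix k M Q (local_param s n (w(i := 0)))))"
proof -
  note [measurable] = em
  define D where "D = local_dens s n (w(i := 0))"
  define A where "A = local_param s n (w(i := 0)) i"
  define \<phi> where "\<phi> y = s i * dev i y / D y" for y
  have [measurable]: "D \<in> borel_measurable m" unfolding D_def by measurable
  have [measurable]: "\<phi> \<in> borel_measurable m" unfolding \<phi>_def by measurable
  have r: "r > 0" unfolding r_def using k2 si n by simp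
  have D: "D y > 0" for y using pos by (simp add: D_def)
  have dens: "local_dens s n (w(i := t)) y = D y * (1 + t * \<phi> y / sqrt (real n))" for y
    using D[of y] local_dens_update[OF i, of s n w t y] by (simp add: \<phi>_def field_simps flip: D_def)
  have par: "local_param s n (w(i := t)) i = A + r * t"
    using local_param_update[OF i, of s n w t] by (simp add: A_def r_def)
  have "\<bar>e y i - (A + r * t)\<bar> powr u = r powr u * \<bar>(e y i - A) / r - t\<bar> powr u" for y
  proof -
    have "e y i - (A + r * t) = r * ((e y i - A) / r - t)" using r by (simp add: field_simps)
    then show ?thesis using r by (simp add: abs_mult powr_mult)
  qed
  then have "coord_risk u s n e i (w(i := t)) = (\<integral>\<^sup>+y. ennreal (r powr u) * ennreal ((\<Prod>j<n. D (y j)) * (lik n (\<lambda>y. t * \<phi> y) y * \<bar>(e y i - A) / r - t\<bar> powr u)) \<partial>iid n m)"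
    unfolding coord_risk_def par dens by (intro nn_integral_cong) (simp add: ennreal_mult'[symmetric] lik_def prod.distrib mult_ac)
  also have "\<dots> = ennreal (r powr u) * (\<integral>\<^sup>+y. ennreal ((\<Prod>j<n. D (y j)) * (lik n (\<lambda>y. t * \<phi> y) y * \<bar>(e y i - A) / r - t\<bar> powr u)) \<partial>iid n m)"
    by (rule nn_integral_cmult) measurable
  also have "(\<integral>\<^sup>+y. ennreal ((\<Prod>j<n. D (y j)) * (lik n (\<lambda>y. t * \<phi> y) y * \<bar>(e y i - A) / r - t\<bar> powr u)) \<partial>iid n m)
    = (\<integral>\<^sup>+y. ennreal (lik n (\<lambda>y. t * \<phi> y) y * \<bar>(e y i - A) / r - t\<bar> powr u) \<partial>iid n (mix k M Q (local_param s n (w(i := 0)))))"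
    unfolding D_def by (rule nn_integral_mix_local_param[symmetric, OF p]) (use pos less_imp_le in auto)
  finally show ?thesis unfolding \<phi>_def D_def A_def .
qed

text \<open>Division by the density restores mean zero under the shifted law. It inflates the second
  moment by at most \<open>1 / (1 - \<rho>)\<close>, for which \<open>inf\<close> leaves room. The
  bound \<open>2 * s i * k\<close> depends neither on \<open>n\<close> nor on
  \<open>\<tau>\<close>.\<close>

lemma local_score:
  assumes i: "i \<in> {1..k}" and si: "s i > 0"
    and p: "\<And>l. l \<in> {1..k} \<Longrightarrow> local_param s n \<tau> l \<ge> 0"
    and pos: "\<And>y. local_dens s n \<tau> y \<ge> 1 - \<rho>" and \<rho>: "\<rho> \<le> 1 / 2" and inf: "(s i)\<^sup>2 * info i \<le> 1 - \<rho>"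
  defines "\<phi> \<equiv> \<lambda>y. s i * dev i y / local_dens s n \<tau> y"
  shows "score (2 * s i * real k) (mix k M Q (local_param s n \<tau>)) \<phi>"
    and "(\<integral>y. (\<phi> y)\<^sup>2 \<partial>mix k M Q (local_param s n \<tau>)) \<le> 1"
proof -
  define D where "D = local_dens s n \<tau>"
  have D: "D y \<ge> 1 / 2" "D y \<ge> 1 - \<rho>" "D y > 0" for y using pos[of y] \<rho> by (auto simp: D_def)
  have [measurable]: "D \<in> borel_measurable m" unfolding D_def by measurable
  have \<phi>: "\<phi> y = s i * dev i y / D y" for y by (simp add: \<phi>_def D_def)
  have \<phi>m[measurable]: "\<phi> \<in> borel_measurable m" unfolding \<phi> by measurable
  have mixD: "mix k M Q (local_param s n \<tau>) = density m (\<lambda>y. ennreal (D y))"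
    unfolding D_def by (rule mix_local_param(1)[OF p])
  have "(\<integral>y. \<phi> y \<partial>mix k M Q (local_param s n \<tau>)) = (\<integral>y. D y * \<phi> y \<partial>m)"
    unfolding mixD using D(3) less_imp_le by (subst integral_density) auto
  also have "\<dots> = (\<integral>y. s i * dev i y \<partial>m)"
    using D(3) by (intro Bochner_Integration.integral_cong refl) (simp add: \<phi> less_imp_neq[symmetric])
  also have "\<dots> = 0" using integral_dev[OF i] by simp
  finally have mean: "(\<integral>y. \<phi> y \<partial>mix k M Q (local_param s n \<tau>)) = 0" .
  have "\<bar>\<phi> y\<bar> \<le> 2 * s i * real k" for y
  proof -
    have "\<bar>\<phi> y\<bar> = s i * \<bar>dev i y\<bar> / D y" using D(3)[of y] si by (simp add: \<phi> abs_mult)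
    also have "\<dots> \<le> s i * real k / (1 / 2)" using D[of y] si dev_bound[OF i, of y] by (intro frac_le mult_left_mono) auto
    finally show ?thesis by simp
  qed
  then show "score (2 * s i * real k) (mix k M Q (local_param s n \<tau>)) \<phi>"
    using mean mix_local_param(2)[OF p] \<phi>m by (simp add: score_def sm cong: measurable_cong_sets)
  have "(\<integral>y. (\<phi> y)\<^sup>2 \<partial>mix k M Q (local_param s n \<tau>)) = (\<integral>y. D y * (\<phi> y)\<^sup>2 \<partial>m)"
    unfolding mixD using D(3) less_imp_le by (subst integral_density) auto
  also have "\<dots> \<le> (\<integral>y. (s i)\<^sup>2 / (1 - \<rho>) * (dev i y)\<^sup>2 \<partial>m)"
  proof (rule integral_mono')
    show "integrable m (\<lambda>y. (s i)\<^sup>2 / (1 - \<rho>) * (dev i y)\<^sup>2)" using integrable_dev_sq[OF i] by simp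
    fix y
    have "D y * (\<phi> y)\<^sup>2 = (s i)\<^sup>2 * (dev i y)\<^sup>2 / D y"
      using D(3)[of y] by (simp add: \<phi> power_divide power_mult_distrib power2_eq_square)
    also have "\<dots> \<le> (s i)\<^sup>2 * (dev i y)\<^sup>2 / (1 - \<rho>)" using D[of y] \<rho> by (intro divide_left_mono) auto
    finally show "D y * (\<phi> y)\<^sup>2 \<le> (s i)\<^sup>2 / (1 - \<rho>) * (dev i y)\<^sup>2" by simp
    show "0 \<le> (s i)\<^sup>2 / (1 - \<rho>) * (dev i y)\<^sup>2" using \<rho> by simp
  qed
  also have "\<dots> = (s i)\<^sup>2 * info i / (1 - \<rho>)" by (simp add: info_def)
  also have "\<dots> \<le> 1" using inf \<rho> by (simp add: divide_le_eq)
  finally show "(\<integral>y. (\<phi> y)\<^sup>2 \<partial>mix k M Q (local_param s n \<tau>)) \<le> 1" .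
qed

text \<open>The step length that brings the information of coordinate \<open>i\<close> to just below
  1. \<open>\<kappa>\<close> keeps it finite when the mechanism reveals nothing in this direction
  and provides the slack used by \<open>local_score\<close>.\<close>

definition scl :: "real \<Rightarrow> nat \<Rightarrow> real" where
  "scl \<kappa> i = 1 / sqrt (info i + \<kappa>)"

lemma scl_pos: "i \<in> {1..k} \<Longrightarrow> \<kappa> > 0 \<Longrightarrow> scl \<kappa> i > 0"
  using info_bounds[of i] by (simp add: scl_def add_nonneg_pos)

text \<open>The slack is \<open>\<kappa> / (info i + \<kappa>)\<close>, which is smallest at the
  largest possible information \<open>k^2\<close>.\<close>

lemma scl_sq_info:
  assumes i: "i \<in> {1..k}" and \<kappa>: "\<kappa> > 0" and \<rho>: "\<rho> \<le> \<kappa> / ((real k)\<^sup>2 + \<kappa>)"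
  shows "(scl \<kappa> i)\<^sup>2 * info i \<le> 1 - \<rho>"
proof -
  have b: "0 \<le> info i" "info i \<le> (real k)\<^sup>2" using info_bounds[OF i] by auto
  have "\<kappa> / ((real k)\<^sup>2 + \<kappa>) \<le> \<kappa> / (info i + \<kappa>)" using b \<kappa> by (intro divide_left_mono mult_pos_pos) auto
  then have "\<rho> \<le> \<kappa> / (info i + \<kappa>)" using \<rho> by simp
  moreover have "(scl \<kappa> i)\<^sup>2 * info i = 1 - \<kappa> / (info i + \<kappa>)"
    using b \<kappa> by (simp add: scl_def power_divide field_simps)
  ultimately show ?thesis by simp
qed

lemma coord_risk_measurable:
  assumes i: "i \<in> {1..k}" and [measurable]: "(\<lambda>y. e y i) \<in> borel_measurable (iid n m)"
    and U: "sets U = sets borel"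
  shows "coord_risk u s n e i \<in> borel_measurable (PiM {1..k} (\<lambda>_. U))"
proof -
  interpret P: prob_space "iid n m" by (rule prob_space_PiM_iid) (rule pm)
  note [measurable_cong] = U
  have [measurable]: "(\<lambda>\<tau>. local_param s n \<tau> i) \<in> borel_measurable (PiM {1..k} (\<lambda>_. U))"
    unfolding local_param_def using i by measurable
  have [measurable]: "(\<lambda>(\<tau>, y). local_dens s n \<tau> (y j)) \<in> borel_measurable (PiM {1..k} (\<lambda>_. U) \<Otimes>\<^sub>M iid n m)" if j: "j \<in> {..<n}" for j
  proof -
    have [measurable]: "(\<lambda>y. y j) \<in> measurable (iid n m) m" using j by (rule measurable_component_singleton)
    have [measurable]: "(\<lambda>\<tau>. \<tau> l) \<in> borel_measurable (PiM {1..k} (\<lambda>_. U))" if "l \<in> {1..k}" for l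
      using measurable_component_singleton[OF that, of "\<lambda>_. U"] by (simp cong: measurable_cong_sets add: U)
    show ?thesis unfolding local_dens_def by measurable
  qed
  show ?thesis unfolding coord_risk_def by measurable
qed

text \<open>The supremum over the simplex is at least the prior mean, and the loss is a sum over
  coordinates. For each of them the others are frozen, which amounts to revealing them to the
  estimator; a lower bound survives that.\<close>

theorem local_minimax_bound:
  assumes u: "1 \<le> u" "u \<le> 2" and \<kappa>: "\<kappa> > 0" and \<eta>: "0 < \<eta>"  "\<eta> < gauss_moment u"
  shows "\<forall>\<^sub>F n in sequentially. ennreal (\<Sum>i=1..k. ((real k - 1) / real k * scl \<kappa> i / sqrt (real n)) powr u * (gauss_moment u - \<eta>)) \<le> minimax_risk k n u M Q"
proof -
  obtain T where T: "T > 0" and Bayes: "\<And>B. B \<ge> 0 \<Longrightarrow> \<forall>\<^sub>F n in sequentially. \<forall>(m::'b measure) f \<delta>. score B m f \<and> (\<integral>y. (f y)\<^sup>2 \<partial>m) \<le> 1 \<and> \<delta> \<in> borel_measurable (iid n m) \<longrightarrow>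
    ennreal (gauss_moment u - \<eta>) \<le>
    (\<integral>\<^sup>+t. tilted_risk u n m f \<delta> t \<partial>uniform_measure lborel {-T..T})"
    using bayes_risk_uniform_prior[OF u \<eta>(1), where 'b='b] by blast
  define s where "s = scl \<kappa>"
  have s: "s i > 0" if "i \<in> {1..k}" for i using scl_pos[OF that \<kappa>] by (simp add: s_def)
  \<comment> \<open>The first entry keeps the densities away from zero, the second is the slack of
    \<open>scl_sq_info\<close>.\<close>
  define \<rho> where "\<rho> = min (1 / 2) (\<kappa> / ((real k)\<^sup>2 + \<kappa>))"
  have \<rho>: "\<rho> > 0" "\<rho> \<le> 1 / 2" "\<rho> \<le> \<kappa> / ((real k)\<^sup>2 + \<kappa>)"
    unfolding \<rho>_def using \<kappa> by (simp_all only: min.cobounded1 min.cobounded2) (simp add: add_nonneg_pos)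
  define S where "S = (\<Sum>i=1..k. s i)"
  define U where "U = uniform_measure lborel {-T..T}"
  have U: "prob_space U" unfolding U_def using T by (intro prob_space_uniform_measure) auto
  have Us: "sets U = sets borel" by (simp add: U_def)
  have AEU: "AE t in U. \<bar>t\<bar> \<le> T" unfolding U_def by (intro AE_uniform_measureI) auto
  have "(\<lambda>n. S * T * 2 * real k / sqrt (real n)) \<longlonglongrightarrow> 0"
    by (intro real_tendsto_divide_at_top[OF tendsto_const] filterlim_compose[OF sqrt_at_top filterlim_real_sequentially])
  \<comment> \<open>From here on the whole cube is mapped into the simplex, and all local densities
    are at least \<open>1 - \<rho>\<close>.\<close>
  then have "\<forall>\<^sub>F n in sequentially. S * T * 2 * real k / sqrt (real n) < \<rho>" by (rule order_tendstoD(2)) (rule \<rho>(1))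
  moreover have "\<forall>\<^sub>F n in sequentially. \<forall>i\<in>{1..k}. \<forall>(m::'b measure) f \<delta>. score (2 * s i * real k) m f \<and> (\<integral>y. (f y)\<^sup>2 \<partial>m) \<le> 1 \<and> \<delta> \<in> borel_measurable (iid n m) \<longrightarrow>
    ennreal (gauss_moment u - \<eta>) \<le>
    (\<integral>\<^sup>+t. tilted_risk u n m f \<delta> t \<partial>U)"
    unfolding U_def
  proof (rule eventually_ball_finite, simp, intro ballI, rule Bayes)
    fix i assume "i \<in> {1..k}"
    then show "0 \<le> 2 * s i * real k" using s[of i] by simp
  qed
  ultimately show ?thesis using eventually_gt_at_top[of 0]
  proof eventually_elim
    case (elim n)
    note n\<rho> = elim(1) and B = elim(2)[rule_format] and n = elim(3)
    have box_param: "local_param s n \<tau> l \<ge> 0" if "\<And>i. i \<in> {1..k} \<Longrightarrow> \<bar>\<tau> i\<bar> \<le> T" "l \<in> {1..k}" for \<tau> l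
    proof (rule local_param_nonneg)
      show "s i \<ge> 0" if "i \<in> {1..k}" for i using s[OF that] by simp
      show "\<bar>\<tau> i\<bar> \<le> T" if "i \<in> {1..k}" for i using that \<open>\<And>i. i \<in> {1..k} \<Longrightarrow> \<bar>\<tau> i\<bar> \<le> T\<close> by blast
      show "(\<Sum>i=1..k. s i) * T * 2 * real k / sqrt (real n) \<le> 1" using n\<rho> \<rho>(2) unfolding S_def by linarith
      show "l \<in> {1..k}" by fact
    qed
    have box_dens: "local_dens s n \<tau> y \<ge> 1 - \<rho>" if "\<And>i. i \<in> {1..k} \<Longrightarrow> \<bar>\<tau> i\<bar> \<le> T" for \<tau> y
    proof -
      have "local_dens s n \<tau> y \<ge> 1 - (\<Sum>i=1..k. s i) * T * real k / sqrt (real n)"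
        by (rule local_dens_ge) (rule less_imp_le[OF s], assumption, rule that)
      moreover have "S * T * real k / sqrt (real n) \<le> S * T * 2 * real k / sqrt (real n)"
      proof -
        have "S \<ge> 0" unfolding S_def by (intro sum_nonneg less_imp_le[OF s])
        then show ?thesis using T by (intro divide_right_mono mult_right_mono) (auto simp: mult_ac mult_left_mono)
      qed
      ultimately show ?thesis using n\<rho> unfolding S_def by linarith
    qed
    show ?case unfolding minimax_risk_def
    proof (rule INF_greatest)
      fix e assume e: "e \<in> estimators k n M"
      have PMm: "sets (iid n m) = sets (iid n M)" by (rule sets_PiM_cong[OF refl]) (rule sm)
      have em[measurable]: "(\<lambda>y. e y i) \<in> borel_measurable (iid n m)" if "i \<in> {1..k}" for i
        using e that by (simp add: estimators_def measurable_cong_sets[OF PMm refl])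
      interpret U: product_prob_space "\<lambda>_::nat. U" using U by (simp add: product_prob_spaceI)
      have risk_ge: "(\<Sum>i=1..k. coord_risk u s n e i \<tau>) \<le> risk k n u M Q e" if \<tau>: "\<And>i. i \<in> {1..k} \<Longrightarrow> \<bar>\<tau> i\<bar> \<le> T" for \<tau>
      proof -
        define p where "p = local_param s n \<tau>"
        have D0: "local_dens s n \<tau> y \<ge> 0" for y
        proof -
          have "local_dens s n \<tau> y \<ge> 1 - \<rho>" by (rule box_dens) (rule \<tau>)
          then show ?thesis using \<rho>(2) by linarith
        qed
        have p0: "l \<in> {1..k} \<Longrightarrow> local_param s n \<tau> l \<ge> 0" for l by (rule box_param[of \<tau>]) (rule \<tau>)
        have "p \<in> prob_simplex k" unfolding prob_simplex_def
          using p0 sum_local_param[of s n \<tau>] by (auto simp: p_def local_param_def)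
        then have "(\<integral>\<^sup>+y. ennreal (lu u k (\<lambda>i. e y i - p i)) \<partial>iid n (mix k M Q p)) \<le> risk k n u M Q e"
          unfolding risk_def by (rule SUP_upper)
        also have "(\<integral>\<^sup>+y. ennreal (lu u k (\<lambda>i. e y i - p i)) \<partial>iid n (mix k M Q p))
          = (\<integral>\<^sup>+y. ennreal ((\<Prod>j<n. local_dens s n \<tau> (y j)) * lu u k (\<lambda>i. e y i - p i)) \<partial>iid n m)"
          unfolding p_def by (rule nn_integral_mix_local_param) (use p0 D0 in \<open>auto simp: lu_def\<close>)
        also have "\<dots> = (\<integral>\<^sup>+y. (\<Sum>i=1..k. ennreal ((\<Prod>j<n. local_dens s n \<tau> (y j)) * \<bar>e y i - p i\<bar> powr u)) \<partial>iid n m)"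
          by (intro nn_integral_cong) (simp add: lu_def sum_distrib_left sum_ennreal prod_nonneg D0)
        also have "\<dots> = (\<Sum>i=1..k. coord_risk u s n e i \<tau>)"
          unfolding coord_risk_def p_def by (rule nn_integral_sum) measurable
        finally show ?thesis .
      qed
      have AEbox: "AE \<tau> in PiM I (\<lambda>_. U). \<forall>i\<in>I. \<bar>\<tau> i\<bar> \<le> T" if "I \<subseteq> {1..k}" for I
        using that finite_subset[OF that] by (intro AE_finite_allI AE_PiM_component[where P="\<lambda>t. \<bar>t\<bar> \<le> T"]) (auto simp: U AEU)
      have meas: "coord_risk u s n e i \<in> borel_measurable (PiM {1..k} (\<lambda>_. U))" if "i \<in> {1..k}" for i
        by (rule coord_risk_measurable, rule that, rule em[OF that], rule Us)
      have coord: "ennreal (((real k - 1) / real k * s i / sqrt (real n)) powr u * (gauss_moment u - \<eta>)) \<le> (\<integral>\<^sup>+\<tau>. coord_risk u s n e i \<tau> \<partial>PiM {1..k} (\<lambda>_. U))"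
        if i: "i \<in> {1..k}" for i
      proof -
        define r where "r = (real k - 1) / real k * s i / sqrt (real n)"
        define I where "I = {1..k} - {i}"
        interpret PI: prob_space "PiM I (\<lambda>_. U)" by (intro prob_space_PiM U)
        have ins: "{1..k} = insert i I" "finite I" "i \<notin> I" using insert_Diff[OF i] by (simp_all add: I_def)
        have "ennreal (r powr u * (gauss_moment u - \<eta>)) = (\<integral>\<^sup>+w. ennreal (r powr u * (gauss_moment u - \<eta>)) \<partial>PiM I (\<lambda>_. U))"
          by (simp add: PI.emeasure_space_1)
        also have "\<dots> \<le> (\<integral>\<^sup>+w. (\<integral>\<^sup>+t. coord_risk u s n e i (w(i := t)) \<partial>U) \<partial>PiM I (\<lambda>_. U))"
        proof (rule nn_integral_mono_AE)
          have "AE w in PiM I (\<lambda>_. U). \<forall>l\<in>I. \<bar>w l\<bar> \<le> T" by (rule AEbox) (auto simp: I_def)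
          then show "AE w in PiM I (\<lambda>_. U). ennreal (r powr u * (gauss_moment u - \<eta>)) \<le> (\<integral>\<^sup>+t. coord_risk u s n e i (w(i := t)) \<partial>U)"
          proof eventually_elim
            case (elim w)
            \<comment> \<open>Elements of the product over \<open>I\<close> are
              \<open>undefined\<close> at \<open>i\<close>; the base point takes 0 there.\<close>
            define \<tau> where "\<tau> = w(i := 0)"
            have \<tau>: "\<bar>\<tau> l\<bar> \<le> T" if "l \<in> {1..k}" for l using elim that T by (auto simp: \<tau>_def I_def)
            have p0: "l \<in> {1..k} \<Longrightarrow> local_param s n \<tau> l \<ge> 0" for l by (rule box_param[of \<tau>]) (rule \<tau>)
            have D: "local_dens s n \<tau> y \<ge> 1 - \<rho>" for y by (rule box_dens) (rule \<tau>)
            have Dpos: "local_dens s n \<tau> y > 0" for y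
            proof -
              show ?thesis using D[of y] \<rho>(2) by linarith
            qed
            define \<phi> where "\<phi> y = s i * dev i y / local_dens s n \<tau> y" for y
            define \<delta> where "\<delta> y = (e y i - local_param s n \<tau> i) / r" for y
            define N where "N = mix k M Q (local_param s n \<tau>)"
            have inf: "(s i)\<^sup>2 * info i \<le> 1 - \<rho>" unfolding s_def by (rule scl_sq_info[OF i \<kappa> \<rho>(3)])
            have sc: "score (2 * s i * real k) N \<phi>" "(\<integral>y. (\<phi> y)\<^sup>2 \<partial>N) \<le> 1"
              unfolding \<phi>_def[abs_def] N_def
              by (rule local_score[OF i s[OF i] _ D \<rho>(2) inf], rule p0, assumption)+
            have sN: "sets N = sets m" by (simp add: N_def sm)
            have PNm: "sets (iid n N) = sets (iid n m)" by (rule sets_PiM_cong[OF refl]) (rule sN)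
            have \<delta>: "\<delta> \<in> borel_measurable (iid n N)"
              unfolding measurable_cong_sets[OF PNm refl] \<delta>_def using i by measurable
            have "(\<lambda>t. tilted_risk u n N \<phi> \<delta> t) \<in> borel_measurable borel"
            proof -
              interpret PN: prob_space "iid n N" by (rule prob_space_PiM_iid) (rule scoreD[OF sc(1)])
              have [measurable]: "\<phi> \<in> borel_measurable N" by (rule scoreD[OF sc(1)])
              note \<delta>[measurable]
              have [measurable]: "(\<lambda>(t, y). lik n (\<lambda>y. t * \<phi> y) y) \<in> borel_measurable (borel \<Otimes>\<^sub>M iid n N)" unfolding lik_def by measurable
              show ?thesis by measurable
            qed
            then have m1: "(\<lambda>t. tilted_risk u n N \<phi> \<delta> t) \<in> borel_measurable U"
              by (simp cong: measurable_cong_sets add: Us)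
            have "ennreal (r powr u * (gauss_moment u - \<eta>)) = ennreal (r powr u) * ennreal (gauss_moment u - \<eta>)"
              by (rule ennreal_mult') simp
            also have "\<dots> \<le> ennreal (r powr u) * (\<integral>\<^sup>+t. tilted_risk u n N \<phi> \<delta> t \<partial>U)"
              by (intro mult_left_mono B[OF i]) (use sc \<delta> in auto)
            also have "\<dots> = (\<integral>\<^sup>+t. ennreal (r powr u) * tilted_risk u n N \<phi> \<delta> t \<partial>U)"
              by (rule nn_integral_cmult[OF m1, symmetric])
            also have "\<dots> = (\<integral>\<^sup>+t. coord_risk u s n e i (w(i := t)) \<partial>U)"
            proof (rule nn_integral_cong)
              fix t
              have "coord_risk u s n e i (w(i := t)) = ennreal (r powr u) *
                (\<integral>\<^sup>+y. ennreal (lik n (\<lambda>y. t * (s i * dev i y / local_dens s n (w(i := 0)) y)) y * \<bar>(e y i - local_param s n (w(i := 0)) i) / r - t\<bar> powr u)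
                \<partial>iid n (mix k M Q (local_param s n (w(i := 0)))))"
                unfolding r_def
                by (rule coord_risk_update, rule i, rule s[OF i], rule n, unfold \<tau>_def[symmetric], rule p0, assumption, rule Dpos, rule em[OF i])
              then show "ennreal (r powr u) * tilted_risk u n N \<phi> \<delta> t = coord_risk u s n e i (w(i := t))"
                by (simp add: \<phi>_def[abs_def] \<delta>_def N_def \<tau>_def)
            qed
            finally show ?case .
          qed
        qed
        also have "\<dots> = (\<integral>\<^sup>+\<tau>. coord_risk u s n e i \<tau> \<partial>PiM {1..k} (\<lambda>_. U))"
          unfolding ins(1) by (rule U.product_nn_integral_insert[symmetric, OF ins(2,3)]) (use meas[OF i] ins(1) in simp)
        finally show ?thesis by (simp add: r_def)
      qed
      interpret PU: prob_space "PiM {1..k} (\<lambda>_. U)" by (intro prob_space_PiM U)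
      have "ennreal (\<Sum>i=1..k. ((real k - 1) / real k * s i / sqrt (real n)) powr u * (gauss_moment u - \<eta>))
        = (\<Sum>i=1..k. ennreal (((real k - 1) / real k * s i / sqrt (real n)) powr u * (gauss_moment u - \<eta>)))"
        using \<eta> by (intro sum_ennreal[symmetric]) auto
      also have "\<dots> \<le> (\<Sum>i=1..k. \<integral>\<^sup>+\<tau>. coord_risk u s n e i \<tau> \<partial>PiM {1..k} (\<lambda>_. U))" by (intro sum_mono coord)
      also have "\<dots> = (\<integral>\<^sup>+\<tau>. (\<Sum>i=1..k. coord_risk u s n e i \<tau>) \<partial>PiM {1..k} (\<lambda>_. U))"
        by (rule nn_integral_sum[symmetric]) (rule meas)
      also have "\<dots> \<le> (\<integral>\<^sup>+\<tau>. risk k n u M Q e \<partial>PiM {1..k} (\<lambda>_. U))"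
      proof (rule nn_integral_mono_AE)
        show "AE \<tau> in PiM {1..k} (\<lambda>_. U). (\<Sum>i=1..k. coord_risk u s n e i \<tau>) \<le> risk k n u M Q e"
          using AEbox[OF subset_refl]
        proof eventually_elim
          case (elim \<tau>)
          show ?case by (rule risk_ge) (use elim in blast)
        qed
      qed
      also have "\<dots> = risk k n u M Q e" unfolding nn_integral_const PU.emeasure_space_1 by simp
      finally show "ennreal (\<Sum>i=1..k. ((real k - 1) / real k * scl \<kappa> i / sqrt (real n)) powr u * (gauss_moment u - \<eta>)) \<le> risk k n u M Q e"
        by (simp add: s_def)
    qed
  qed
qed

text \<open>Tangent line of the convex function \<open>x powr (- u / 2)\<close> at
  \<open>c + \<kappa>\<close>. Its slope is negative, so an upper bound on the total information is
  of the right kind.\<close>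

lemma sum_scl_powr_ge:
  assumes u: "0 < u" and \<kappa>: "\<kappa> > 0" and c: "c \<ge> 0" and sum: "(\<Sum>i=1..k. info i) \<le> c * real k"
  shows "real k * (c + \<kappa>) powr (- u / 2) \<le> (\<Sum>i=1..k. scl \<kappa> i powr u)"
proof -
  define v where "v = u / 2"
  define A where "A = (c + \<kappa>) powr (- v)"
  have ck: "c + \<kappa> > 0" using c \<kappa> by simp
  have pt: "A * (1 - v * ((info i + \<kappa>) / (c + \<kappa>) - 1)) \<le> scl \<kappa> i powr u" if i: "i \<in> {1..k}" for i
  proof -
    define x where "x = (info i + \<kappa>) / (c + \<kappa>)"
    have ik: "info i + \<kappa> > 0" using info_bounds[OF i] \<kappa> by simp
    have x: "x > 0" using ik ck by (simp add: x_def)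
    have "1 - v * (x - 1) \<le> 1 + (- v) * ln x"
      using ln_le_minus_one[OF x] u by (simp add: v_def mult_left_mono)
    also have "\<dots> \<le> exp ((- v) * ln x)" by (rule exp_ge_add_one_self)
    also have "\<dots> = x powr (- v)" using x by (simp add: powr_def)
    finally have "A * (1 - v * (x - 1)) \<le> A * x powr (- v)" by (intro mult_left_mono) (auto simp: A_def)
    also have "\<dots> = (info i + \<kappa>) powr (- v)"
      using ck ik by (simp add: A_def x_def powr_mult[symmetric])
    also have "\<dots> = scl \<kappa> i powr u"
    proof -
      have "scl \<kappa> i = (info i + \<kappa>) powr (- (1 / 2))"
        using ik by (simp add: scl_def powr_minus powr_half_sqrt inverse_eq_divide)
      then show ?thesis by (simp add: powr_powr v_def)
    qed
    finally show ?thesis by (simp add: x_def)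
  qed
  have "(\<Sum>i=1..k. (info i + \<kappa>) / (c + \<kappa>)) \<le> real k"
  proof -
    have "(\<Sum>i=1..k. (info i + \<kappa>) / (c + \<kappa>)) = ((\<Sum>i=1..k. info i) + real k * \<kappa>) / (c + \<kappa>)"
      by (simp add: sum.distrib flip: sum_divide_distrib)
    also have "\<dots> \<le> (c * real k + real k * \<kappa>) / (c + \<kappa>)" using sum ck by (intro divide_right_mono) auto
    also have "\<dots> = real k" using ck by (simp add: field_simps)
    finally show ?thesis .
  qed
  then have "v * ((\<Sum>i=1..k. (info i + \<kappa>) / (c + \<kappa>)) - real k) \<le> 0"
    using u by (intro mult_nonneg_nonpos) (auto simp: v_def)
  then have "A * real k \<le> A * (real k - v * ((\<Sum>i=1..k. (info i + \<kappa>) / (c + \<kappa>)) - real k))"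
    by (intro mult_left_mono) (auto simp: A_def)
  also have "\<dots> = (\<Sum>i=1..k. A * (1 - v * ((info i + \<kappa>) / (c + \<kappa>) - 1)))"
    by (simp add: sum_distrib_left[symmetric] sum_subtractf)
  also have "\<dots> \<le> (\<Sum>i=1..k. scl \<kappa> i powr u)" by (rule sum_mono) (rule pt)
  finally show ?thesis by (simp add: A_def v_def mult.commute)
qed

end

text \<open>Common shape of both bounds: \<open>c\<close> is an information per coordinate and
  \<open>g\<close> an absolute moment. The lower bound takes \<open>c + \<kappa>\<close> and
  \<open>gauss_moment u - \<eta>\<close>, the upper one \<open>c\<close> and
  \<open>gauss_moment u + \<eta>\<close>.\<close>

abbreviation asymptotic_risk :: "nat \<Rightarrow> real \<Rightarrow> real \<Rightarrow> real \<Rightarrow> nat \<Rightarrow> real" where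
  "asymptotic_risk k u c g n \<equiv> real k * (((real k - 1) / real k) powr u * c powr (- u / 2)) * g * real n powr (- u / 2)"

theorem ldp_minimax_lower_bound:
  fixes M :: "'b measure"
  assumes k: "k \<ge> 2" and \<epsilon>: "\<epsilon> > 0" and u: "1 \<le> u" "u \<le> 2"
    and mech: "mechanism k M Q" and ldp: "ldp k \<epsilon> M Q"
    and c: "\<And>d. d \<in> {1..k-1} \<Longrightarrow> real d * (real k - real d) * (exp \<epsilon> - 1)\<^sup>2 \<le> c * (real d * exp \<epsilon> + real k - real d)\<^sup>2"
    and c0: "c \<ge> 0" and \<kappa>: "\<kappa> > 0" and \<eta>: "0 < \<eta>" "\<eta> < gauss_moment u"
  shows "\<forall>\<^sub>F n in sequentially. ennreal (asymptotic_risk k u (c + \<kappa>) (gauss_moment u - \<eta>) n) \<le> minimax_risk k n u M Q"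
proof -
  define m where "m = mix k M Q (\<lambda>i. if i \<in> {1..k} then 1 / real k else 0)"
  have k1: "k \<ge> 1" and \<epsilon>0: "\<epsilon> \<ge> 0" using k \<epsilon> by auto
  obtain f where f: "prob_space m" "sets m = sets M"
    "\<And>i. f i \<in> borel_measurable M"
    "\<And>i y. i \<in> {1..k} \<Longrightarrow> 0 \<le> f i y"
    "\<And>y. (\<Sum>i=1..k. f i y) = real k"
    "\<And>i j y. i \<in> {1..k} \<Longrightarrow> j \<in> {1..k} \<Longrightarrow> f i y \<le> exp \<epsilon> * f j y"
    "\<And>i. i \<in> {1..k} \<Longrightarrow> Q i = density m (\<lambda>y. ennreal (f i y))"
    using ldp_densities[OF k1 mech ldp \<epsilon>0] unfolding m_def by metis
  interpret mechanism_densities k M Q m f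
  proof (rule mechanism_densities.intro)
    show "f i \<in> borel_measurable m" for i
      using f(3) by (simp cong: measurable_cong_sets add: f(2))
    show "k \<ge> 2" "mechanism k M Q" "prob_space m" "sets m = sets M" by fact+
    show "0 \<le> f i y" if "i \<in> {1..k}" for i y using that by (rule f(4))
    show "(\<Sum>i=1..k. f i y) = real k" for y by (rule f(5))
    show "Q i = density m (\<lambda>y. ennreal (f i y))" if "i \<in> {1..k}" for i using that by (rule f(7))
  qed
  have "real k * (\<Sum>i=1..k. (f i y)\<^sup>2) \<le> (1 + c) * (\<Sum>i=1..k. f i y)\<^sup>2" for y
  proof (rule bounded_ratio_variance[OF k])
    show "1 < exp \<epsilon>" using \<epsilon> by simp
    show "0 \<le> f i y" if "i \<in> {1..k}" for i using that by (rule f(4))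
    show "f i y \<le> exp \<epsilon> * f j y" if "i \<in> {1..k}" "j \<in> {1..k}" for i j using that by (rule f(6))
  qed (rule c)
  then have sum: "(\<Sum>i=1..k. info i) \<le> c * real k" by (rule sum_info_le)
  show ?thesis using local_minimax_bound[OF u \<kappa> \<eta>] eventually_gt_at_top[of 0]
  proof eventually_elim
    case (elim n)
    have e: "((real k - 1) / real k * scl \<kappa> i / sqrt (real n)) powr u = ((real k - 1) / real k) powr u * real n powr (- u / 2) * scl \<kappa> i powr u" if "i \<in> {1..k}" for i
    proof -
      have "((real k - 1) / real k * scl \<kappa> i / sqrt (real n)) powr u = ((real k - 1) / real k) powr u * scl \<kappa> i powr u / sqrt (real n) powr u"
        using k scl_pos[OF that \<kappa>] by (simp add: powr_mult powr_divide)
      also have "sqrt (real n) powr u = real n powr (u / 2)" by (simp add: powr_half_sqrt[symmetric] powr_powr)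
      finally show ?thesis by (simp add: powr_minus_divide)
    qed
    have "(\<Sum>i=1..k. ((real k - 1) / real k * scl \<kappa> i / sqrt (real n)) powr u * (gauss_moment u - \<eta>))
      = ((real k - 1) / real k) powr u * real n powr (- u / 2) * (gauss_moment u - \<eta>) * (\<Sum>i=1..k. scl \<kappa> i powr u)"
      unfolding sum_distrib_left
    proof (intro sum.cong refl)
      fix i assume i: "i \<in> {1..k}"
      show "((real k - 1) / real k * scl \<kappa> i / sqrt (real n)) powr u * (gauss_moment u - \<eta>)
        = ((real k - 1) / real k) powr u * real n powr (- u / 2) * (gauss_moment u - \<eta>) * scl \<kappa> i powr u"
        unfolding e[OF i] by (simp only: mult_ac)
    qed
    moreover have "\<dots> \<ge> ((real k - 1) / real k) powr u * real n powr (- u / 2) * (gauss_moment u - \<eta>) * (real k * (c + \<kappa>) powr (- u / 2))"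
      using sum_scl_powr_ge[OF _ \<kappa> c0 sum, of u] u \<eta> by (intro mult_left_mono) auto
    ultimately have "asymptotic_risk k u (c + \<kappa>) (gauss_moment u - \<eta>) n \<le> (\<Sum>i=1..k. ((real k - 1) / real k * scl \<kappa> i / sqrt (real n)) powr u * (gauss_moment u - \<eta>))"
      by (simp add: mult_ac)
    then show ?case using elim(1) by (meson ennreal_leI order_trans)
  qed
qed

section \<open>Convergence of absolute moments\<close>

lemma gauss_capped_moment_le:
  assumes "0 < u" "u \<le> 2" "A \<ge> 0"
  shows "(\<integral>x. min \<bar>x\<bar> A powr u \<partial>gauss) \<le> gauss_moment u"
  unfolding gauss_moment_def
  by (rule integral_mono') (use assms integrable_gauss_moment in \<open>auto intro!: powr_mono2\<close>)

text \<open>Beyond \<open>A\<close> one has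
  \<open>\<bar>x\<bar> powr u \<le> x^2 \<le> x^4 / A^2\<close>, and
  \<open>x^4 \<le> 24 * exp \<bar>x\<bar>\<close> with \<open>24 = fact 4\<close>. Exponential
  moments thus control the tail that weak convergence does not see.\<close>

lemma abs_powr_le_capped:
  fixes x u A :: real
  assumes u: "0 < u" "u \<le> 2" and A: "A \<ge> 1"
  shows "\<bar>x\<bar> powr u \<le> min \<bar>x\<bar> A powr u + 24 / A\<^sup>2 * (exp x + exp (- x))"
proof (cases "\<bar>x\<bar> \<le> A")
  case True
  then show ?thesis using A by (simp add: min_def)
next
  case False
  have x: "\<bar>x\<bar> > 1" using A False by linarith
  have "\<bar>x\<bar> powr u \<le> \<bar>x\<bar> powr 2" using x u by (intro powr_mono) auto
  also have "\<bar>x\<bar> powr 2 = x\<^sup>2" using x by (simp add: powr_numeral)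
  also have "\<dots> \<le> \<bar>x\<bar> ^ 4 / A\<^sup>2"
  proof -
    have "A\<^sup>2 \<le> \<bar>x\<bar>\<^sup>2" using False A by (intro power_mono) auto
    then have "x\<^sup>2 * A\<^sup>2 \<le> x\<^sup>2 * x\<^sup>2" by (intro mult_left_mono) auto
    then show ?thesis using A by (simp add: field_simps power4_eq_xxxx power2_eq_square)
  qed
  also have "\<bar>x\<bar> ^ 4 \<le> 24 * exp \<bar>x\<bar>"
  proof -
    obtain t where t: "\<bar>t\<bar> \<le> \<bar>\<bar>x\<bar>\<bar>" "exp \<bar>x\<bar> = (\<Sum>m<4. (\<bar>x\<bar> ^ m) / fact m) + (exp t / fact 4) * \<bar>x\<bar> ^ 4"
      using Maclaurin_exp_le[of "\<bar>x\<bar>" 4] by blast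
    obtain t' where t': "exp \<bar>x\<bar> = (\<Sum>m<5. (\<bar>x\<bar> ^ m) / fact m) + (exp t' / fact 5) * \<bar>x\<bar> ^ 5"
      using Maclaurin_exp_le[of "\<bar>x\<bar>" 5] by blast
    have "\<bar>x\<bar> ^ 4 / fact 4 \<le> (\<Sum>m<5. (\<bar>x\<bar> ^ m) / fact m)"
      by (rule member_le_sum[of 4]) auto
    also have "\<dots> \<le> exp \<bar>x\<bar>" unfolding t' by simp
    finally show ?thesis by (simp add: fact_numeral)
  qed
  also have "24 * exp \<bar>x\<bar> \<le> 24 * (exp x + exp (- x))" by (cases "x \<ge> 0") auto
  finally have "\<bar>x\<bar> powr u \<le> 24 / A\<^sup>2 * (exp x + exp (- x))" using A by (simp add: divide_right_mono)
  then show ?thesis by (smt (verit) powr_ge_zero)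
qed

text \<open>The Gaussian value is at most \<open>exp (1 / 2) \<le> 2\<close>; the remaining 1
  absorbs the deviation from it.\<close>

lemma mgf_le_3:
  assumes B: "B \<ge> 0"
  shows "\<forall>\<^sub>F n in sequentially. \<forall>(m::'b measure) f. score B m f \<and> (\<integral>y. (f y)\<^sup>2 \<partial>m) \<le> 1 \<longrightarrow>
    (\<integral>\<^sup>+y. ennreal (exp (nsum n f y)) \<partial>iid n m) \<le> 3"
    (is "\<forall>\<^sub>F n in sequentially. \<forall>m f. ?P m f \<longrightarrow> ?R n m f")
proof -
  have "\<forall>\<^sub>F n in sequentially. \<forall>z :: 'b measure \<times> ('b \<Rightarrow> real). ?P (fst z) (snd z) \<longrightarrow> ?R n (fst z) (snd z)"
  proof (rule eventually_uniformly_in_parameter)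
    show "\<exists>z :: 'b measure \<times> ('b \<Rightarrow> real). ?P (fst z) (snd z)"
      by (rule exI[of _ "(return (count_space UNIV) undefined, \<lambda>_. 0)"]) (use B in \<open>simp add: score_def prob_space_return\<close>)
    fix X :: "nat \<Rightarrow> 'b measure \<times> ('b \<Rightarrow> real)"
    assume X: "\<And>n. ?P (fst (X n)) (snd (X n))"
    then have s: "\<And>n. score B (fst (X n)) (snd (X n))" by blast
    have "\<forall>\<^sub>F n in sequentially. (\<integral>y. exp (nsum n (snd (X n)) y) \<partial>iid n (fst (X n))) - exp ((\<integral>y. (snd (X n) y)\<^sup>2 \<partial>fst (X n)) / 2) < 1"
      by (rule order_tendstoD(2)[OF mgf_tendsto(1)[OF s]]) simp
    then show "\<forall>\<^sub>F n in sequentially. ?R n (fst (X n)) (snd (X n))" using eventually_gt_at_top[of 0]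
    proof eventually_elim
      case (elim n)
      have "exp ((\<integral>y. (snd (X n) y)\<^sup>2 \<partial>fst (X n)) / 2) \<le> exp (1 / 2)" using X[of n] by simp
      also have "\<dots> \<le> 2" by (rule exp_half_le2)
      finally have "(\<integral>y. exp (nsum n (snd (X n)) y) \<partial>iid n (fst (X n))) \<le> 3" using elim(1) by linarith
      then show ?case
        using mgf_tendsto(2)[OF s elim(2)] ennreal_leI by (subst nn_integral_eq_integral) fastforce+
    qed
  qed
  then show ?thesis by (rule eventually_mono) auto
qed

text \<open>The capped power is bounded and continuous, so weak convergence applies to it, and
  exponential moments bound the rest. As the second moment is exactly 1, the auxiliary Gaussian of
  \<open>expectation_clt\<close> has weight zero.\<close>

theorem absolute_moment_clt:
  assumes u: "0 < u" "u \<le> 2" and B: "B \<ge> 0" and \<eta>: "\<eta> > 0"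
  shows "\<forall>\<^sub>F n in sequentially. \<forall>(m::'b measure) f. score B m f \<and> (\<integral>y. (f y)\<^sup>2 \<partial>m) = 1 \<longrightarrow>
    (\<integral>\<^sup>+y. ennreal (\<bar>nsum n f y\<bar> powr u) \<partial>iid n m) \<le> ennreal (gauss_moment u + \<eta>)"
proof -
  obtain A where A: "A \<ge> 1" "24 / A\<^sup>2 * 6 \<le> \<eta> / 2"
  proof
    \<comment> \<open>\<open>6\<close> is the sum of the bounds 3 for the two exponential moments,
      and \<open>288 = 2 * 24 * 6\<close>.\<close>
    define A where "A = max 1 (sqrt (288 / \<eta>))"
    show "A \<ge> 1" by (simp add: A_def)
    have "288 / \<eta> = (sqrt (288 / \<eta>))\<^sup>2" using \<eta> by simp
    also have "\<dots> \<le> A\<^sup>2" using \<eta> by (intro power_mono) (auto simp: A_def)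
    finally have "288 \<le> A\<^sup>2 * \<eta>" using \<eta> by (simp add: divide_le_eq)
    then show "24 / A\<^sup>2 * 6 \<le> \<eta> / 2" using \<open>A \<ge> 1\<close> by (simp add: field_simps)
  qed
  define c where "c x = min \<bar>x\<bar> A powr u" for x :: real
  have c[measurable]: "c \<in> borel_measurable borel" unfolding c_def by measurable
  have cb: "0 \<le> c x" "c x \<le> A powr u" for x using A u by (auto simp: c_def intro!: powr_mono2)
  have "isCont c x" for x
  proof -
    have "((\<lambda>z. min \<bar>z\<bar> A) \<longlongrightarrow> min \<bar>x\<bar> A) (at x)" by (intro tendsto_intros)
    then show ?thesis unfolding isCont_def c_def
      by (rule tendsto_powr2[OF _ tendsto_const]) (use A u in auto)
  qed
  then have disc: "gauss {x. \<not> isCont c x} = 0" by simp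
  have \<eta>2: "\<eta> / 2 > 0" using \<eta> by simp
  have cg: "(\<integral>x. c x \<partial>gauss) \<le> gauss_moment u" using gauss_capped_moment_le[OF u, of A] A unfolding c_def by simp
  interpret N: prob_space gauss by (rule prob_space_std_normal)
  show ?thesis using expectation_clt[OF B \<eta>2 c cb disc, where 'b='b] mgf_le_3[OF B, where 'b='b]
  proof eventually_elim
    case (elim n)
    show ?case
    proof (intro allI impI, elim conjE)
      fix m :: "'b measure" and f assume s: "score B m f" and v: "(\<integral>y. (f y)\<^sup>2 \<partial>m) = 1"
      note [measurable] = scoreD(2)[OF s]
      \<comment> \<open>The negated score yields the exponential moment of
        \<open>- nsum n f y\<close>.\<close>
      have s': "score B m (\<lambda>y. - 1 * f y)" using score_scale[OF s, of "- 1" 1] by simp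
      have v': "(\<integral>y. (- 1 * f y)\<^sup>2 \<partial>m) = 1" using v by simp
      obtain r where r: "\<bar>r - (\<integral>x. c x \<partial>gauss)\<bar> < \<eta> / 2"
        and eq: "(\<integral>\<^sup>+y. (\<integral>\<^sup>+x. ennreal (c (nsum n f y + sqrt (1 - (\<integral>y. (f y)\<^sup>2 \<partial>m)) * x)) \<partial>gauss) \<partial>iid n m) = ennreal r"
        using elim(1) s v by fastforce
      have C: "(\<integral>\<^sup>+y. ennreal (c (nsum n f y)) \<partial>iid n m) = ennreal r"
        using eq unfolding v by (simp add: N.emeasure_space_1[simplified])
      have M1: "(\<integral>\<^sup>+y. ennreal (exp (nsum n f y)) \<partial>iid n m) \<le> 3"
        using elim(2) s v by fastforce
      have M2: "(\<integral>\<^sup>+y. ennreal (exp (- nsum n f y)) \<partial>iid n m) \<le> 3"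
        using elim(2)[rule_format, OF conjI[OF s' eq_refl[OF v']]] unfolding nsum_scale by simp
      have "(\<integral>\<^sup>+y. ennreal (\<bar>nsum n f y\<bar> powr u) \<partial>iid n m) \<le>
        (\<integral>\<^sup>+y. ennreal (c (nsum n f y)) + ennreal (24 / A\<^sup>2) * (ennreal (exp (nsum n f y)) + ennreal (exp (- nsum n f y))) \<partial>iid n m)"
      proof (rule nn_integral_mono)
        fix y
        have "ennreal (\<bar>nsum n f y\<bar> powr u) \<le> ennreal (c (nsum n f y)) + ennreal (24 / A\<^sup>2 * (exp (nsum n f y) + exp (- nsum n f y)))"
          using abs_powr_le_capped[OF u A(1), of "nsum n f y"] cb unfolding c_def by (intro ennreal_le_plus) auto
        also have "ennreal (24 / A\<^sup>2 * (exp (nsum n f y) + exp (- nsum n f y))) = ennreal (24 / A\<^sup>2) * (ennreal (exp (nsum n f y)) + ennreal (exp (- nsum n f y)))"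
          by (subst ennreal_mult') simp_all
        finally show "ennreal (\<bar>nsum n f y\<bar> powr u) \<le> ennreal (c (nsum n f y)) + ennreal (24 / A\<^sup>2) * (ennreal (exp (nsum n f y)) + ennreal (exp (- nsum n f y)))" .
      qed
      also have "\<dots> = ennreal r + ennreal (24 / A\<^sup>2) * ((\<integral>\<^sup>+y. ennreal (exp (nsum n f y)) \<partial>iid n m) + (\<integral>\<^sup>+y. ennreal (exp (- nsum n f y)) \<partial>iid n m))"
        unfolding C[symmetric] by (simp add: nn_integral_add nn_integral_cmult)
      also have "\<dots> \<le> ennreal r + ennreal (24 / A\<^sup>2) * (3 + 3)"
        by (intro add_left_mono mult_left_mono add_mono M1 M2) simp
      also have "ennreal (24 / A\<^sup>2) * (3 + 3) = ennreal (24 / A\<^sup>2 * 6)" by (subst ennreal_mult') simp_all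
      also have "ennreal r + ennreal (24 / A\<^sup>2 * 6) \<le> ennreal (gauss_moment u + \<eta> / 2) + ennreal (\<eta> / 2)"
        by (intro add_mono ennreal_leI A(2)) (use r cg in linarith)
      also have "\<dots> = ennreal (gauss_moment u + \<eta>)"
        using gauss_moment_pos[OF u] \<eta> by (subst ennreal_plus[symmetric]) auto
      finally show "(\<integral>\<^sup>+y. ennreal (\<bar>nsum n f y\<bar> powr u) \<partial>iid n m) \<le> ennreal (gauss_moment u + \<eta>)" .
    qed
  qed
qed

section \<open>The risk of the empirical estimator\<close>

lemma Ykd_eq_image:
  "Ykd k d = (\<lambda>A i. if i \<in> A then 1 else 0) ` {A. A \<subseteq> {1..k} \<and> card A = d}" (is "_ = ?f ` _")
proof (intro equalityI subsetI)
  fix y assume y: "y \<in> Ykd k d"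
  define A where "A = {i\<in>{1..k}. y i = 1}"
  have yA: "y = ?f A"
  proof
    fix i show "y i = ?f A i" using y unfolding Ykd_def A_def by (cases "i \<in> {1..k}") auto
  qed
  have "d = (\<Sum>i=1..k. y i)" using y by (simp add: Ykd_def)
  also have "\<dots> = (\<Sum>i\<in>{1..k}. if i \<in> A then 1 else 0)" by (subst yA) simp
  also have "\<dots> = card ({1..k} \<inter> A)" by (subst sum.inter_restrict[symmetric]) auto
  also have "{1..k} \<inter> A = A" by (auto simp: A_def)
  finally have "d = card A" .
  then show "y \<in> ?f ` {A. A \<subseteq> {1..k} \<and> card A = d}" 
    by (intro image_eqI[where x=A], intro yA) (auto simp: A_def)
next
  fix y assume "y \<in> ?f ` {A. A \<subseteq> {1..k} \<and> card A = d}"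
  then obtain A where A: "A \<subseteq> {1..k}" "card A = d" "y = ?f A" by blast
  have "(\<Sum>i=1..k. y i) = card ({1..k} \<inter> A)" unfolding A(3) by (subst sum.inter_restrict[symmetric]) auto
  also have "{1..k} \<inter> A = A" using A by auto
  finally show "y \<in> Ykd k d" using A by (auto simp: Ykd_def)
qed

lemma finite_Ykd [simp]: "finite (Ykd k d)"
  unfolding Ykd_eq_image by (rule finite_imageI, rule finite_subset[of _ "Pow {1..k}"], blast, simp)

lemma card_Ykd: "card (Ykd k d) = k choose d"
proof -
  have "inj_on (\<lambda>A i. if i \<in> A then 1 else 0 :: nat) {A. A \<subseteq> {1..k} \<and> card A = d}"
    by (rule inj_onI) (auto simp: fun_eq_iff split: if_splits)
  then have "card (Ykd k d) = card {A. A \<subseteq> {1..k} \<and> card A = d}" unfolding Ykd_eq_image by (rule card_image)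
  also have "\<dots> = k choose d" using n_subsets[of "{1..k}" d] by simp
  finally show ?thesis .
qed

text \<open>Exchanging two positions is an involution of the alphabet. This symmetry replaces direct
  counts of words with prescribed entries.\<close>

lemma sum_Ykd_swap:
  assumes "i \<in> {1..k}" "j \<in> {1..k}"
  shows "(\<Sum>y\<in>Ykd k d. g (y \<circ> Transposition.transpose i j)) = (\<Sum>y\<in>Ykd k d. g y)"
proof -
  have perm: "Transposition.transpose i j permutes {1..k}" by (rule permutes_swap_id[OF assms])
  have *: "y \<circ> Transposition.transpose i j \<in> Ykd k d" if "y \<in> Ykd k d" for y
  proof -
    have "(\<Sum>l=1..k. (y \<circ> Transposition.transpose i j) l) = (\<Sum>l=1..k. y l)" by (rule sum.permute[OF perm, symmetric])
    moreover have "Transposition.transpose i j l \<in> {1..k} \<longleftrightarrow> l \<in> {1..k}" for l by (rule permutes_in_image[OF perm])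
    ultimately show ?thesis using that unfolding Ykd_def mem_Collect_eq comp_apply by blast
  qed
  show ?thesis
    by (rule sum.reindex_bij_witness[where i="\<lambda>y. y \<circ> Transposition.transpose i j" and j="\<lambda>y. y \<circ> Transposition.transpose i j"])
       (use * in \<open>auto simp: comp_assoc\<close>)
qed

lemma Ykd_coord: "y \<in> Ykd k d \<Longrightarrow> i \<in> {1..k} \<Longrightarrow> y i = 0 \<or> y i = 1"
  unfolding Ykd_def by blast

lemma Ykd_sum: "y \<in> Ykd k d \<Longrightarrow> (\<Sum>i=1..k. real (y i)) = real d"
  unfolding Ykd_def by (auto simp flip: of_nat_sum)

text \<open>Double counting: all positions contribute equally by symmetry, and together they count
  every word \<open>d\<close> times.\<close>

lemma sum_Ykd_coord:
  assumes i: "i \<in> {1..k}" and d: "d \<ge> 1"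
  shows "(\<Sum>y\<in>Ykd k d. real (y i)) = real ((k - 1) choose (d - 1))"
proof -
  have eq: "(\<Sum>y\<in>Ykd k d. real (y l)) = (\<Sum>y\<in>Ykd k d. real (y i))" if "l \<in> {1..k}" for l
    using sum_Ykd_swap[where d=d and g="\<lambda>y. real (y i)", OF i that] by simp
  have "real k * (\<Sum>y\<in>Ykd k d. real (y i)) = (\<Sum>l=1..k. \<Sum>y\<in>Ykd k d. real (y l))"
    using eq by simp
  also have "\<dots> = (\<Sum>y\<in>Ykd k d. \<Sum>l=1..k. real (y l))" by (rule sum.swap)
  also have "\<dots> = (\<Sum>y\<in>Ykd k d. real d)" by (rule sum.cong[OF refl Ykd_sum])
  also have "\<dots> = real (d * (k choose d))" by (simp add: card_Ykd)
  also have "d * (k choose d) = k * ((k - 1) choose (d - 1))"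
    using binomial_absorption[of "d - 1" "k"] d by simp
  finally show ?thesis using i by simp
qed

text \<open>Double counting again, over the partners of \<open>l\<close>: a word with a one at
  \<open>l\<close> has \<open>d - 1\<close> further ones.\<close>

lemma sum_Ykd_pair:
  assumes i: "i \<in> {1..k}" and l: "l \<in> {1..k}" and il: "i \<noteq> l" and d: "d \<ge> 1"
  shows "(real k - 1) * (\<Sum>y\<in>Ykd k d. real (y i) * real (y l)) = (real d - 1) * real ((k - 1) choose (d - 1))"
proof -
  have eq: "(\<Sum>y\<in>Ykd k d. real (y j) * real (y l)) = (\<Sum>y\<in>Ykd k d. real (y i) * real (y l))" if "j \<in> {1..k} - {l}" for j
    using sum_Ykd_swap[where i=i and k=k and j=j and d=d and g="\<lambda>y. real (y i) * real (y l)"] i il that by simp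
  have sq: "real (y l) * real (y l) = real (y l)" if "y \<in> Ykd k d" for y
    using Ykd_coord[OF that l] by auto
  have "(real k - 1) * (\<Sum>y\<in>Ykd k d. real (y i) * real (y l)) = (\<Sum>j\<in>{1..k} - {l}. \<Sum>y\<in>Ykd k d. real (y j) * real (y l))"
    using eq l by (simp add: of_nat_diff)
  also have "\<dots> = (\<Sum>y\<in>Ykd k d. \<Sum>j\<in>{1..k} - {l}. real (y j) * real (y l))" by (rule sum.swap)
  also have "\<dots> = (\<Sum>y\<in>Ykd k d. (real d - 1) * real (y l))"
  proof (rule sum.cong[OF refl])
    fix y assume y: "y \<in> Ykd k d"
    have "(\<Sum>j\<in>{1..k} - {l}. real (y j)) = real d - real (y l)"
      using Ykd_sum[OF y] sum.remove[of "{1..k}" l "\<lambda>j. real (y j)"] l by simp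
    then have "(\<Sum>j\<in>{1..k} - {l}. real (y j) * real (y l)) = (real d - real (y l)) * real (y l)"
      by (simp add: sum_distrib_right[symmetric])
    also have "\<dots> = (real d - 1) * real (y l)" using sq[OF y] by (simp add: algebra_simps)
    finally show "(\<Sum>j\<in>{1..k} - {l}. real (y j) * real (y l)) = (real d - 1) * real (y l)" .
  qed
  also have "\<dots> = (real d - 1) * real ((k - 1) choose (d - 1))"
    using sum_Ykd_coord[OF l d] by (simp add: sum_distrib_left[symmetric])
  finally show ?thesis .
qed

section \<open>Output probabilities of the subset mechanism\<close>

locale subset_mechanism =
  fixes k d :: nat and \<epsilon> :: real
  assumes k2: "k \<ge> 2" and d1: "d \<ge> 1" and dk: "d \<le> k - 1" and eps: "\<epsilon> > 0"
begin

definition Z :: real where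
  "Z = real ((k - 1) choose (d - 1)) * exp \<epsilon> + real ((k - 1) choose d)"

definition w :: "nat \<Rightarrow> (nat \<Rightarrow> nat) \<Rightarrow> real" where
  "w i y = (exp \<epsilon> * real (y i) + (1 - real (y i))) / Z"

text \<open>Probabilities that bit \<open>i\<close> of the output is set when the input is
  \<open>i\<close> (\<open>pa\<close>) and when it is another letter (\<open>pb\<close>). The second
  follows from the first since every output has exactly \<open>d\<close> ones.\<close>

definition pa :: real where "pa = real d * exp \<epsilon> / (real d * exp \<epsilon> + real k - real d)"
definition pb :: real where "pb = (real d - pa) / (real k - 1)"

lemma exp_gt1: "exp \<epsilon> > 1" using eps by simp

lemma den_pos: "real d * exp \<epsilon> + real k - real d > 0"
proof -
  have "real d * exp \<epsilon> > 0" "real d \<le> real k" using d1 dk by auto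
  then show ?thesis by linarith
qed

lemma dk_real: "real d < real k" "real d \<ge> 1" "real k \<ge> 2"
  using k2 d1 dk by linarith+

lemma N1_pos: "real ((k - 1) choose (d - 1)) > 0"
  using d1 dk by simp

text \<open>Absorption expresses the second binomial of \<open>Z\<close> through the first, which
  then cancels from all probabilities.\<close>

lemma Z_eq: "Z = real ((k - 1) choose (d - 1)) * (real d * exp \<epsilon> + real k - real d) / real d"
proof -
  have "d * (k choose d) = k * ((k - 1) choose (d - 1))"
    using binomial_absorption[of "d - 1" "k"] d1 by simp
  moreover have "k choose d = ((k - 1) choose (d - 1)) + ((k - 1) choose d)"
    using choose_reduce_nat[of k d] k2 d1 by simp
  ultimately have "d * ((k - 1) choose d) + d * ((k - 1) choose (d - 1)) = k * ((k - 1) choose (d - 1))"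
    by (simp add: algebra_simps)
  then have "real d * real ((k - 1) choose d) = (real k - real d) * real ((k - 1) choose (d - 1))"
    by (simp add: algebra_simps flip: of_nat_mult of_nat_add)
  then show ?thesis unfolding Z_def using d1 by (simp add: field_simps)
qed

lemma Z_pos: "Z > 0"
  unfolding Z_eq using N1_pos den_pos d1 by simp

lemma w_nonneg: "y \<in> Ykd k d \<Longrightarrow> i \<in> {1..k} \<Longrightarrow> w i y \<ge> 0"
  using Ykd_coord[of y k d i] Z_pos by (auto simp: w_def)

lemma sum_w: "i \<in> {1..k} \<Longrightarrow> (\<Sum>y\<in>Ykd k d. w i y) = 1"
proof -
  assume i: "i \<in> {1..k}"
  have "(\<Sum>y\<in>Ykd k d. w i y) = ((exp \<epsilon> - 1) * (\<Sum>y\<in>Ykd k d. real (y i)) + real (card (Ykd k d))) / Z"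
    unfolding w_def sum_divide_distrib[symmetric] by (simp add: algebra_simps sum.distrib sum_subtractf sum_distrib_left)
  also have "(exp \<epsilon> - 1) * (\<Sum>y\<in>Ykd k d. real (y i)) + real (card (Ykd k d)) = Z"
    using choose_reduce_nat[of k d] k2 d1 by (simp add: sum_Ykd_coord[OF i d1] card_Ykd Z_def algebra_simps)
  finally show ?thesis using Z_pos by simp
qed

lemma sum_w_coord:
  assumes i: "i \<in> {1..k}" and l: "l \<in> {1..k}"
  shows "(\<Sum>y\<in>Ykd k d. w l y * real (y i)) = (if i = l then pa else pb)"
proof -
  define N where "N = real ((k - 1) choose (d - 1))"
  define D where "D = real d * exp \<epsilon> + real k - real d"
  have pos: "N > 0" "D > 0" "real d > 0" "real k - 1 > 0" using N1_pos den_pos dk_real by (auto simp: N_def D_def)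
  have Z: "Z = N * D / real d" unfolding Z_eq N_def D_def ..
  have e: "(\<Sum>y\<in>Ykd k d. w l y * real (y i)) = (N + (exp \<epsilon> - 1) * (\<Sum>y\<in>Ykd k d. real (y i) * real (y l))) / Z"
  proof -
    have "(\<Sum>y\<in>Ykd k d. w l y * real (y i)) = (\<Sum>y\<in>Ykd k d. real (y i) + (exp \<epsilon> - 1) * (real (y i) * real (y l))) / Z"
      unfolding w_def sum_divide_distrib by (intro sum.cong refl) (simp add: algebra_simps)
    then show ?thesis by (simp add: sum.distrib sum_distrib_left[symmetric] sum_Ykd_coord[OF i d1] N_def)
  qed
  show ?thesis
  proof (cases "i = l")
    case True
    have "(\<Sum>y\<in>Ykd k d. real (y i) * real (y l)) = (\<Sum>y\<in>Ykd k d. real (y i))"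
      using Ykd_coord[of _ k d i] i True by (intro sum.cong refl) fastforce
    then have "(\<Sum>y\<in>Ykd k d. w l y * real (y i)) = N * exp \<epsilon> / Z"
      unfolding e by (simp add: sum_Ykd_coord[OF i d1] N_def algebra_simps)
    also have "\<dots> = pa" unfolding Z pa_def D_def[symmetric] using pos by simp
    finally show ?thesis using True by simp
  next
    case False
    define P where "P = (\<Sum>y\<in>Ykd k d. real (y i) * real (y l))"
    have "(real k - 1) * P = (real d - 1) * N" using sum_Ykd_pair[OF i l False d1] by (simp add: P_def N_def)
    then have P: "P = (real d - 1) * N / (real k - 1)" using pos by (simp add: field_simps)
    have "(N + (exp \<epsilon> - 1) * P) / Z = (real d - real d * exp \<epsilon> / D) / (real k - 1)"
    proof -
      have "(N + (exp \<epsilon> - 1) * P) / Z = real d * ((real k - 1) + (exp \<epsilon> - 1) * (real d - 1)) / ((real k - 1) * D)"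
        unfolding P Z using pos by (simp add: field_simps)
      also have "(real k - 1) + (exp \<epsilon> - 1) * (real d - 1) = D - exp \<epsilon>" by (simp add: D_def algebra_simps)
      also have "real d * (D - exp \<epsilon>) / ((real k - 1) * D) = (real d - real d * exp \<epsilon> / D) / (real k - 1)"
        using pos by (simp add: field_simps)
      finally show ?thesis .
    qed
    then show ?thesis unfolding e P_def[symmetric] using False by (simp add: pb_def pa_def D_def)
  qed
qed

lemma emeasure_Qkd: "S \<subseteq> Ykd k d \<Longrightarrow> i \<in> {1..k} \<Longrightarrow> emeasure (Qkd k \<epsilon> d i) S = ennreal (\<Sum>y\<in>S. w i y)"
proof -
  assume S: "S \<subseteq> Ykd k d" and i: "i \<in> {1..k}"
  have "emeasure (Qkd k \<epsilon> d i) S = (\<Sum>y\<in>S. ennreal (w i y))"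
    unfolding Qkd_def w_def Z_def by (rule emeasure_point_measure_finite[OF finite_Ykd S])
  also have "\<dots> = ennreal (\<Sum>y\<in>S. w i y)"
    by (rule sum_ennreal) (use S in \<open>blast intro: w_nonneg[OF _ i]\<close>)
  finally show ?thesis .
qed

lemma mech: "mechanism k (Ykd_space k d) (Qkd k \<epsilon> d)"
  unfolding mechanism_def
proof (intro ballI conjI)
  fix i assume i: "i \<in> {1..k}"
  show "prob_space (Qkd k \<epsilon> d i)"
  proof
    have "space (Qkd k \<epsilon> d i) = Ykd k d" by (simp add: Qkd_def space_point_measure)
    then show "emeasure (Qkd k \<epsilon> d i) (space (Qkd k \<epsilon> d i)) = 1"
      using emeasure_Qkd[OF subset_refl i] sum_w[OF i] by simp
  qed
  show "sets (Qkd k \<epsilon> d i) = sets (Ykd_space k d)" by (simp add: Qkd_def Ykd_space_def sets_point_measure)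
qed

lemma pa_pb: "0 < pb" "pa < 1" "pb < pa" "pa + (real k - 1) * pb = real d"
proof -
  have D: "real d * exp \<epsilon> + real k - real d > 0" by (rule den_pos)
  show pa1: "pa < 1" unfolding pa_def using D dk_real by (simp add: divide_less_eq)
  show "0 < pb" unfolding pb_def using pa1 dk_real by simp
  show e: "pa + (real k - 1) * pb = real d" unfolding pb_def using dk_real by simp
  have "real d < real k * pa"
  proof -
    have "real d * (real d * exp \<epsilon> + real k - real d) < real d * (real k * exp \<epsilon>)"
    proof (rule mult_strict_left_mono)
      have "(real k - real d) * 1 < (real k - real d) * exp \<epsilon>" using dk_real exp_gt1 by (intro mult_strict_left_mono) auto
      then show "real d * exp \<epsilon> + real k - real d < real k * exp \<epsilon>" by (simp add: algebra_simps)
    qed (use dk_real in simp)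
    then show ?thesis unfolding pa_def using D by (simp add: less_divide_eq mult_ac)
  qed
  then have "(real k - 1) * pb < (real k - 1) * pa" using e by (simp add: algebra_simps)
  then show "pb < pa" using dk_real by simp
qed

lemma pa_minus_pb: "pa - pb = real d * (exp \<epsilon> - 1) * (real k - real d) / ((real k - 1) * (real d * exp \<epsilon> + real k - real d))"
proof -
  define D where "D = real d * exp \<epsilon> + real k - real d"
  have pos: "D > 0" "real k - 1 > 0" using den_pos dk_real by (auto simp: D_def)
  have "pa - pb = (real k * pa - real d) / (real k - 1)" unfolding pb_def using pos by (simp add: field_simps)
  also have "real k * pa - real d = real d * (real k * exp \<epsilon> - D) / D" unfolding pa_def D_def[symmetric] using pos by (simp add: field_simps)
  also have "real k * exp \<epsilon> - D = (exp \<epsilon> - 1) * (real k - real d)" by (simp add: D_def algebra_simps)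
  finally show ?thesis unfolding D_def[symmetric] by (simp add: mult_ac)
qed

text \<open>The chance that bit \<open>i\<close> is set under \<open>p\<close>, as
  \<open>prob_coord\<close> shows. It is affine in \<open>p i\<close>, and the empirical estimator
  inverts it.\<close>

definition q :: "(nat \<Rightarrow> real) \<Rightarrow> nat \<Rightarrow> real" where "q p i = pb + (pa - pb) * p i"

lemma prob_coord:
  assumes p: "p \<in> prob_simplex k" and i: "i \<in> {1..k}"
  shows "measure (mix k (Ykd_space k d) (Qkd k \<epsilon> d) p) {y \<in> Ykd k d. y i = 1} = q p i"
proof -
  have p0: "\<And>i. i \<in> {1..k} \<Longrightarrow> 0 \<le> p i" and p1: "(\<Sum>i=1..k. p i) = 1" using p by (auto simp: prob_simplex_def)
  let ?S = "{y \<in> Ykd k d. y i = 1}"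
  have w1: "(\<Sum>y\<in>?S. w l y) = (if i = l then pa else pb)" if l: "l \<in> {1..k}" for l
  proof -
    have "(\<Sum>y\<in>?S. w l y) = (\<Sum>y\<in>Ykd k d. if y i = 1 then w l y else 0)" by (rule sum.inter_filter) simp
    also have "\<dots> = (\<Sum>y\<in>Ykd k d. w l y * real (y i))"
      using Ykd_coord[of _ k d i] i by (intro sum.cong refl) fastforce
    finally show ?thesis using sum_w_coord[OF i l] by simp
  qed
  have ab: "pa \<ge> 0" "pb \<ge> 0" using pa_pb by auto
  have "emeasure (mix k (Ykd_space k d) (Qkd k \<epsilon> d) p) ?S = (\<Sum>l=1..k. ennreal (p l) * ennreal (if i = l then pa else pb))"
    using emeasure_Qkd[of ?S] w1 by (subst emeasure_mix[OF mech]) (auto simp: Ykd_space_def intro!: sum.cong)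
  also have "\<dots> = (\<Sum>l=1..k. ennreal (p l * (if i = l then pa else pb)))"
    by (intro sum.cong refl ennreal_mult'[symmetric] p0)
  also have "\<dots> = ennreal (\<Sum>l=1..k. p l * (if i = l then pa else pb))"
    using p0 ab by (intro sum_ennreal) auto
  also have "(\<Sum>l=1..k. p l * (if i = l then pa else pb)) = (\<Sum>l=1..k. p l * pb + (if i = l then p l * (pa - pb) else 0))"
    by (intro sum.cong refl) (auto simp: algebra_simps)
  also have "\<dots> = q p i" using p1 i by (simp add: sum.distrib sum_distrib_right[symmetric] q_def)
  finally have "emeasure (mix k (Ykd_space k d) (Qkd k \<epsilon> d) p) ?S = ennreal (q p i)" .
  moreover have "q p i \<ge> 0" using p0[OF i] ab pa_pb by (simp add: q_def)
  ultimately show ?thesis by (simp only: measure_def enn2real_ennreal)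
qed

end

text \<open>Serves to match the upper constant with the lower one: \<open>a\<close> is
  \<open>pa - pb\<close>, \<open>K\<close> is \<open>(k - 1) / k\<close> and \<open>V\<close> the
  variance of a bit under uniform inputs. The hypothesis \<open>eq\<close> is the case
  \<open>u = 2\<close>.\<close>

lemma powr_balance:
  fixes a K V c u :: real
  assumes pos: "a > 0" "K > 0" "V > 0" "c > 0" and eq: "a\<^sup>2 * K\<^sup>2 = V * c"
  shows "a powr (- u) * V powr (u / 2) = K powr u * c powr (- u / 2)"
proof -
  have "a powr u * K powr u = (a * K) powr u" using pos by (simp add: powr_mult)
  also have "\<dots> = ((a * K) powr 2) powr (u / 2)" by (simp add: powr_powr)
  also have "(a * K) powr 2 = V * c" using pos eq by (simp add: powr_numeral power_mult_distrib)
  also have "(V * c) powr (u / 2) = V powr (u / 2) * c powr (u / 2)" using pos by (simp add: powr_mult)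
  finally have "a powr u * K powr u = V powr (u / 2) * c powr (u / 2)" .
  moreover have "a powr u > 0" "c powr (u / 2) > 0" using pos by auto
  ultimately show ?thesis by (simp add: powr_minus field_simps)
qed

context subset_mechanism
begin

text \<open>The third bound keeps the variances away from zero over the whole simplex, so that the
  standardised bits are scores with one common bound.\<close>

lemma q_bounds:
  assumes p: "p \<in> prob_simplex k" and i: "i \<in> {1..k}"
  shows "pb \<le> q p i" "q p i \<le> pa" "pb * (1 - pa) \<le> q p i * (1 - q p i)"
proof -
  have p0: "\<And>i. i \<in> {1..k} \<Longrightarrow> 0 \<le> p i" and p1: "(\<Sum>i=1..k. p i) = 1" using p by (auto simp: prob_simplex_def)
  have "p i \<le> (\<Sum>i=1..k. p i)" using i p0 by (intro member_le_sum) auto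
  then have pi: "0 \<le> p i" "p i \<le> 1" using p0[OF i] p1 by auto
  show 1: "pb \<le> q p i" using pi pa_pb by (simp add: q_def)
  have "(pa - pb) * p i \<le> (pa - pb) * 1" using pi pa_pb by (intro mult_left_mono) auto
  then show 2: "q p i \<le> pa" by (simp add: q_def)
  show "pb * (1 - pa) \<le> q p i * (1 - q p i)" using 1 2 pa_pb by (intro mult_mono) auto
qed

lemma sum_q: "p \<in> prob_simplex k \<Longrightarrow> (\<Sum>i=1..k. q p i) = real d"
proof -
  assume p: "p \<in> prob_simplex k"
  have "(\<Sum>i=1..k. q p i) = real k * pb + (pa - pb) * (\<Sum>i=1..k. p i)"
    unfolding q_def sum.distrib sum_distrib_left by simp
  also have "(\<Sum>i=1..k. p i) = 1" using p by (simp add: prob_simplex_def)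
  finally show ?thesis using pa_pb(4) by (simp add: algebra_simps)
qed

text \<open>Tangent line of the concave function \<open>x powr (u / 2)\<close> at the variance
  \<open>v\<close> of the uniform case. Since the \<open>q p i\<close> always add up to
  \<open>d\<close>, the sum of the variances is largest when all of them equal
  \<open>d / k\<close>.\<close>

lemma sum_variance_powr_le:
  assumes p: "p \<in> prob_simplex k" and u: "0 < u" "u \<le> 2"
  shows "(\<Sum>i=1..k. sqrt (q p i * (1 - q p i)) powr u) \<le> real k * (real d / real k * (1 - real d / real k)) powr (u / 2)"
proof -
  define v where "v = real d / real k * (1 - real d / real k)"
  have v: "v > 0" unfolding v_def using dk_real by (simp add: divide_less_eq)
  have nn: "q p i * (1 - q p i) \<ge> 0" if "i \<in> {1..k}" for i
    using q_bounds[OF p that] pa_pb by (intro mult_nonneg_nonneg) auto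
  have pt: "sqrt (q p i * (1 - q p i)) powr u \<le> v powr (u / 2) * (1 + u / 2 * (q p i * (1 - q p i) / v - 1))" if i: "i \<in> {1..k}" for i
  proof -
    have "sqrt (q p i * (1 - q p i)) powr u = (q p i * (1 - q p i)) powr (u / 2)"
      using nn[OF i] by (simp add: powr_half_sqrt[symmetric] powr_powr)
    also have "\<dots> = v powr (u / 2) * (q p i * (1 - q p i) / v) powr (u / 2)"
      using nn[OF i] v by (simp add: powr_mult[symmetric])
    also have "\<dots> \<le> v powr (u / 2) * (1 + u / 2 * (q p i * (1 - q p i) / v - 1))"
      using nn[OF i] v u by (intro mult_left_mono powr_Bernoulli_concave) auto
    finally show ?thesis .
  qed
  have sv: "(\<Sum>i=1..k. q p i * (1 - q p i)) \<le> real k * v"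
  proof -
    have "(\<Sum>i=1..k. (q p i - real d / real k)\<^sup>2) \<ge> 0" by (intro sum_nonneg) auto
    also have "(\<Sum>i=1..k. (q p i - real d / real k)\<^sup>2) = (\<Sum>i=1..k. (q p i)\<^sup>2) - 2 * (real d / real k) * (\<Sum>i=1..k. q p i) + real k * (real d / real k)\<^sup>2"
      by (simp add: power2_diff sum.distrib sum_subtractf sum_distrib_left mult_ac)
    also have "\<dots> = (\<Sum>i=1..k. (q p i)\<^sup>2) - real k * (real d / real k)\<^sup>2"
      unfolding sum_q[OF p] using dk_real by (simp add: power2_eq_square field_simps)
    finally have "real k * (real d / real k)\<^sup>2 \<le> (\<Sum>i=1..k. (q p i)\<^sup>2)" by simp
    moreover have "(\<Sum>i=1..k. q p i * (1 - q p i)) = (\<Sum>i=1..k. q p i) - (\<Sum>i=1..k. (q p i)\<^sup>2)"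
      by (simp add: algebra_simps power2_eq_square sum_subtractf)
    moreover have "real d - real k * (real d / real k)\<^sup>2 = real k * v"
      using dk_real by (simp add: v_def power2_eq_square field_simps)
    ultimately show ?thesis unfolding sum_q[OF p] by linarith
  qed
  have "(\<Sum>i=1..k. sqrt (q p i * (1 - q p i)) powr u) \<le> (\<Sum>i=1..k. v powr (u / 2) * (1 + u / 2 * (q p i * (1 - q p i) / v - 1)))"
    by (rule sum_mono) (rule pt)
  also have "\<dots> = v powr (u / 2) * (real k + u / 2 * ((\<Sum>i=1..k. q p i * (1 - q p i)) / v - real k))"
    by (simp add: sum_distrib_left[symmetric] sum.distrib sum_subtractf sum_divide_distrib[symmetric])
  also have "\<dots> \<le> v powr (u / 2) * real k"
  proof (rule mult_left_mono)
    have "(\<Sum>i=1..k. q p i * (1 - q p i)) / v \<le> real k" using sv v by (simp add: divide_le_eq)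
    then have "u / 2 * ((\<Sum>i=1..k. q p i * (1 - q p i)) / v - real k) \<le> 0" using u by (intro mult_nonneg_nonpos) auto
    then show "real k + u / 2 * ((\<Sum>i=1..k. q p i * (1 - q p i)) / v - real k) \<le> real k" by simp
  qed simp
  finally show ?thesis by (simp add: v_def mult.commute)
qed

text \<open>The coefficients of the estimator are \<open>1 / (pa - pb)\<close> and
  \<open>pb / (pa - pb)\<close>, so it applies the inverse of \<open>q\<close> to the empirical
  frequency. The error is then a standardised sum.\<close>

lemma emp_est_error:
  assumes y: "\<And>j. j < n \<Longrightarrow> y j i = 0 \<or> y j i = 1" and n: "n > 0" and sg: "\<sigma> > 0"
  shows "emp_est k \<epsilon> d n y i - p i = \<sigma> / ((pa - pb) * sqrt (real n)) * nsum n (\<lambda>z. (of_bool (z i = 1) - q p i) / \<sigma>) y"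
proof -
  define D where "D = real d * exp \<epsilon> + real k - real d"
  define t where "t = real (\<Sum>j<n. y j i)"
  have D: "D > 0" unfolding D_def by (rule den_pos)
  have E: "exp \<epsilon> - 1 > 0" using exp_gt1 by simp
  have kd: "real (k - d) = real k - real d" "real (k - 1) = real k - 1" "real (d - 1) = real d - 1"
    using dk_real d1 k2 dk by (auto simp: of_nat_diff)
  have pos: "real k - real d > 0" "real d > 0" "real k - 1 > 0" using dk_real by auto
  have ab: "pa - pb = real d * (exp \<epsilon> - 1) * (real k - real d) / ((real k - 1) * D)" unfolding D_def by (rule pa_minus_pb)
  have ab0: "pa - pb > 0" using pa_pb by simp
  have c1: "(real (k - 1) * exp \<epsilon> + real (k - 1) * real (k - d) / real d) / (real (k - d) * (exp \<epsilon> - 1)) = 1 / (pa - pb)"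
  proof -
    have "real (k - 1) * exp \<epsilon> + real (k - 1) * real (k - d) / real d = (real k - 1) * D / real d"
      unfolding kd D_def using pos by (simp add: field_simps)
    then show ?thesis unfolding ab kd using pos D E by simp
  qed
  have c2: "(real (d - 1) * exp \<epsilon> + real (k - d)) / (real (k - d) * (exp \<epsilon> - 1)) = pb / (pa - pb)"
  proof -
    have "pb = real d * (D - exp \<epsilon>) / ((real k - 1) * D)"
      unfolding pb_def pa_def D_def[symmetric] using pos D by (simp add: field_simps)
    then have "pb / (pa - pb) = (D - exp \<epsilon>) / ((exp \<epsilon> - 1) * (real k - real d))"
      unfolding ab using pos D E by simp
    also have "D - exp \<epsilon> = real (d - 1) * exp \<epsilon> + real (k - d)" unfolding D_def kd by (simp add: algebra_simps)
    finally show ?thesis unfolding kd by (simp add: mult.commute)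
  qed
  have "nsum n (\<lambda>z. (of_bool (z i = 1) - q p i) / \<sigma>) y = (\<Sum>j<n. (real (y j i) - q p i) / (\<sigma> * sqrt (real n)))"
    unfolding nsum_def by (intro sum.cong refl) (use y in fastforce)
  also have "\<dots> = (t - real n * q p i) / (\<sigma> * sqrt (real n))"
    by (simp add: sum_divide_distrib[symmetric] sum_subtractf t_def)
  finally have ns: "nsum n (\<lambda>z. (of_bool (z i = 1) - q p i) / \<sigma>) y = (t - real n * q p i) / (\<sigma> * sqrt (real n))" .
  have sq: "sqrt (real n) * sqrt (real n) = real n" by simp
  have "\<sigma> / ((pa - pb) * s) * (x / (\<sigma> * s)) = x / ((pa - pb) * (s * s))" for s x
    using sg by simp
  from this[of "sqrt (real n)" "t - real n * q p i"]
  have "\<sigma> / ((pa - pb) * sqrt (real n)) * ((t - real n * q p i) / (\<sigma> * sqrt (real n))) = (t - real n * q p i) / ((pa - pb) * real n)"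
    unfolding sq .
  also have "\<dots> = (t / real n - q p i) / (pa - pb)" using n ab0 by (simp add: field_simps)
  also have "\<dots> = 1 / (pa - pb) * (t / real n) - pb / (pa - pb) - p i"
  proof -
    have "(x - (pb + a * z)) / a = 1 / a * x - pb / a - z" if "a > 0" for a x z :: real
      using that by (simp add: field_simps)
    then show ?thesis unfolding q_def using ab0 by blast
  qed
  also have "\<dots> = emp_est k \<epsilon> d n y i - p i" unfolding emp_est_def c1 c2 t_def by simp
  finally show ?thesis unfolding ns by simp
qed

lemma coord_score:
  assumes p: "p \<in> prob_simplex k" and i: "i \<in> {1..k}"
  defines "N \<equiv> mix k (Ykd_space k d) (Qkd k \<epsilon> d) p" and "\<sigma> \<equiv> sqrt (q p i * (1 - q p i))"
  shows "score (1 / sqrt (pb * (1 - pa))) N (\<lambda>z. (of_bool (z i = 1) - q p i) / \<sigma>)"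
    and "(\<integral>z. ((of_bool (z i = 1) - q p i) / \<sigma>)\<^sup>2 \<partial>N) = 1"
proof -
  have p0: "\<And>i. i \<in> {1..k} \<Longrightarrow> 0 \<le> p i" and p1: "(\<Sum>i=1..k. p i) = 1" using p by (auto simp: prob_simplex_def)
  have PN: "prob_space N" unfolding N_def by (rule prob_space_mix[OF mech p0 p1])
  interpret N: prob_space N by (rule PN)
  have sN[measurable_cong]: "sets N = sets (count_space (Ykd k d))" by (simp add: N_def Ykd_space_def)
  have spN: "space N = Ykd k d" by (simp add: N_def Ykd_space_def)
  have meas: "g \<in> borel_measurable N" for g :: "(nat \<Rightarrow> nat) \<Rightarrow> real"
    unfolding measurable_cong_sets[OF sN refl] by simp
  define S where "S = {y \<in> Ykd k d. y i = 1}"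
  have S: "S \<in> sets N" by (simp add: sN S_def)
  have mS: "measure N S = q p i" unfolding N_def S_def by (rule prob_coord[OF p i])
  have qb: "q p i > 0" "1 - q p i > 0" using q_bounds[OF p i] pa_pb by auto
  have v: "q p i * (1 - q p i) > 0" using qb by simp
  then have sg: "\<sigma> > 0" "\<sigma>\<^sup>2 = q p i * (1 - q p i)" by (auto simp: \<sigma>_def)
  have ind: "of_bool (z i = 1) = (indicator S z :: real)" if "z \<in> space N" for z
    using that by (auto simp: S_def spN indicator_def)
  have int: "integrable N (\<lambda>z. of_bool (z i = 1) :: real)"
    by (rule N.integrable_const_bound[where B=1]) (auto simp: meas)
  have "(\<integral>z. of_bool (z i = 1) \<partial>N) = (\<integral>z. (indicator S z :: real) \<partial>N)"
    by (rule Bochner_Integration.integral_cong[OF refl ind])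
  also have "\<dots> = q p i" using S mS by simp
  finally have I: "(\<integral>z. of_bool (z i = 1) \<partial>N) = q p i" .
  have mean: "(\<integral>z. (of_bool (z i = 1) - q p i) / \<sigma> \<partial>N) = 0"
    using int I by (simp add: N.prob_space)
  \<comment> \<open>A bit equals its square, so the squared deviation is affine in the bit and only
    its mean is needed.\<close>
  have "(\<integral>z. ((of_bool (z i = 1) - q p i) / \<sigma>)\<^sup>2 \<partial>N) = (\<integral>z. ((1 - 2 * q p i) * of_bool (z i = 1) + (q p i)\<^sup>2) / \<sigma>\<^sup>2 \<partial>N)"
    by (intro Bochner_Integration.integral_cong refl) (auto simp: power_divide power2_eq_square algebra_simps)
  also have "\<dots> = ((1 - 2 * q p i) * q p i + (q p i)\<^sup>2) / \<sigma>\<^sup>2"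
    using int I by (simp add: N.prob_space)
  also have "(1 - 2 * q p i) * q p i + (q p i)\<^sup>2 = \<sigma>\<^sup>2" unfolding sg(2) by (simp add: power2_eq_square algebra_simps)
  finally show "(\<integral>z. ((of_bool (z i = 1) - q p i) / \<sigma>)\<^sup>2 \<partial>N) = 1" using sg(1) by simp
  have "\<bar>(of_bool (z i = 1) - q p i) / \<sigma>\<bar> \<le> 1 / sqrt (pb * (1 - pa))" for z
  proof -
    have "\<bar>of_bool (z i = 1) - q p i\<bar> \<le> 1" using qb by (auto simp: of_bool_def)
    moreover have "sqrt (pb * (1 - pa)) \<le> \<sigma>" unfolding \<sigma>_def using q_bounds(3)[OF p i] by simp
    moreover have "sqrt (pb * (1 - pa)) > 0" using pa_pb by simp
    ultimately show ?thesis using sg(1) by (simp add: abs_divide frac_le)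
  qed
  then show "score (1 / sqrt (pb * (1 - pa))) N (\<lambda>z. (of_bool (z i = 1) - q p i) / \<sigma>)"
    unfolding score_def using PN meas mean by blast
qed

theorem emp_est_risk_upper_bound:
  assumes u: "0 < u" "u \<le> 2" and \<eta>: "\<eta> > 0"
  defines "c \<equiv> real d * (real k - real d) * (exp \<epsilon> - 1)\<^sup>2 / (real d * exp \<epsilon> + real k - real d)\<^sup>2"
  shows "\<forall>\<^sub>F n in sequentially. risk k n u (Ykd_space k d) (Qkd k \<epsilon> d) (emp_est k \<epsilon> d n) \<le>
    ennreal (asymptotic_risk k u c (gauss_moment u + \<eta>) n)"
proof -
  define B where "B = 1 / sqrt (pb * (1 - pa))"
  have B: "B \<ge> 0"
  proof -
    have "pb * (1 - pa) \<le> 1 * 1" using pa_pb by (intro mult_mono) auto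
    moreover have "pb * (1 - pa) > 0" using pa_pb by simp
    ultimately show ?thesis unfolding B_def by simp
  qed
  have ab0: "pa - pb > 0" using pa_pb by simp
  \<comment> \<open>The variance on the left is that of a bit under uniform inputs; here the
    constant of the empirical estimator turns out to be the one of the lower bound.\<close>
  have const: "(pa - pb) powr (- u) * (real d / real k * (1 - real d / real k)) powr (u / 2) = ((real k - 1) / real k) powr u * c powr (- u / 2)"
  proof -
    define D where "D = real d * exp \<epsilon> + real k - real d"
    have D: "D > 0" unfolding D_def by (rule den_pos)
    have E: "exp \<epsilon> - 1 > 0" using exp_gt1 by simp
    have pos: "real k - real d > 0" "real d > 0" "real k - 1 > 0" "real k > 0" using dk_real by auto
    have c: "c > 0" unfolding c_def using pos E den_pos by simp
    have v: "real d / real k * (1 - real d / real k) > 0" using pos by (simp add: field_simps)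
    have "(pa - pb)\<^sup>2 * ((real k - 1) / real k)\<^sup>2 = real d / real k * (1 - real d / real k) * c"
    proof -
      have "pa - pb = real d * (exp \<epsilon> - 1) * (real k - real d) / ((real k - 1) * D)" unfolding D_def by (rule pa_minus_pb)
      then have "(pa - pb) * ((real k - 1) / real k) = real d * (exp \<epsilon> - 1) * (real k - real d) / (real k * D)"
        using pos by simp
      then have "((pa - pb) * ((real k - 1) / real k))\<^sup>2 = (real d * (exp \<epsilon> - 1) * (real k - real d))\<^sup>2 / (real k * D)\<^sup>2"
        by (simp add: power_divide)
      moreover have "real d / real k * (1 - real d / real k) = real d * (real k - real d) / (real k)\<^sup>2"
        using pos by (simp add: field_simps power2_eq_square)
      ultimately show ?thesis unfolding c_def D_def[symmetric] by (simp add: power_mult_distrib power2_eq_square mult_ac)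
    qed
    then show ?thesis by (intro powr_balance) (use ab0 pos v c in auto)
  qed
  show ?thesis using absolute_moment_clt[OF u B \<eta>, where 'b="nat \<Rightarrow> nat"] eventually_gt_at_top[of 0]
  proof eventually_elim
    case (elim n)
    note clt = elim(1)[rule_format] and n = elim(2)
    show ?case unfolding risk_def
    proof (rule SUP_least)
      fix p assume p: "p \<in> prob_simplex k"
      define N where "N = mix k (Ykd_space k d) (Qkd k \<epsilon> d) p"
      have p0: "\<And>i. i \<in> {1..k} \<Longrightarrow> 0 \<le> p i" and p1: "(\<Sum>i=1..k. p i) = 1" using p by (auto simp: prob_simplex_def)
      have spN: "space N = Ykd k d" by (simp add: N_def Ykd_space_def)
      define P where "P = iid n N"
      define \<sigma> where "\<sigma> i = sqrt (q p i * (1 - q p i))" for i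
      define f where "f i z = (of_bool (z i = 1) - q p i) / \<sigma> i" for i and z :: "nat \<Rightarrow> nat"
      have sg: "\<sigma> i > 0" if "i \<in> {1..k}" for i
      proof -
        have "q p i > 0" "1 - q p i > 0" using q_bounds[OF p that] pa_pb by auto
        then show ?thesis by (simp add: \<sigma>_def)
      qed
      have sc: "score B N (f i)" "(\<integral>z. (f i z)\<^sup>2 \<partial>N) = 1" if "i \<in> {1..k}" for i
        using coord_score[OF p that] unfolding B_def N_def f_def[abs_def] \<sigma>_def by auto
      have mom: "(\<integral>\<^sup>+y. ennreal (\<bar>nsum n (f i) y\<bar> powr u) \<partial>P) \<le> ennreal (gauss_moment u + \<eta>)" if "i \<in> {1..k}" for i
        unfolding P_def using sc[OF that] by (intro clt) auto
      define r where "r i = (\<sigma> i / ((pa - pb) * sqrt (real n))) powr u" for i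
      have err: "\<bar>emp_est k \<epsilon> d n y i - p i\<bar> powr u = r i * \<bar>nsum n (f i) y\<bar> powr u" if i: "i \<in> {1..k}" and y: "y \<in> space P" for i y
      proof -
        have "y j i = 0 \<or> y j i = 1" if "j < n" for j
          using y that Ykd_coord[of "y j" k d i] i by (auto simp: P_def space_PiM spN PiE_iff)
        then have "emp_est k \<epsilon> d n y i - p i = \<sigma> i / ((pa - pb) * sqrt (real n)) * nsum n (f i) y"
          unfolding f_def[abs_def] by (rule emp_est_error) (use n sg[OF i] in auto)
        moreover have "\<bar>s * x\<bar> powr u = s powr u * \<bar>x\<bar> powr u" if "s > 0" for s x :: real
          using that by (simp add: abs_mult powr_mult)
        moreover have "\<sigma> i / ((pa - pb) * sqrt (real n)) > 0" using sg[OF i] ab0 n by simp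
        ultimately show ?thesis unfolding r_def by (simp only:)
      qed
      have rr: "r i = (pa - pb) powr (- u) * real n powr (- u / 2) * \<sigma> i powr u" if "i \<in> {1..k}" for i
      proof -
        have "r i = \<sigma> i powr u / ((pa - pb) powr u * sqrt (real n) powr u)"
          unfolding r_def using sg[OF that] ab0 n by (simp add: powr_divide powr_mult)
        also have "sqrt (real n) powr u = real n powr (u / 2)" by (simp add: powr_half_sqrt[symmetric] powr_powr)
        finally show ?thesis by (simp add: powr_minus_divide)
      qed
      have C0: "gauss_moment u + \<eta> \<ge> 0" using gauss_moment_pos[OF u] \<eta> by simp
      have "(\<integral>\<^sup>+y. ennreal (lu u k (\<lambda>i. emp_est k \<epsilon> d n y i - p i)) \<partial>P) = (\<integral>\<^sup>+y. (\<Sum>i=1..k. ennreal (r i) * ennreal (\<bar>nsum n (f i) y\<bar> powr u)) \<partial>P)"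
      proof (rule nn_integral_cong)
        fix y assume y: "y \<in> space P"
        have "lu u k (\<lambda>i. emp_est k \<epsilon> d n y i - p i) = (\<Sum>i=1..k. r i * \<bar>nsum n (f i) y\<bar> powr u)"
          unfolding lu_def by (intro sum.cong refl err y)
        then show "ennreal (lu u k (\<lambda>i. emp_est k \<epsilon> d n y i - p i)) = (\<Sum>i=1..k. ennreal (r i) * ennreal (\<bar>nsum n (f i) y\<bar> powr u))"
          by (simp add: sum_ennreal ennreal_mult'[symmetric] r_def)
      qed
      also have "\<dots> = (\<Sum>i=1..k. ennreal (r i) * (\<integral>\<^sup>+y. ennreal (\<bar>nsum n (f i) y\<bar> powr u) \<partial>P))"
      proof -
        have m: "(\<lambda>y. ennreal (\<bar>nsum n (f i) y\<bar> powr u)) \<in> borel_measurable P" if "i \<in> {1..k}" for i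
        proof -
          note [measurable] = scoreD(2)[OF sc(1)[OF that]]
          show ?thesis unfolding P_def by measurable
        qed
        then show ?thesis by (subst nn_integral_sum) (auto intro!: sum.cong nn_integral_cmult)
      qed
      also have "\<dots> \<le> (\<Sum>i=1..k. ennreal (r i) * ennreal (gauss_moment u + \<eta>))"
        by (intro sum_mono mult_left_mono mom) auto
      also have "\<dots> = ennreal (\<Sum>i=1..k. r i * (gauss_moment u + \<eta>))"
        using C0 by (subst sum_ennreal[symmetric]) (auto simp: r_def ennreal_mult')
      also have "\<dots> \<le> ennreal (asymptotic_risk k u c (gauss_moment u + \<eta>) n)"
      proof (rule ennreal_leI)
        have "(\<Sum>i=1..k. r i * (gauss_moment u + \<eta>)) = (gauss_moment u + \<eta>) * ((pa - pb) powr (- u) * real n powr (- u / 2)) * (\<Sum>i=1..k. \<sigma> i powr u)"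
          unfolding sum_distrib_left
        proof (intro sum.cong refl)
          fix i assume i: "i \<in> {1..k}"
          show "r i * (gauss_moment u + \<eta>) = (gauss_moment u + \<eta>) * ((pa - pb) powr (- u) * real n powr (- u / 2)) * \<sigma> i powr u"
            unfolding rr[OF i] by (simp only: mult_ac)
        qed
        also have "\<dots> \<le> (gauss_moment u + \<eta>) * ((pa - pb) powr (- u) * real n powr (- u / 2)) * (real k * (real d / real k * (1 - real d / real k)) powr (u / 2))"
          using C0 unfolding \<sigma>_def by (intro mult_left_mono sum_variance_powr_le p u) auto
        also have "\<dots> = real k * ((pa - pb) powr (- u) * (real d / real k * (1 - real d / real k)) powr (u / 2)) * (gauss_moment u + \<eta>) * real n powr (- u / 2)"
          by (simp only: mult_ac)
        finally show "(\<Sum>i=1..k. r i * (gauss_moment u + \<eta>)) \<le> asymptotic_risk k u c (gauss_moment u + \<eta>) n"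
          unfolding const .
      qed
      finally show "(\<integral>\<^sup>+y. ennreal (lu u k (\<lambda>i. emp_est k \<epsilon> d n y i - p i)) \<partial>iid n (mix k (Ykd_space k d) (Qkd k \<epsilon> d) p)) \<le>
        ennreal (asymptotic_risk k u c (gauss_moment u + \<eta>) n)"
        unfolding P_def N_def .
    qed
  qed
qed

end

section \<open>Comparison of the two asymptotic risks\<close>

lemma ennreal_inverse_antimono:
  fixes a b :: ennreal
  assumes "a \<le> b"
  shows "inverse b \<le> inverse a"
proof (cases "a = 0 \<or> b = \<top>")
  case False
  then obtain r s where "a = ennreal r" "b = ennreal s" "0 < r" "0 \<le> s"
    using assms by (cases a; cases b) (auto simp: top_unique)
  with assms show ?thesis by (auto simp: inverse_ennreal intro!: ennreal_leI le_imp_inverse_le)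
qed auto

lemma ennreal_divide_mono:
  fixes a a' b b' :: ennreal
  assumes "a \<le> a'" "b' \<le> b"
  shows "a / b \<le> a' / b'"
  unfolding divide_ennreal_def using assms by (intro mult_mono ennreal_inverse_antimono) auto

theorem theorem1:
  fixes k :: nat and \<epsilon> u :: real and M :: "'b measure" and Q :: "nat \<Rightarrow> 'b measure"
    and ds :: nat
  assumes "k \<ge> 2" and "\<epsilon> > 0" and "1 \<le> u" and "u \<le> 2"
    and "mechanism k M Q" and "ldp k \<epsilon> M Q"
    and "ds \<in> {1..k-1}" and "\<forall>d\<in>{1..k-1}. dstar_obj k \<epsilon> ds \<le> dstar_obj k \<epsilon> d"
  shows "liminf (\<lambda>n. minimax_risk k n u M Q /
                     risk k n u (Ykd_space k ds) (Qkd k \<epsilon> ds) (emp_est k \<epsilon> ds n)) \<ge> 1"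
proof -
  interpret subset_mechanism k ds \<epsilon> by standard (use assms in auto)
  define c where "c = real ds * (real k - real ds) * (exp \<epsilon> - 1)\<^sup>2 / (real ds * exp \<epsilon> + real k - real ds)\<^sup>2"
  have E: "exp \<epsilon> - 1 > 0" using exp_gt1 by simp
  have c0: "c > 0" unfolding c_def using dk_real E den_pos by simp
  \<comment> \<open>\<open>c\<close> is \<open>(exp \<epsilon> - 1)^2\<close> divided by the
    objective at \<open>ds\<close>. Minimality of the objective is therefore maximality of this
    quotient over \<open>d\<close>, as the lower bound requires.\<close>
  have c_opt: "real d * (real k - real d) * (exp \<epsilon> - 1)\<^sup>2 \<le> c * (real d * exp \<epsilon> + real k - real d)\<^sup>2"
    if d: "d \<in> {1..k-1}" for d
  proof -
    define X where "X d = (real d * exp \<epsilon> + real k - real d)\<^sup>2" for d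
    define Y where "Y d = real d * (real k - real d)" for d
    have Y: "Y d > 0" "Y ds > 0" unfolding Y_def using d dk_real by auto
    have X: "X ds > 0" unfolding X_def using den_pos by simp
    have "X ds / Y ds \<le> X d / Y d" using assms(8) d unfolding dstar_obj_def X_def Y_def by blast
    then have "Y d \<le> Y ds / X ds * X d" using X Y by (simp add: field_simps)
    then have "(exp \<epsilon> - 1)\<^sup>2 * Y d \<le> (exp \<epsilon> - 1)\<^sup>2 * (Y ds / X ds * X d)" by (rule mult_left_mono) simp
    then show ?thesis unfolding c_def X_def[symmetric] Y_def[symmetric] by (simp add: mult_ac)
  qed
  have C: "gauss_moment u > 0" using gauss_moment_pos[of u] assms(3,4) by simp
  \<comment> \<open>Quotient of the lower and the upper constant when one slack \<open>h\<close> is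
    used for both \<open>\<kappa>\<close> and \<open>\<eta>\<close>.\<close>
  define \<rho> where "\<rho> h = (c + h) powr (- u / 2) * (gauss_moment u - h) / (c powr (- u / 2) * (gauss_moment u + h))" for h
  have "(\<rho> \<longlongrightarrow> (c + 0) powr (- u / 2) * (gauss_moment u - 0) / (c powr (- u / 2) * (gauss_moment u + 0))) (at_right 0)"
    unfolding \<rho>_def using c0 C by (intro tendsto_intros) auto
  then have \<rho>: "(\<rho> \<longlongrightarrow> 1) (at_right 0)" using c0 C by simp
  show ?thesis
  \<comment> \<open>It suffices to reach every value below 1: such a value is finite and leaves room
    for a positive slack \<open>h\<close>.\<close>
  proof (rule dense_le)
    fix x' :: ennreal assume "x' < 1"
    then obtain x where x: "x' = ennreal x" "0 \<le> x" "x < 1" by (cases x') auto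
    have "\<forall>\<^sub>F h in at_right 0. \<rho> h > x" by (rule order_tendstoD(1)[OF \<rho> x(3)])
    moreover have "\<forall>\<^sub>F h in at_right (0::real). 0 < h \<and> h < gauss_moment u"
      using C by (auto simp: eventually_at_right_field)
    ultimately have "\<forall>\<^sub>F h in at_right 0. \<rho> h > x \<and> 0 < h \<and> h < gauss_moment u" by eventually_elim simp
    then obtain h where h: "\<rho> h > x" "0 < h" "h < gauss_moment u"
      using eventually_happens'[OF trivial_limit_at_right_real] by blast
    have lower: "\<forall>\<^sub>F n in sequentially. ennreal (asymptotic_risk k u (c + h) (gauss_moment u - h) n) \<le> minimax_risk k n u M Q"
      by (rule ldp_minimax_lower_bound[OF assms(1-6) _ less_imp_le[OF c0] h(2) h(2,3)]) (rule c_opt)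
    have u0: "0 < u" using assms(3) by simp
    note upper = emp_est_risk_upper_bound[OF u0 assms(4) h(2), folded c_def]
    have "\<forall>\<^sub>F n in sequentially. x' \<le> minimax_risk k n u M Q / risk k n u (Ykd_space k ds) (Qkd k \<epsilon> ds) (emp_est k \<epsilon> ds n)"
      using lower upper eventually_gt_at_top[of 0]
    proof eventually_elim
      case (elim n)
      define L where "L = asymptotic_risk k u (c + h) (gauss_moment u - h) n"
      define R where "R = asymptotic_risk k u c (gauss_moment u + h) n"
      have R: "R > 0" unfolding R_def using dk_real c0 C h elim(3) by simp
      have L: "L \<ge> 0" unfolding L_def using h by simp
      have "L / R = \<rho> h" unfolding L_def R_def \<rho>_def using dk_real elim(3) by simp
      then have "x' \<le> ennreal (L / R)" unfolding x(1) using h(1) by (intro ennreal_leI) simp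
      also have "\<dots> = ennreal L / ennreal R" using L R by (simp add: divide_ennreal)
      also have "\<dots> \<le> minimax_risk k n u M Q / risk k n u (Ykd_space k ds) (Qkd k \<epsilon> ds) (emp_est k \<epsilon> ds n)"
        using elim(1,2) assms(3) unfolding L_def R_def by (intro ennreal_divide_mono) auto
      finally show ?case .
    qed
    then show "x' \<le> liminf (\<lambda>n. minimax_risk k n u M Q / risk k n u (Ykd_space k ds) (Qkd k \<epsilon> ds) (emp_est k \<epsilon> ds n))"
      by (rule Liminf_bounded)
  qed
qed

end
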